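(* Fix $r\ge1$. Let $\Theta$ be a bounded subset of $\mathbb{R}^d$. Let $\mathcal{D}=\mathscr{D}_{\alpha G}$, where $G=\sum_{i=1}^k\beta_i\delta_{\theta_i}$ for some $k<\infty$ and $\alpha\in(0,1]$. Let $\alpha_1>\alpha_0>0$ and define $\mathscr{C}=\{\mathscr{D}_{\alpha'G'}:G'\in\mathscr{P}(\Theta),\ \alpha'\in[\alpha_0,\alpha_1]\}$. Then $\mathscr{C}$ has $\alpha^*r$-regular boundary with respect to $\mathcal{D}$, where $\alpha^*=\min_i\alpha\beta_i$.
   Context: $\mathscr{P}(\Theta)$: Borel probability measures on $\Theta$, metrized by $W_r(G,G')=\inf_\kappa[\int\|\theta-\theta'\|^rd\kappa(\theta,\theta')]^{1/r}$ (infimum over couplings of $G,G'$). $\mathscr{D}_{\alpha G}$ denotes the Dirichlet measure on $\mathscr{P}(\Theta)$ with base measure $G$ and concentration $\alpha$ (law of random $Q$ with $(Q(B_1),\dots,Q(B_k))\sim\mathrm{Dir}(\alpha G(B_1),\dots,\alpha G(B_k))$ for every measurable partition). For $\mathscr{B}\subset\mathscr{P}(\Theta)$ and $\delta>0$, $\mathscr{B}_\delta$ is the set of $P\in\mathscr{P}(\Theta)$ for which there is $Q\in\mathscr{B}$ with $W_r(Q,P)\le\delta$. Definition: a class $\mathscr{C}$ of Dirichlet measures has $a$-regular boundary with respect to $\mathcal{D}=\mathscr{D}_{\alpha G}$ (for a constant $a>0$) if there are positive constants $C_0,c_0,c_1$ depending only on $\mathcal{D}$ such that for each $\mathcal{D}'=\mathscr{D}_{\alpha'G'}\in\mathscr{C}$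 there is a measurable $\mathscr{B}\subset\mathscr{P}(\Theta)$ with (i) $\mathcal{D}'(\mathscr{B})-\mathcal{D}(\mathscr{B})\ge c_0W_r^r(G,G')$, and (ii) $\mathcal{D}(\mathscr{B}_\delta\setminus\mathscr{B})\le C_0(\delta/W_r(G,G'))^{a}$ for every $\delta\le c_1W_r(G,G')$. *)

theory Defs
  imports "HOL-Probability.Probability"
begin

definition couplings :: "'a measure \<Rightarrow> 'a measure \<Rightarrow> 'a measure \<Rightarrow> ('a \<times> 'a) measure set" where
  "couplings M G G' = {\<kappa>. \<kappa> \<in> space (prob_algebra (M \<Otimes>\<^sub>M M)) \<and>
      distr \<kappa> M fst = G \<and> distr \<kappa> M snd = G'}"

definition wass :: "real \<Rightarrow> 'a::real_normed_vector measure \<Rightarrow> 'a measure \<Rightarrow> 'a measure \<Rightarrow> real" where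
  "wass r M G G' = (INF \<kappa> \<in> couplings M G G'. \<integral>x. norm (fst x - snd x) powr r \<partial>\<kappa>) powr (1 / r)"

definition gamma_measure :: "real \<Rightarrow> real measure" where
  "gamma_measure a = (if a = 0 then return borel 0
     else density lborel (\<lambda>x. ennreal (if x > 0 then x powr (a - 1) * exp (- x) / Gamma a else 0)))"

text \<open>Dirichlet distribution Dir(a_0,...,a_{k-1}) on R^k (zero parameters give degenerate
  zero coordinates), as the law of normalised independent Gamma variables.\<close>
definition dirichlet_dist :: "nat \<Rightarrow> (nat \<Rightarrow> real) \<Rightarrow> (nat \<Rightarrow> real) measure" where
  "dirichlet_dist k a = distr (PiM {..<k} (\<lambda>i. gamma_measure (a i))) (PiM {..<k} (\<lambda>_. borel))
     (\<lambda>y. \<lambda>i\<in>{..<k}. y i / (\<Sum>j<k. y j))"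

definition is_dirichlet :: "'a measure \<Rightarrow> real \<Rightarrow> 'a measure \<Rightarrow> 'a measure measure \<Rightarrow> bool" where
  "is_dirichlet M \<alpha> G D \<longleftrightarrow> D \<in> space (prob_algebra (prob_algebra M)) \<and>
     (\<forall>k B. (\<forall>i<k. B i \<in> sets M) \<and> disjoint_family_on B {..<k} \<and> (\<Union>i<k. B i) = space M \<longrightarrow>
        distr D (PiM {..<k} (\<lambda>_. borel)) (\<lambda>Q. \<lambda>i\<in>{..<k}. measure Q (B i))
          = dirichlet_dist k (\<lambda>i. \<alpha> * measure G (B i)))"

definition dirichlet_measure :: "'a measure \<Rightarrow> real \<Rightarrow> 'a measure \<Rightarrow> 'a measure measure" where
  "dirichlet_measure M \<alpha> G = (THE D. is_dirichlet M \<alpha> G D)"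

definition enlarge :: "real \<Rightarrow> 'a::real_normed_vector measure \<Rightarrow> 'a measure set \<Rightarrow> real \<Rightarrow> 'a measure set" where
  "enlarge r M \<B> \<delta> = {P \<in> space (prob_algebra M). \<exists>Q\<in>\<B>. wass r M Q P \<le> \<delta>}"

text \<open>The class of Dirichlet measures D_{alpha' G'} with (alpha', G') in Cpar has a-regular
  boundary w.r.t. D_{alpha G}. Condition (ii) is read with outer measure (measurable cover).\<close>
definition regular_boundary ::
  "real \<Rightarrow> 'a::real_normed_vector measure \<Rightarrow> real \<Rightarrow> real \<Rightarrow> 'a measure \<Rightarrow> (real \<times> 'a measure) set \<Rightarrow> bool" where
  "regular_boundary r M a \<alpha> G Cpar \<longleftrightarrow>
    (\<exists>C0>0. \<exists>c0>0. \<exists>c1>0. \<forall>(\<alpha>', G') \<in> Cpar.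
       \<exists>\<B> \<in> sets (prob_algebra M).
         measure (dirichlet_measure M \<alpha>' G') \<B> - measure (dirichlet_measure M \<alpha> G) \<B>
           \<ge> c0 * wass r M G G' powr r \<and>
         (\<forall>\<delta>>0. \<delta> \<le> c1 * wass r M G G' \<longrightarrow>
            (\<exists>S \<in> sets (prob_algebra M). enlarge r M \<B> \<delta> - \<B> \<subseteq> S \<and>
               measure (dirichlet_measure M \<alpha> G) S \<le> C0 * (\<delta> / wass r M G G') powr a)))"

end

theory Submission
  imports Defs
begin

text \<open>
  The Dirichlet measure is only described by its finite-dimensional laws, so it is first identified:
  two solutions agree on the events that fix finitely many set masses, and a solution is given by
  stick breaking, $\sum_n w_n \delta_{x_n}$. Scaling of $x^{a-1} dx$ shows that the sum of independent
  Gamma variables is independent of their normalisation; hence the Dirichlet law is invariant under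
  $z \mapsto v e_i + (1 - v) z$, and the truncated stick-breaking sums, completed by an independent
  Dirichlet vector, all have the Dirichlet law and converge almost surely.

  For the boundary, split $\Theta$ into the Voronoi cells of the atoms of $G$ and let $f(x)$ be the
  $r$-th power of the distance to the nearest atom. Then $W_r^r(G,G')$ is at most
  $\int f\, dG'$ plus a multiple of the total deficit $\sum_j (\beta_j - G'(\mathrm{cell}_j))^+$.
  If the first term dominates, the test set is $\{Q : \int f\, dQ > t\}$; measures near it charge the
  complement of the atoms, which has probability zero. Otherwise some cell has a large deficit and the test set is
  $\{Q : Q(\mathrm{cell}_j) \le t\}$, with $t$ chosen by comparing means; its boundary is controlled
  by the Beta law of $Q(\mathrm{cell}_j)$, since moving mass between cells costs a fixed distance.
\<close>

section \<open>Gamma measures\<close>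

text \<open>The exponent arises as follows. A measure on the atoms at \<open>W_r\<close> distance
  \<delta> from the cell test set exceeds its threshold by at most a multiple of \<delta>^r of cell
  mass, and a Beta(p, q) variable with p, q \<le> 1 lies in an interval of length s with probability
  O(s^p + s^q), the order attained at the endpoints, where the density blows up. There p and q are
  at least b, the smallest \<alpha> \<beta>_i, whence \<delta>^(b r); \<alpha> \<le> 1 keeps p and q
  at most one. Only means are compared when the test sets are chosen: the mean measure of a
  Dirichlet measure is its base measure whatever the concentration, so the constants are uniform
  over the class. Invariance under stick breaking is a size-biasing identity: the weights y_i / a_i,
  averaged with the probabilities a_i / \<alpha> of the blocks, give (sum of y) / \<alpha>, which
  has mean one and is independent of the direction. Independence itself is proved for a measure of
  infinite mass, because x^(a-1) dx is homogeneous and a Gamma law is not; the exponential factor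
  relating the two sees only the sum.\<close>

definition power_measure :: "real \<Rightarrow> real measure" where
  "power_measure a = (if a = 0 then return borel 0
     else density lborel (\<lambda>x. ennreal (if x > 0 then x powr (a - 1) else 0)))"

text \<open>\<^const>\<open>Gamma\<close> has the junk value 0 at 0, so the degenerate case needs its own constant.\<close>

definition gamma_norm :: "real \<Rightarrow> real" where
  "gamma_norm a = (if a = 0 then 1 else Gamma a)"

lemma sets_power_measure [simp, measurable_cong]: "sets (power_measure a) = sets borel"
  and space_power_measure [simp]: "space (power_measure a) = UNIV"
  by (auto simp: power_measure_def)

lemma sets_gamma_measure [simp, measurable_cong]: "sets (gamma_measure a) = sets borel"
  and space_gamma_measure [simp]: "space (gamma_measure a) = UNIV"
  by (auto simp: gamma_measure_def)

lemma gamma_norm_pos: "0 \<le> a \<Longrightarrow> 0 < gamma_norm a"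
  by (auto simp: gamma_norm_def)

lemma sigma_finite_power_measure: "sigma_finite_measure (power_measure a)"
proof (cases "a = 0")
  case True
  interpret prob_space "return borel (0::real)" by (rule prob_space_return) auto
  show ?thesis using True by (simp add: power_measure_def sigma_finite_measure_axioms)
next
  case False
  then show ?thesis
    by (auto simp: power_measure_def sigma_finite_measure.sigma_finite_iff_density_finite[OF sigma_finite_lborel])
qed

lemma gamma_measure_eq_density:
  assumes "0 \<le> a"
  shows "gamma_measure a = density (power_measure a) (\<lambda>x. ennreal (exp (- x) / gamma_norm a))"
proof (cases "a = 0")
  case True
  show ?thesis
  proof (rule measure_eqI)
    fix A assume "A \<in> sets (gamma_measure a)"
    then show "emeasure (gamma_measure a) A =
        emeasure (density (power_measure a) (\<lambda>x. ennreal (exp (- x) / gamma_norm a))) A"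
      using True
      by (simp add: gamma_measure_def power_measure_def gamma_norm_def emeasure_density
          nn_integral_return)
  qed simp
next
  case False
  have "0 < Gamma a" using False assms by (auto intro!: Gamma_real_pos)
  then show ?thesis
    using False
    by (auto simp: gamma_measure_def power_measure_def gamma_norm_def density_density_eq
        ennreal_mult'[symmetric] intro!: density_cong)
qed

lemma emeasure_gamma_measure_UNIV:
  assumes "0 \<le> a"
  shows "emeasure (gamma_measure a) UNIV = 1"
proof (cases "a = 0")
  case False
  have G: "0 < Gamma a" using False assms by (auto intro!: Gamma_real_pos)
  have "emeasure (gamma_measure a) UNIV = (\<integral>\<^sup>+x. ennreal (1 / Gamma a) * (indicator {0..} x * ennreal (x powr (a - 1) / exp x)) \<partial>lborel)"
    using False G
    by (auto simp: gamma_measure_def emeasure_density indicator_def exp_minus divide_simps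
        ennreal_mult'[symmetric] intro!: nn_integral_cong)
  also have "\<dots> = ennreal (1 / Gamma a) * (\<integral>\<^sup>+x. ennreal (indicator {0..} x * (x powr (a - 1) / exp x)) \<partial>lborel)"
    by (subst nn_integral_cmult[symmetric])
      (auto simp: indicator_def intro!: nn_integral_cong)
  also have "(\<integral>\<^sup>+x. ennreal (indicator {0..} x * (x powr (a - 1) / exp x)) \<partial>lborel) = Gamma a"
    using nn_integral_has_integral_lebesgue[OF _ Gamma_integral_real[of a]] assms False by auto
  finally show ?thesis using G by (simp add: ennreal_mult'[symmetric])
qed (simp add: gamma_measure_def)

lemma prob_space_gamma_measure: "0 \<le> a \<Longrightarrow> prob_space (gamma_measure a)"
  by (rule prob_spaceI) (simp add: emeasure_gamma_measure_UNIV)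

lemma AE_power_measure_pos: "a \<noteq> 0 \<Longrightarrow> AE x in power_measure a. 0 < x"
  unfolding power_measure_def by (simp, subst AE_density) (auto split: if_splits)

lemma AE_power_measure_nonneg: "AE x in power_measure a. 0 \<le> x"
proof (cases "a = 0")
  case True
  then show ?thesis using AE_return[of "0::real" borel "\<lambda>x. 0 \<le> x"] unfolding power_measure_def by simp
next
  case False
  then show ?thesis using AE_power_measure_pos[OF False] by (auto elim: eventually_mono)
qed

lemma AE_gamma_measure_pos: "a \<noteq> 0 \<Longrightarrow> AE x in gamma_measure a. 0 < x"
  unfolding gamma_measure_def by (simp, subst AE_density) (auto split: if_splits)

lemma AE_gamma_measure_nonneg: "AE x in gamma_measure a. 0 \<le> x"
proof (cases "a = 0")
  case True
  then show ?thesis using AE_return[of "0::real" borel "\<lambda>x. 0 \<le> x"] unfolding gamma_measure_def by simp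
next
  case False
  then show ?thesis using AE_gamma_measure_pos[OF False] by (auto elim: eventually_mono)
qed

text \<open>Substituting \<open>c * x\<close> contributes a factor \<open>c\<close> from Lebesgue
  measure and \<open>c powr (a - 1)\<close> from the density. For \<open>a = 0\<close> the point
  mass at zero is fixed by scaling, in agreement with \<open>c powr 0 = 1\<close>.\<close>

lemma emeasure_power_measure_scale:
  assumes "0 < c" "A \<in> sets borel"
  shows "emeasure (power_measure a) A = ennreal (c powr a) * emeasure (power_measure a) ((\<lambda>x. c * x) -` A)"
proof (cases "a = 0")
  case True
  have "(\<lambda>x. c * x) -` A \<in> sets borel"
    using measurable_sets_borel[OF _ assms(2), of "\<lambda>x. c * x"] by simp
  with True show ?thesis using assms by (simp add: power_measure_def indicator_def)
next
  case False
  have [measurable]: "A \<in> sets borel" by fact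
  have A': "(\<lambda>x. c * x) -` A \<in> sets borel"
    using measurable_sets_borel[OF _ assms(2), of "\<lambda>x. c * x"] by simp
  let ?p = "\<lambda>x::real. ennreal (if x > 0 then x powr (a - 1) else 0)"
  have "emeasure (power_measure a) A = (\<integral>\<^sup>+x. ?p x * indicator A x \<partial>lborel)"
    using False assms by (simp add: power_measure_def emeasure_density)
  also have "\<dots> = c * (\<integral>\<^sup>+x. ?p (0 + c * x) * indicator A (0 + c * x) \<partial>lborel)"
    using assms by (subst nn_integral_real_affine[where c=c and t=0]) auto
  also have "(\<integral>\<^sup>+x. ?p (0 + c * x) * indicator A (0 + c * x) \<partial>lborel) =
    (\<integral>\<^sup>+x. ennreal (c powr (a - 1)) * (?p x * indicator ((\<lambda>x. c * x) -` A) x) \<partial>lborel)"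
    using assms by (intro nn_integral_cong)
      (auto simp: indicator_def zero_less_mult_iff powr_mult ennreal_mult'[symmetric])
  also have "\<dots> = ennreal (c powr (a - 1)) * emeasure (power_measure a) ((\<lambda>x. c * x) -` A)"
    using False A' by (subst nn_integral_cmult) (auto simp: power_measure_def emeasure_density)
  also have "ennreal c * (ennreal (c powr (a - 1)) * emeasure (power_measure a) ((\<lambda>x. c * x) -` A)) =
     ennreal (c powr a) * emeasure (power_measure a) ((\<lambda>x. c * x) -` A)"
    using assms by (simp add: mult.assoc[symmetric] ennreal_mult'[symmetric] powr_mult_base)
  finally show ?thesis .
qed

lemma emeasure_power_measure_atMost:
  assumes "0 < a"
  shows "emeasure (power_measure a) {..c} = ennreal (max 0 c powr a / a)"
proof (cases "0 \<le> c")
  case True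
  have "emeasure (power_measure a) {..c} = (\<integral>\<^sup>+x. ennreal (indicator {0..c} x * (x powr (a - 1))) \<partial>lborel)"
    using assms True by (auto simp: power_measure_def emeasure_density indicator_def intro!: nn_integral_cong)
  also have "\<dots> = ennreal (c powr a / a)"
    using nn_integral_has_integral_lebesgue[OF _ has_integral_powr_from_0[of "a - 1" c]] assms True by auto
  finally show ?thesis using True by simp
next
  case False
  have "AE x in power_measure a. x \<notin> {..c}"
    using AE_power_measure_nonneg[of a] by eventually_elim (use False in auto)
  then have "emeasure (power_measure a) {..c} = 0"
    by (subst (asm) AE_iff_measurable[of "{..c}"]) auto
  then show ?thesis using False by simp
qed

text \<open>\<open>Gamma (a + 1) = a * Gamma a\<close> absorbs the additional factor
  \<open>x\<close>. This size biasing yields the mean of a Gamma variable and later turns an added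
  Gamma(1) summand into a density.\<close>

lemma gamma_measure_add_one:
  assumes "0 < a"
  shows "gamma_measure (a + 1) = density (gamma_measure a) (\<lambda>x. ennreal (x / a))"
proof -
  have G: "0 < Gamma a" "Gamma (a + 1) = a * Gamma a"
    using assms by (auto intro!: Gamma_plus1 elim!: nonpos_Ints_cases)
  have "density (gamma_measure a) (\<lambda>x. ennreal (x / a)) =
    density lborel (\<lambda>x. ennreal (if 0 < x then x powr (a - 1) * exp (- x) / Gamma a else 0) * ennreal (x / a))"
    using assms by (simp add: gamma_measure_def density_density_eq)
  also have "\<dots> = density lborel (\<lambda>x. ennreal (if 0 < x then x powr (a + 1 - 1) * exp (- x) / Gamma (a + 1) else 0))"
    using assms G
    by (intro density_cong) (auto simp: ennreal_mult'[symmetric] powr_diff divide_simps)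
  finally show ?thesis using assms by (simp add: gamma_measure_def)
qed

text \<open>For positive \<open>a\<close>, the total mass one of Gamma(\<open>a + 1\<close>), read
  through the size-biased density, is the mean divided by \<open>a\<close>.\<close>

lemma nn_integral_gamma_measure_id:
  assumes "0 \<le> a"
  shows "(\<integral>\<^sup>+x. ennreal x \<partial>gamma_measure a) = ennreal a"
proof (cases "a = 0")
  case True
  then show ?thesis by (simp add: gamma_measure_def nn_integral_return)
next
  case False
  have "1 = (\<integral>\<^sup>+x. ennreal (x / a) \<partial>gamma_measure a)"
    using emeasure_gamma_measure_UNIV[of "a + 1"] gamma_measure_add_one[of a] assms False
    by (simp add: emeasure_density)
  also have "\<dots> = (\<integral>\<^sup>+x. ennreal (1/a) * ennreal x \<partial>gamma_measure a)"
    using assms False by (intro nn_integral_cong) (simp add: ennreal_mult'[symmetric])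
  also have "\<dots> = ennreal (1/a) * (\<integral>\<^sup>+x. ennreal x \<partial>gamma_measure a)"
    by (simp add: nn_integral_cmult)
  finally have "ennreal a * 1 = ennreal a * (ennreal (1/a) * (\<integral>\<^sup>+x. ennreal x \<partial>gamma_measure a))"
    by simp
  then show ?thesis
    using assms False by (simp add: mult.assoc[symmetric] ennreal_mult'[symmetric])
qed

section \<open>Sum and normalisation of independent Gamma variables\<close>

abbreviation (input) borel_on :: "'i set \<Rightarrow> ('i \<Rightarrow> real) measure" where
  "borel_on I \<equiv> PiM I (\<lambda>_. borel)"

abbreviation (input) powers :: "'i set \<Rightarrow> ('i \<Rightarrow> real) \<Rightarrow> ('i \<Rightarrow> real) measure" where
  "powers I a \<equiv> PiM I (\<lambda>i. power_measure (a i))"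

abbreviation (input) gammas :: "'i set \<Rightarrow> ('i \<Rightarrow> real) \<Rightarrow> ('i \<Rightarrow> real) measure" where
  "gammas I a \<equiv> PiM I (\<lambda>i. gamma_measure (a i))"

lemma product_sigma_finite_power_measure: "product_sigma_finite (\<lambda>i. power_measure (a i))"
  by (intro product_sigma_finite.intro sigma_finite_power_measure)

lemma product_sigma_finite_gamma_measure:
  "(\<And>i. 0 \<le> a i) \<Longrightarrow> product_sigma_finite (\<lambda>i. gamma_measure (a i))"
  by (intro product_sigma_finite.intro prob_space_imp_sigma_finite prob_space_gamma_measure)

text \<open>Homogeneity of degree \<open>sum a I\<close>: the degrees of the factors add up.
  Rectangles suffice to identify a finite product of sigma-finite measures.\<close>

lemma PiM_power_measure_scale:
  assumes I: "finite I" and c: "0 < c"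
  shows "powers I a = scale_measure (ennreal (c powr (sum a I)))
    (distr (powers I a) (borel_on I) (\<lambda>y. \<lambda>i\<in>I. c * y i))"
    (is "?P = ?Q")
proof (rule sym, rule product_sigma_finite.PiM_eqI[OF product_sigma_finite_power_measure I])
  interpret product_sigma_finite "\<lambda>i. power_measure (a i)"
    by (rule product_sigma_finite_power_measure)
  show "sets ?Q = sets ?P"
    by (auto intro!: sets_PiM_cong)
  fix A assume "\<And>i. i \<in> I \<Longrightarrow> A i \<in> sets (power_measure (a i))"
  then have A: "\<And>i. i \<in> I \<Longrightarrow> A i \<in> sets borel" by simp
  have A': "(\<lambda>x. c * x) -` A i \<in> sets borel" if "i \<in> I" for i
    using measurable_sets_borel[OF _ A[OF that], of "\<lambda>x. c * x"] by simp
  have "(\<lambda>y. \<lambda>i\<in>I. c * y i) \<in> ?P \<rightarrow>\<^sub>M borel_on I"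
    by (intro measurable_restrict) measurable
  moreover have "Pi\<^sub>E I A \<in> sets (borel_on I)"
    using A I by (intro sets_PiM_I_finite) auto
  moreover have "(\<lambda>y. \<lambda>i\<in>I. c * y i) -` Pi\<^sub>E I A \<inter> space ?P = Pi\<^sub>E I (\<lambda>i. (\<lambda>x. c * x) -` A i)"
    by (auto simp: space_PiM PiE_iff extensional_def)
  ultimately have "emeasure ?Q (Pi\<^sub>E I A) = ennreal (c powr (sum a I)) * emeasure ?P (Pi\<^sub>E I (\<lambda>i. (\<lambda>x. c * x) -` A i))"
    by (simp add: emeasure_distr)
  also have "emeasure ?P (Pi\<^sub>E I (\<lambda>i. (\<lambda>x. c * x) -` A i)) = (\<Prod>i\<in>I. emeasure (power_measure (a i)) ((\<lambda>x. c * x) -` A i))"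
    using A' I by (intro emeasure_PiM) auto
  also have "ennreal (c powr (sum a I)) * (\<Prod>i\<in>I. emeasure (power_measure (a i)) ((\<lambda>x. c * x) -` A i)) =
    (\<Prod>i\<in>I. ennreal (c powr a i)) * (\<Prod>i\<in>I. emeasure (power_measure (a i)) ((\<lambda>x. c * x) -` A i))"
    using c by (simp add: powr_sum prod_ennreal)
  also have "(\<Prod>i\<in>I. ennreal (c powr a i)) * (\<Prod>i\<in>I. emeasure (power_measure (a i)) ((\<lambda>x. c * x) -` A i)) =
     (\<Prod>i\<in>I. emeasure (power_measure (a i)) (A i))"
    unfolding prod.distrib[symmetric]
    using c A by (intro prod.cong refl) (metis emeasure_power_measure_scale)
  finally show "emeasure ?Q (Pi\<^sub>E I A) = (\<Prod>i\<in>I. emeasure (power_measure (a i)) (A i))" .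
qed

text \<open>The exponential factors multiply to a function of \<open>sum y I\<close> alone, so
  passing from power measures to Gamma laws does not touch the direction of
  \<open>y\<close>.\<close>

lemma PiM_gamma_measure_eq_density:
  assumes I: "finite I" and a: "\<And>i. 0 \<le> a i"
  shows "gammas I a = density (powers I a)
    (\<lambda>y. ennreal (exp (- (sum y I)) / (\<Prod>i\<in>I. gamma_norm (a i))))" (is "?P = density ?R ?f")
proof (rule sym, rule product_sigma_finite.PiM_eqI[OF product_sigma_finite_gamma_measure[OF a] I])
  interpret product_sigma_finite "\<lambda>i. power_measure (a i)"
    by (rule product_sigma_finite_power_measure)
  show "sets (density ?R ?f) = sets ?P"
    by (auto intro!: sets_PiM_cong)
  fix A assume "\<And>i. i \<in> I \<Longrightarrow> A i \<in> sets (gamma_measure (a i))"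
  then have A: "\<And>i. i \<in> I \<Longrightarrow> A i \<in> sets borel" by simp
  have "Pi\<^sub>E I A \<in> sets ?R"
    using A I by (intro sets_PiM_I_finite) auto
  then have "emeasure (density ?R ?f) (Pi\<^sub>E I A) = (\<integral>\<^sup>+y. ?f y * indicator (Pi\<^sub>E I A) y \<partial>?R)"
    by (intro emeasure_density) auto
  also have "\<dots> = (\<integral>\<^sup>+y. (\<Prod>i\<in>I. ennreal (exp (- y i) / gamma_norm (a i)) * indicator (A i) (y i)) \<partial>?R)"
  proof (intro nn_integral_cong)
    fix y assume y: "y \<in> space ?R"
    have "?f y = (\<Prod>i\<in>I. ennreal (exp (- y i) / gamma_norm (a i)))"
      using I gamma_norm_pos[OF a]
      by (simp add: prod_ennreal less_imp_le exp_sum sum_negf[symmetric] prod_dividef)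
    moreover have "(indicator (Pi\<^sub>E I A) y :: ennreal) = (\<Prod>i\<in>I. indicator (A i) (y i))"
    proof (cases "y \<in> Pi\<^sub>E I A")
      case True
      then show ?thesis by (auto simp: indicator_def PiE_iff)
    next
      case False
      then obtain i where "i \<in> I" "y i \<notin> A i" using y by (auto simp: space_PiM PiE_iff)
      then have "(\<Prod>i\<in>I. indicator (A i) (y i)) = (0::ennreal)"
        using I by (intro prod_zero bexI[of _ i]) auto
      then show ?thesis using False by simp
    qed
    ultimately show "?f y * indicator (Pi\<^sub>E I A) y = (\<Prod>i\<in>I. ennreal (exp (- y i) / gamma_norm (a i)) * indicator (A i) (y i))"
      by (simp add: prod.distrib)
  qed
  also have "\<dots> = (\<Prod>i\<in>I. \<integral>\<^sup>+x. ennreal (exp (- x) / gamma_norm (a i)) * indicator (A i) x \<partial>power_measure (a i))"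
    using A I by (intro product_nn_integral_prod) auto
  also have "\<dots> = (\<Prod>i\<in>I. emeasure (gamma_measure (a i)) (A i))"
    using A a by (intro prod.cong refl) (simp add: gamma_measure_eq_density emeasure_density)
  finally show "emeasure (density ?R ?f) (Pi\<^sub>E I A) = (\<Prod>i\<in>I. emeasure (gamma_measure (a i)) (A i))" .
qed

text \<open>Meant for the infinite measures \<open>power_measure s\<close>: the half-lines exhaust
  the line and have finite mass, which replaces finiteness of the whole measure.\<close>

lemma measure_eqI_atMost:
  fixes M N :: "real measure"
  assumes "sets M = sets borel" "sets N = sets borel"
    and "\<And>c. emeasure M {..c} = emeasure N {..c}" "\<And>c. emeasure M {..c} \<noteq> \<infinity>"
  shows "M = N"
proof (rule measure_eqI_generator_eq[where E="range (\<lambda>c::real. {..c})" and \<Omega>=UNIV and A="\<lambda>n. {..real n}"])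
  show "Int_stable (range (\<lambda>c::real. {..c}))"
    by (auto simp: Int_stable_def min_def intro!: image_eqI[where x="min _ _"])
  have "sets (borel :: real measure) = sigma_sets UNIV (range (\<lambda>c. {..c}))"
    by (subst borel_eq_atMost) simp
  then show "sets M = sigma_sets UNIV (range (\<lambda>c. {..c}))" "sets N = sigma_sets UNIV (range (\<lambda>c. {..c}))"
    using assms by auto
  show "(\<Union>i. {..real i}) = UNIV"
    by (auto intro: real_arch_simple)
qed (use assms in auto)

definition normalize_on :: "'i set \<Rightarrow> ('i \<Rightarrow> real) \<Rightarrow> 'i \<Rightarrow> real" where
  "normalize_on I y = (\<lambda>i\<in>I. y i / (\<Sum>j\<in>I. y j))"

lemma measurable_normalize_on [measurable]:
  "finite I \<Longrightarrow> normalize_on I \<in> borel_on I \<rightarrow>\<^sub>M borel_on I"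
  unfolding normalize_on_def[abs_def] by (intro measurable_restrict) measurable

lemma normalize_on_scale:
  "0 < c \<Longrightarrow> normalize_on I (\<lambda>i\<in>I. c * y i) = normalize_on I y"
  by (auto simp: normalize_on_def sum_distrib_left[symmetric] fun_eq_iff)

lemma AE_PiM_power_measure:
  assumes I: "finite I" "i \<in> I" and P: "AE x in power_measure (a i). P x" "Measurable.pred borel P"
  shows "AE y in powers I a. P (y i)"
proof -
  interpret product_sigma_finite "\<lambda>i. power_measure (a i)"
    by (rule product_sigma_finite_power_measure)
  let ?R = "powers I a"
  have [measurable]: "Measurable.pred borel P" by fact
  have B: "{x. \<not> P x} \<in> sets borel" by measurable
  have "emeasure (power_measure (a i)) {x. \<not> P x} = 0"
    using P B by (subst (asm) AE_iff_measurable[of "{x. \<not> P x}"]) auto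
  moreover have "{y \<in> space ?R. \<not> P (y i)} = Pi\<^sub>E I (\<lambda>j. if j = i then {x. \<not> P x} else UNIV)"
    using I by (auto simp: space_PiM PiE_iff extensional_def split: if_splits)
  moreover have "emeasure ?R (Pi\<^sub>E I (\<lambda>j. if j = i then {x. \<not> P x} else UNIV)) =
     (\<Prod>j\<in>I. emeasure (power_measure (a j)) (if j = i then {x. \<not> P x} else UNIV))"
    using I B by (intro emeasure_PiM) auto
  ultimately have "emeasure ?R {y \<in> space ?R. \<not> P (y i)} = 0"
    using I by (auto intro!: bexI[of _ i])
  moreover have "{y \<in> space ?R. \<not> P (y i)} \<in> sets ?R"
    using I by measurable
  ultimately show ?thesis
    by (subst AE_iff_measurable) auto
qed

text \<open>For fixed \<open>Z\<close>, scaling shows that the sum, under the power measure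
  restricted to directions in \<open>Z\<close>, has a homogeneous law of degree \<open>s\<close>,
  hence a multiple of \<open>power_measure s\<close>. Only the multiple depends on \<open>Z\<close>,
  and the exponential density, a function of the sum, keeps this product form.\<close>

lemma gamma_sum_normalize_independent:
  assumes I: "finite I" and a: "\<And>i. 0 \<le> a i" and s: "0 < (sum a I)"
    and Z: "Z \<in> sets (borel_on I)" and A: "A \<in> sets borel"
  defines "P \<equiv> gammas I a"
  shows "emeasure P {y \<in> space P. (sum y I) \<in> A \<and> normalize_on I y \<in> Z} =
    emeasure (gamma_measure (sum a I)) A * emeasure P {y \<in> space P. normalize_on I y \<in> Z}"
proof -
  define R where "R = powers I a"
  define s where "s = (sum a I)"
  define S where "S = (\<lambda>y :: 'a \<Rightarrow> real. \<Sum>i\<in>I. y i)"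
  define C where "C = (\<Prod>i\<in>I. gamma_norm (a i))"
  interpret product_sigma_finite "\<lambda>i. power_measure (a i)"
    by (rule product_sigma_finite_power_measure)
  have setsR [measurable_cong, simp]: "sets R = sets (borel_on I)"
    unfolding R_def by (auto intro!: sets_PiM_cong)
  have spR [simp]: "space R = Pi\<^sub>E I (\<lambda>_. UNIV)"
    unfolding R_def by (simp add: space_PiM)
  note [measurable] = I Z A
  have [measurable]: "S \<in> borel_measurable (borel_on I)"
    unfolding S_def by measurable
  have Cpos: "0 < C" unfolding C_def by (intro prod_pos gamma_norm_pos a)
  have spos: "0 < s" using s by (simp add: s_def)
  define H where "H = {y \<in> space R. normalize_on I y \<in> Z}"
  have H [measurable]: "H \<in> sets (borel_on I)"
  proof -
    have "H \<in> sets R" unfolding H_def by measurable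
    then show ?thesis by simp
  qed
  \<comment> \<open>\<open>H\<close> is the cone of points with direction in \<open>Z\<close>, and
    \<open>\<rho>\<close> is the law of the sum on it, a measure of possibly infinite mass.\<close>
  define \<rho> where "\<rho> = distr (density R (indicator H)) borel S"
  have \<rho>: "emeasure \<rho> B = emeasure R {y \<in> space R. S y \<in> B \<and> normalize_on I y \<in> Z}" if [measurable]: "B \<in> sets borel" for B
  proof -
    have "emeasure \<rho> B = emeasure (density R (indicator H)) (S -` B \<inter> space R)"
      unfolding \<rho>_def by (subst emeasure_distr) auto
    also have "\<dots> = emeasure R (H \<inter> (S -` B \<inter> space R))"
    proof (rule emeasure_restricted)
      show "H \<in> sets R" by simp
      show "S -` B \<inter> space R \<in> sets R" by measurable
    qed
    also have "H \<inter> (S -` B \<inter> space R) = {y \<in> space R. S y \<in> B \<and> normalize_on I y \<in> Z}"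
      by (auto simp: H_def)
    finally show ?thesis .
  qed
  have nonneg: "AE y in R. \<forall>i\<in>I. 0 \<le> y i"
    using I unfolding R_def
    by (intro AE_finite_allI AE_PiM_power_measure[where P="\<lambda>x. 0 \<le> x"] AE_power_measure_nonneg) auto
  have pos: "AE y in R. 0 < S y"
  proof -
    have "\<not> (\<forall>i\<in>I. a i = 0)" 
      using s sum.neutral[of I a] by (intro notI) simp
    then obtain i where i: "i \<in> I" "a i \<noteq> 0" by auto
    have "AE y in R. 0 < y i"
      using i I unfolding R_def
      by (intro AE_PiM_power_measure[where P="\<lambda>x. 0 < x"] AE_power_measure_pos) auto
    then show ?thesis using nonneg
      by eventually_elim (use i I in \<open>auto simp: S_def intro!: sum_pos2[of _ i]\<close>)
  qed
  \<comment> \<open>\<open>K\<close> is the one free constant of \<open>\<rho>\<close>. It is finite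
    because nonnegative coordinates with sum at most one are each at most one, and every power
    measure is finite on \<open>{..1}\<close>.\<close>
  define K where "K = emeasure \<rho> {..1}"
  have K_fin: "K < \<infinity>"
  proof -
    have "K \<le> emeasure R (Pi\<^sub>E I (\<lambda>_. {..1}))"
      unfolding K_def \<rho>[OF borel_closed[OF closed_atMost]]
    proof (rule emeasure_mono_AE)
      show "AE y in R. y \<in> {y \<in> space R. S y \<in> {..1} \<and> normalize_on I y \<in> Z} \<longrightarrow> y \<in> Pi\<^sub>E I (\<lambda>_. {..1})"
        using nonneg
      proof eventually_elim
        case (elim y)
        have "y i \<le> S y" if "i \<in> I" for i
          using elim I that member_le_sum[of i I y] by (simp add: S_def)
        then have "y i \<le> 1" if "i \<in> I" "S y \<le> 1" for i
          using that by force
        then show ?case by (simp add: PiE_iff)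
      qed
      show "Pi\<^sub>E I (\<lambda>_. {..1}) \<in> sets R"
        using I by simp
    qed
    also have "\<dots> = (\<Prod>i\<in>I. emeasure (power_measure (a i)) {..1})"
      unfolding R_def using I by (intro emeasure_PiM) auto
    also have "\<dots> < \<infinity>"
    proof -
      have "emeasure (power_measure (a i)) {..1} < top" for i
      proof (cases "a i = 0")
        case True then show ?thesis by (simp add: power_measure_def)
      next
        case False then show ?thesis using a[of i] by (simp add: emeasure_power_measure_atMost)
      qed
      then show ?thesis by (simp add: ennreal_prod_eq_top less_top[symmetric])
    qed
    finally show ?thesis .
  qed
  \<comment> \<open>Scaling by \<open>c\<close> carries the part of the cone with
    \<open>S y \<le> 1\<close> to the part with \<open>S y \<le> c\<close>, since
    \<open>normalize_on\<close> ignores positive factors.\<close>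
  have \<rho>_le: "emeasure \<rho> {..c} = ennreal (max 0 c powr s) * K" for c
  proof (cases "0 < c")
    case True
    let ?B = "{y \<in> space R. S y \<in> {..c} \<and> normalize_on I y \<in> Z}"
    have "?B \<in> sets R" by measurable
    have m: "(\<lambda>y. \<lambda>i\<in>I. c * y i) \<in> R \<rightarrow>\<^sub>M borel_on I"
      unfolding R_def by (intro measurable_restrict) measurable
    have "emeasure R ?B = ennreal (c powr s) * emeasure (distr R (borel_on I) (\<lambda>y. \<lambda>i\<in>I. c * y i)) ?B"
      using arg_cong[OF PiM_power_measure_scale[OF I True, of a], of "\<lambda>M. emeasure M ?B"]
      by (simp add: R_def[symmetric] s_def)
    also have "emeasure (distr R (borel_on I) (\<lambda>y. \<lambda>i\<in>I. c * y i)) ?B =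
       emeasure R ((\<lambda>y. \<lambda>i\<in>I. c * y i) -` ?B \<inter> space R)"
      using \<open>?B \<in> sets R\<close> m by (subst emeasure_distr) auto
    also have "(\<lambda>y. \<lambda>i\<in>I. c * y i) -` ?B \<inter> space R = {y \<in> space R. S y \<in> {..1} \<and> normalize_on I y \<in> Z}"
      using True by (auto simp: normalize_on_scale S_def sum_distrib_left[symmetric])
    finally show ?thesis using True by (simp add: K_def \<rho>)
  next
    case False
    have "AE y in R. y \<notin> {y \<in> space R. S y \<in> {..c} \<and> normalize_on I y \<in> Z}"
      using pos by eventually_elim (use False in auto)
    then have "emeasure R {y \<in> space R. S y \<in> {..c} \<and> normalize_on I y \<in> Z} = 0"
      by (subst (asm) AE_iff_measurable[of "{y \<in> space R. S y \<in> {..c} \<and> normalize_on I y \<in> Z}"])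
        auto
    then show ?thesis using False spos by (simp add: \<rho>)
  qed
  \<comment> \<open>\<open>power_measure s\<close> gives \<open>{..1}\<close> the mass
    \<open>1 / s\<close>, which is why the multiple is \<open>s * K\<close>.\<close>
  have \<rho>_eq: "\<rho> = scale_measure (ennreal s * K) (power_measure s)"
  proof (rule measure_eqI_atMost)
    show "emeasure \<rho> {..c} = emeasure (scale_measure (ennreal s * K) (power_measure s)) {..c}" for c
    proof -
      have "ennreal (max 0 c powr s) = ennreal s * ennreal (max 0 c powr s / s)"
        using spos by (simp add: ennreal_mult'[symmetric])
      then show ?thesis
        using spos by (simp add: \<rho>_le emeasure_power_measure_atMost mult_ac)
    qed
    show "emeasure \<rho> {..c} \<noteq> \<infinity>" for c
      using K_fin by (auto simp: \<rho>_le ennreal_mult_eq_top_iff)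
  qed (simp_all add: \<rho>_def)
  have key: "emeasure P {y \<in> space P. S y \<in> B \<and> normalize_on I y \<in> Z} =
     ennreal s * K * ennreal (gamma_norm s / C) * emeasure (gamma_measure s) B"
    if B [measurable]: "B \<in> sets borel" for B
  proof -
    have P_eq: "P = density R (\<lambda>y. ennreal (exp (- S y) / C))"
      unfolding P_def R_def S_def C_def by (rule PiM_gamma_measure_eq_density[OF I a])
    have "{y \<in> space R. S y \<in> B \<and> normalize_on I y \<in> Z} \<in> sets R"
      by measurable
    then have "emeasure P {y \<in> space P. S y \<in> B \<and> normalize_on I y \<in> Z} =
      (\<integral>\<^sup>+y. ennreal (exp (- S y) / C) * indicator {y \<in> space R. S y \<in> B \<and> normalize_on I y \<in> Z} y \<partial>R)"
      unfolding P_eq by (subst emeasure_density) (auto simp del: spR)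
    also have "\<dots> = (\<integral>\<^sup>+y. indicator H y * (ennreal (exp (- S y) / C) * indicator B (S y)) \<partial>R)"
      by (intro nn_integral_cong) (auto simp: H_def indicator_def)
    also have "\<dots> = (\<integral>\<^sup>+t. ennreal (exp (- t) / C) * indicator B t \<partial>\<rho>)"
      unfolding \<rho>_def by (subst nn_integral_distr, simp, simp, subst nn_integral_density) auto
    also have "\<dots> = ennreal s * K * (\<integral>\<^sup>+t. ennreal (exp (- t) / C) * indicator B t \<partial>power_measure s)"
      unfolding \<rho>_eq by (subst nn_integral_scale_measure) auto
    also have "(\<integral>\<^sup>+t. ennreal (exp (- t) / C) * indicator B t \<partial>power_measure s) =
      (\<integral>\<^sup>+t. ennreal (gamma_norm s / C) * (ennreal (exp (- t) / gamma_norm s) * indicator B t) \<partial>power_measure s)"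
      using gamma_norm_pos[of s] spos Cpos
      by (intro nn_integral_cong) (auto simp: ennreal_mult'[symmetric] mult.assoc[symmetric] indicator_def)
    also have "\<dots> = ennreal (gamma_norm s / C) * emeasure (gamma_measure s) B"
      using spos by (subst nn_integral_cmult) (auto simp: gamma_measure_eq_density emeasure_density)
    finally show ?thesis by (simp add: mult_ac)
  qed
  \<comment> \<open>Taking \<open>B = UNIV\<close> identifies the constant as the probability that
    the direction lies in \<open>Z\<close>.\<close>
  have "emeasure P {y \<in> space P. normalize_on I y \<in> Z} = ennreal s * K * ennreal (gamma_norm s / C)"
    using key[of UNIV] spos by (simp add: emeasure_gamma_measure_UNIV)
  then show ?thesis
    using key[OF A] by (simp add: S_def s_def mult_ac)
qed

section \<open>Dirichlet laws over a finite index set\<close>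

lemma product_prob_space_gamma_measure:
  "(\<And>i. 0 \<le> a i) \<Longrightarrow> product_prob_space (\<lambda>i. gamma_measure (a i))"
  by (intro product_prob_spaceI prob_space_gamma_measure)

lemma sets_PiM_gamma_measure [simp, measurable_cong]:
  "sets (gammas I a) = sets (borel_on I)"
  by (auto intro!: sets_PiM_cong)

lemma space_PiM_gamma_measure [simp]: "space (gammas I a) = Pi\<^sub>E I (\<lambda>_. UNIV)"
  by (simp add: space_PiM)

lemma AE_PiM_gamma_measure_nonneg:
  assumes "finite I" "\<And>i. 0 \<le> a i"
  shows "AE y in gammas I a. \<forall>i\<in>I. 0 \<le> y i"
proof -
  interpret product_prob_space "\<lambda>i. gamma_measure (a i)" I
    by (rule product_prob_space_gamma_measure) fact
  show ?thesis
    using assms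
    by (intro AE_finite_allI AE_PiM_component[where P="\<lambda>x. 0 \<le> x"] AE_gamma_measure_nonneg)
      (auto intro: prob_space_gamma_measure)
qed

definition dirichlet_on :: "'i set \<Rightarrow> ('i \<Rightarrow> real) \<Rightarrow> ('i \<Rightarrow> real) measure" where
  "dirichlet_on I a = distr (gammas I a) (borel_on I) (normalize_on I)"

lemma dirichlet_dist_eq: "dirichlet_dist k a = dirichlet_on {..<k} a"
  by (simp add: dirichlet_dist_def dirichlet_on_def normalize_on_def[abs_def])

lemma sets_dirichlet_on [simp, measurable_cong]: "sets (dirichlet_on I a) = sets (borel_on I)"
  by (simp add: dirichlet_on_def)

lemma space_dirichlet_on [simp]: "space (dirichlet_on I a) = Pi\<^sub>E I (\<lambda>_. UNIV)"
  by (simp add: dirichlet_on_def space_PiM)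

lemma prob_space_dirichlet_on:
  assumes "finite I" "\<And>i. 0 \<le> a i"
  shows "prob_space (dirichlet_on I a)"
proof -
  interpret product_prob_space "\<lambda>i. gamma_measure (a i)" I
    by (rule product_prob_space_gamma_measure) fact
  show ?thesis
    unfolding dirichlet_on_def using assms by (intro prob_space_distr) measurable
qed

lemma distr_sum_normalize_gamma:
  assumes I: "finite I" and a: "\<And>i. 0 \<le> a i" and s: "0 < (sum a I)"
  shows "distr (gammas I a) (borel \<Otimes>\<^sub>M borel_on I)
      (\<lambda>y. (\<Sum>i\<in>I. y i, normalize_on I y)) =
    gamma_measure (sum a I) \<Otimes>\<^sub>M dirichlet_on I a"
    (is "distr ?P _ ?f = _")
proof (rule sym, rule pair_measure_eqI)
  have [measurable]: "?f \<in> ?P \<rightarrow>\<^sub>M borel \<Otimes>\<^sub>M borel_on I"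
    using I by measurable
  show "sigma_finite_measure (gamma_measure (sum a I))" "sigma_finite_measure (dirichlet_on I a)"
    using s by (auto intro!: prob_space_imp_sigma_finite prob_space_gamma_measure prob_space_dirichlet_on I a)
  show "sets (gamma_measure (sum a I) \<Otimes>\<^sub>M dirichlet_on I a) = sets (distr ?P (borel \<Otimes>\<^sub>M borel_on I) ?f)"
    by (auto intro!: sets_pair_measure_cong)
  fix A Z assume "A \<in> sets (gamma_measure (sum a I))" "Z \<in> sets (dirichlet_on I a)"
  then have A [measurable]: "A \<in> sets borel" and Z [measurable]: "Z \<in> sets (borel_on I)"
    by auto
  have "emeasure (distr ?P (borel \<Otimes>\<^sub>M borel_on I) ?f) (A \<times> Z) =
    emeasure ?P {y \<in> space ?P. (sum y I) \<in> A \<and> normalize_on I y \<in> Z}"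
    by (subst emeasure_distr) (auto intro!: arg_cong[where f="emeasure _"])
  also have "\<dots> = emeasure (gamma_measure (sum a I)) A * emeasure ?P {y \<in> space ?P. normalize_on I y \<in> Z}"
    by (rule gamma_sum_normalize_independent[OF I a s Z A])
  also have "emeasure ?P {y \<in> space ?P. normalize_on I y \<in> Z} = emeasure (dirichlet_on I a) Z"
    unfolding dirichlet_on_def using I
    by (subst emeasure_distr) (auto intro!: arg_cong[where f="emeasure _"])
  finally show "emeasure (gamma_measure (sum a I)) A * emeasure (dirichlet_on I a) Z =
    emeasure (distr ?P (borel \<Otimes>\<^sub>M borel_on I) ?f) (A \<times> Z)" by simp
qed

lemma nn_integral_sum_normalize_gamma:
  assumes I: "finite I" and a: "\<And>i. 0 \<le> a i" and s: "0 < (sum a I)"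
    and f [measurable]: "(\<lambda>(s, z). f s z) \<in> borel_measurable (borel \<Otimes>\<^sub>M borel_on I)"
  shows "(\<integral>\<^sup>+y. f (sum y I) (normalize_on I y) \<partial>gammas I a) =
    (\<integral>\<^sup>+s. \<integral>\<^sup>+z. f s z \<partial>dirichlet_on I a \<partial>gamma_measure (sum a I))"
proof -
  interpret D: prob_space "dirichlet_on I a" by (rule prob_space_dirichlet_on[OF I a])
  have [measurable]: "(\<lambda>(s, z). f s z) \<in> borel_measurable (gamma_measure (sum a I) \<Otimes>\<^sub>M dirichlet_on I a)"
    using f by (subst measurable_cong_sets[OF sets_pair_measure_cong refl]) auto
  have "(\<integral>\<^sup>+s. \<integral>\<^sup>+z. f s z \<partial>dirichlet_on I a \<partial>gamma_measure (sum a I)) =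
    (\<integral>\<^sup>+p. (\<lambda>(s, z). f s z) p \<partial>(gamma_measure (sum a I) \<Otimes>\<^sub>M dirichlet_on I a))"
    by (subst D.nn_integral_fst[symmetric]) auto
  also have "\<dots> = (\<integral>\<^sup>+y. f (sum y I) (normalize_on I y) \<partial>gammas I a)"
    unfolding distr_sum_normalize_gamma[OF I a s, symmetric] using I
    by (subst nn_integral_distr) auto
  finally show ?thesis ..
qed

lemma nn_integral_sum_gamma:
  assumes I: "finite I" and a: "\<And>i. 0 \<le> a i" and s: "0 < (sum a I)"
    and f [measurable]: "f \<in> borel_measurable borel"
  shows "(\<integral>\<^sup>+y. f (sum y I) \<partial>gammas I a) = (\<integral>\<^sup>+s. f s \<partial>gamma_measure (sum a I))"
proof -
  interpret D: prob_space "dirichlet_on I a" by (rule prob_space_dirichlet_on[OF I a])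
  show ?thesis
    using nn_integral_sum_normalize_gamma[OF I a s, of "\<lambda>s z. f s"] D.emeasure_space_1 by simp
qed

lemma AE_sum_gamma_pos:
  assumes I: "finite I" and a: "\<And>i. 0 \<le> a i" and s: "0 < (sum a I)"
  shows "AE y in gammas I a. 0 < (sum y I)"
proof -
  have "\<not> (\<forall>i\<in>I. a i = 0)" 
      using s sum.neutral[of I a] by (intro notI) simp
  then obtain i where i: "i \<in> I" "a i \<noteq> 0" by auto
  interpret product_prob_space "\<lambda>i. gamma_measure (a i)" I
    by (rule product_prob_space_gamma_measure) fact
  have "AE y in gammas I a. 0 < y i"
    using I i a
    by (intro AE_PiM_component[where P="\<lambda>x. 0 < x"] AE_gamma_measure_pos)
      (auto intro: prob_space_gamma_measure)
  then show ?thesis using AE_PiM_gamma_measure_nonneg[OF I a]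
    by eventually_elim (use i I in \<open>auto intro!: sum_pos2[of _ i]\<close>)
qed

text \<open>This is the law of a sum of independent Gamma variables for the index type
  \<open>bool\<close>, with \<open>True\<close> carrying the added Gamma(1) variable.\<close>

lemma nn_integral_gamma_convolution:
  assumes a: "0 \<le> a" and f [measurable]: "f \<in> borel_measurable borel"
  shows "(\<integral>\<^sup>+e. \<integral>\<^sup>+t. f (t + e) \<partial>gamma_measure a \<partial>gamma_measure 1) = (\<integral>\<^sup>+u. f u \<partial>gamma_measure (a + 1))"
proof -
  define b where "b = (\<lambda>i. if i then 1 else a)"
  have b: "0 \<le> b i" for i using a by (simp add: b_def)
  interpret product_sigma_finite "\<lambda>i. gamma_measure (b i)"
    by (rule product_sigma_finite_gamma_measure[OF b])
  have "(\<integral>\<^sup>+u. f u \<partial>gamma_measure (a + 1)) = (\<integral>\<^sup>+u. f u \<partial>gamma_measure (\<Sum>i\<in>insert True {False}. b i))"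
    by (simp add: b_def add.commute)
  also have "\<dots> = (\<integral>\<^sup>+y. f (\<Sum>i\<in>insert True {False}. y i) \<partial>PiM (insert True {False}) (\<lambda>i. gamma_measure (b i)))"
    using b a by (subst nn_integral_sum_gamma) (auto simp: b_def)
  also have "\<dots> = (\<integral>\<^sup>+e. \<integral>\<^sup>+x. f (x False + e) \<partial>PiM {False} (\<lambda>i. gamma_measure (b i)) \<partial>gamma_measure (b True))"
    by (subst product_nn_integral_insert_rev) (auto simp: add.commute)
  also have "\<dots> = (\<integral>\<^sup>+e. \<integral>\<^sup>+t. f (t + e) \<partial>gamma_measure (b False) \<partial>gamma_measure (b True))"
    by (intro nn_integral_cong product_nn_integral_singleton) auto
  finally show ?thesis by (simp add: b_def)
qed

text \<open>This is Beta(1, \<open>s\<close>), realised as a ratio of Gamma variables so that a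
  stick step can be absorbed into the normalisation of a Gamma vector.\<close>

definition stick_law :: "real \<Rightarrow> real measure" where
  "stick_law s = distr (gamma_measure 1 \<Otimes>\<^sub>M gamma_measure s) borel (\<lambda>(e, t). e / (e + t))"

lemma sets_stick_law [simp, measurable_cong]: "sets (stick_law s) = sets borel"
  and space_stick_law [simp]: "space (stick_law s) = UNIV"
  by (auto simp: stick_law_def)

lemma prob_space_stick_law:
  assumes "0 \<le> s"
  shows "prob_space (stick_law s)"
proof -
  interpret prob_space "gamma_measure 1" by (simp add: prob_space_gamma_measure)
  interpret G: prob_space "gamma_measure s" by (rule prob_space_gamma_measure) fact
  interpret pair_prob_space "gamma_measure 1" "gamma_measure s" ..
  show ?thesis unfolding stick_law_def by (intro prob_space_distr) measurable
qed

lemma nn_integral_stick_law: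
  assumes "0 \<le> s" "f \<in> borel_measurable borel"
  shows "(\<integral>\<^sup>+v. f v \<partial>stick_law s) = (\<integral>\<^sup>+e. \<integral>\<^sup>+t. f (e / (e + t)) \<partial>gamma_measure s \<partial>gamma_measure 1)"
proof -
  interpret G: prob_space "gamma_measure s" by (rule prob_space_gamma_measure) fact
  note [measurable] = assms(2)
  have "(\<integral>\<^sup>+v. f v \<partial>stick_law s) = (\<integral>\<^sup>+p. (\<lambda>(e, t). f (e / (e + t))) p \<partial>(gamma_measure 1 \<Otimes>\<^sub>M gamma_measure s))"
    unfolding stick_law_def by (subst nn_integral_distr) (auto intro!: nn_integral_cong)
  then show ?thesis
    by (subst (asm) G.nn_integral_fst[symmetric]) auto
qed

definition stick_step :: "'i set \<Rightarrow> ('i \<Rightarrow> real) \<Rightarrow> real \<Rightarrow> ('i \<Rightarrow> real) \<Rightarrow> 'i \<Rightarrow> real" where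
  "stick_step I u v z = (\<lambda>j\<in>I. v * u j + (1 - v) * z j)"

text \<open>With \<open>S\<close> the sum of \<open>y\<close>, the factor
  \<open>1 - e / (e + S) = S / (e + S)\<close> cancels the denominator \<open>S\<close> of the
  normalisation and leaves the common denominator \<open>e + S\<close>.\<close>

lemma stick_step_normalize:
  assumes "finite I" "i \<in> I" "0 < e" "0 < (\<Sum>j\<in>I. y j)" "y \<in> Pi\<^sub>E I (\<lambda>_. UNIV)"
  shows "stick_step I (indicator {i}) (e / (e + (\<Sum>j\<in>I. y j))) (normalize_on I y) = normalize_on I (y(i := y i + e))"
proof -
  define S where "S = (\<Sum>j\<in>I. y j)"
  have S: "(\<Sum>j\<in>I. (y(i := y i + e)) j) = e + S"
    using assms by (simp add: sum.remove[of I i] S_def)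
  have "0 < S" using assms S_def by simp
  then have "1 - e / (e + S) = S / (e + S)"
    using assms(3) by (simp add: field_simps)
  moreover have "S / (e + S) * (w / S) = w / (e + S)" for w
    using \<open>0 < S\<close> by simp
  ultimately show ?thesis
    unfolding stick_step_def normalize_on_def S S_def[symmetric]
    using \<open>0 < S\<close> by (auto simp: fun_eq_iff restrict_def indicator_def add_divide_distrib)
qed

text \<open>With \<open>v = e / (e + t)\<close>, \<open>e\<close> of law Gamma(1) and \<open>t\<close> the sum of the Gamma vector, a stick step adds \<open>e\<close> to the
  \<open>i\<close>-th coordinate before normalising; the factor \<open>y i / a i\<close> is the density of Gamma(\<open>a i + 1\<close>) relative
  to Gamma(\<open>a i\<close>).\<close>

lemma dirichlet_stick_step:
  fixes I :: "'i set"
  assumes I: "finite I" "i \<in> I" and a: "\<And>i. 0 \<le> a i" and ai: "0 < a i"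
    and f [measurable]: "f \<in> borel_measurable (borel_on I)"
  defines "s \<equiv> sum a I"
  shows "(\<integral>\<^sup>+v. \<integral>\<^sup>+z. f (stick_step I (indicator {i}) v z) \<partial>dirichlet_on I a \<partial>stick_law s) =
    (\<integral>\<^sup>+y. f (normalize_on I y) * ennreal (y i / a i) \<partial>gammas I a)"
proof -
  have s: "0 < s" unfolding s_def using I a ai by (auto intro!: sum_pos2[of _ i])
  define J where "J = I - {i}"
  have J: "finite J" "i \<notin> J" "I = insert i J" using I by (auto simp: J_def)
  define P where "P = gammas J a"
  have [measurable_cong]: "sets P = sets (borel_on J)" by (simp add: P_def)
  interpret product_sigma_finite "\<lambda>i. gamma_measure (a i)"
    by (rule product_sigma_finite_gamma_measure[OF a])
  interpret D: prob_space "dirichlet_on I a" by (rule prob_space_dirichlet_on[OF I(1) a])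
  interpret G: prob_space "gamma_measure (a i)" by (rule prob_space_gamma_measure[OF a])
  interpret PP: product_prob_space "\<lambda>i. gamma_measure (a i)" J
    by (rule product_prob_space_gamma_measure) fact
  interpret P: prob_space P unfolding P_def by (rule PP.prob_space_axioms)
  interpret PP': product_prob_space "\<lambda>i. gamma_measure (a i)" I
    by (rule product_prob_space_gamma_measure) fact
  interpret G1: prob_space "gamma_measure 1" by (rule prob_space_gamma_measure) simp
  interpret pair_sigma_finite "gamma_measure 1" P ..
  have ms [measurable]: "(\<lambda>(v, z). stick_step I (indicator {i}) v z) \<in> borel \<Otimes>\<^sub>M borel_on I \<rightarrow>\<^sub>M borel_on I"
    unfolding stick_step_def case_prod_beta by (intro measurable_restrict) measurable
  have mn [measurable]: "normalize_on I \<in> borel_on I \<rightarrow>\<^sub>M borel_on I"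
    using I by measurable
  have mu [measurable]: "(\<lambda>(x, t). x(i := t)) \<in> borel_on J \<Otimes>\<^sub>M borel \<rightarrow>\<^sub>M borel_on I"
    unfolding J(3) by (rule measurable_add_dim)
  have "(\<integral>\<^sup>+v. \<integral>\<^sup>+z. f (stick_step I (indicator {i}) v z) \<partial>dirichlet_on I a \<partial>stick_law s) =
    (\<integral>\<^sup>+e. \<integral>\<^sup>+t. \<integral>\<^sup>+z. f (stick_step I (indicator {i}) (e / (e + t)) z) \<partial>dirichlet_on I a \<partial>gamma_measure s \<partial>gamma_measure 1)"
    using s by (subst nn_integral_stick_law) auto
  \<comment> \<open>Independence of sum and direction, read backwards: the independent pair
    \<open>t\<close>, \<open>z\<close> becomes the sum and the normalisation of a single Gamma
    vector \<open>y\<close>.\<close>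
  also have "\<dots> = (\<integral>\<^sup>+e. \<integral>\<^sup>+y. f (stick_step I (indicator {i}) (e / (e + (\<Sum>j\<in>I. y j))) (normalize_on I y))
       \<partial>gammas I a \<partial>gamma_measure 1)"
    using s unfolding s_def
    by (intro nn_integral_cong nn_integral_sum_normalize_gamma[OF I(1) a, symmetric]) auto
  also have "\<dots> = (\<integral>\<^sup>+e. \<integral>\<^sup>+y. f (normalize_on I (y(i := y i + e))) \<partial>gammas I a \<partial>gamma_measure 1)"
  proof (intro nn_integral_cong_AE)
    show "AE e in gamma_measure 1. (\<integral>\<^sup>+y. f (stick_step I (indicator {i}) (e / (e + (\<Sum>j\<in>I. y j))) (normalize_on I y))
       \<partial>gammas I a) = (\<integral>\<^sup>+y. f (normalize_on I (y(i := y i + e))) \<partial>gammas I a)"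
      using AE_gamma_measure_pos[of 1, simplified]
    proof eventually_elim
      case (elim e)
      show ?case
        using AE_sum_gamma_pos[OF I(1) a s[unfolded s_def]] AE_space
        by (intro nn_integral_cong_AE, eventually_elim)
          (use I elim in \<open>simp add: stick_step_normalize\<close>)
    qed
  qed
  also have "\<dots> = (\<integral>\<^sup>+e. \<integral>\<^sup>+x. \<integral>\<^sup>+t. f (normalize_on I (x(i := t + e))) \<partial>gamma_measure (a i) \<partial>P \<partial>gamma_measure 1)"
  proof (intro nn_integral_cong)
    fix e :: real
    have "(\<lambda>y. y(i := y i + e)) \<in> borel_on (insert i J) \<rightarrow>\<^sub>M borel_on (insert i J)"
      by (intro measurable_fun_upd[where J="insert i J"]) auto
    then have [measurable]: "(\<lambda>y. y(i := y i + e)) \<in> borel_on I \<rightarrow>\<^sub>M borel_on I"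
      using J by simp
    have "(\<integral>\<^sup>+y. f (normalize_on I (y(i := y i + e))) \<partial>gammas I a) =
      (\<integral>\<^sup>+y. f (normalize_on I (y(i := y i + e))) \<partial>gammas (insert i J) a)"
      using J by simp
    also have "\<dots> = (\<integral>\<^sup>+x. \<integral>\<^sup>+t. f (normalize_on I (x(i := t + e))) \<partial>gamma_measure (a i) \<partial>P)"
      unfolding P_def using J by (subst product_nn_integral_insert) (auto simp flip: J(3))
    finally show "(\<integral>\<^sup>+y. f (normalize_on I (y(i := y i + e))) \<partial>gammas I a) =
      (\<integral>\<^sup>+x. \<integral>\<^sup>+t. f (normalize_on I (x(i := t + e))) \<partial>gamma_measure (a i) \<partial>P)" .
  qed
  \<comment> \<open>The order is exchanged so that \<open>t\<close> and \<open>e\<close> become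
    innermost; their sum is then a Gamma(\<open>a i + 1\<close>) variable.\<close>
  also have "\<dots> = (\<integral>\<^sup>+x. \<integral>\<^sup>+e. \<integral>\<^sup>+t. f (normalize_on I (x(i := t + e))) \<partial>gamma_measure (a i) \<partial>gamma_measure 1 \<partial>P)"
    by (rule Fubini'[symmetric]) measurable
  also have "\<dots> = (\<integral>\<^sup>+x. \<integral>\<^sup>+u. f (normalize_on I (x(i := u))) \<partial>gamma_measure (a i + 1) \<partial>P)"
    by (intro nn_integral_cong nn_integral_gamma_convolution[OF a]) (auto simp: P_def space_PiM)
  also have "\<dots> = (\<integral>\<^sup>+x. \<integral>\<^sup>+t. f (normalize_on I (x(i := t))) * ennreal (t / a i) \<partial>gamma_measure (a i) \<partial>P)"
    using ai by (intro nn_integral_cong, subst gamma_measure_add_one, simp, subst nn_integral_density)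
      (auto simp: mult.commute P_def space_PiM)
  also have "\<dots> = (\<integral>\<^sup>+y. f (normalize_on I y) * ennreal (y i / a i) \<partial>gammas (insert i J) a)"
  proof -
    have "(\<lambda>y. y i) \<in> borel_measurable (borel_on I)"
      using I by measurable
    then have "(\<lambda>y. f (normalize_on I y) * ennreal (y i / a i)) \<in> borel_measurable (gammas I a)"
      by measurable
    then show ?thesis
      unfolding P_def J(3) by (subst product_nn_integral_insert[OF J(1,2)]) auto
  qed
  finally show ?thesis using J by simp
qed

section \<open>Invariance of the Dirichlet law under stick breaking\<close>

lemma measurable_stick_step [measurable (raw)]:
  assumes "u \<in> N \<rightarrow>\<^sub>M borel_on I" "v \<in> borel_measurable N" "z \<in> N \<rightarrow>\<^sub>M borel_on I"
  shows "(\<lambda>x. stick_step I (u x) (v x) (z x)) \<in> N \<rightarrow>\<^sub>M borel_on I"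
proof -
  note [measurable] = assms
  show ?thesis unfolding stick_step_def by (intro measurable_restrict) measurable
qed

lemma stick_step_restrict [simp]: "stick_step I (restrict u I) v z = stick_step I u v z"
  by (auto simp: stick_step_def)

text \<open>The atom lies in \<open>B i\<close> with probability \<open>a i / \<alpha>\<close>, and
  a step towards coordinate \<open>i\<close> weights the Gamma vector by \<open>y i / a i\<close>.
  The mixture carries the weight \<open>sum y I / \<alpha>\<close>; it is independent of the
  direction and has mean one, so it integrates out.\<close>

lemma dirichlet_stick_fixed_point:
  fixes B :: "nat \<Rightarrow> 'a set"
  assumes G: "prob_space G" and B: "\<And>i. i < k \<Longrightarrow> B i \<in> sets G"
    and disj: "disjoint_family_on B {..<k}" and un: "(\<Union>i<k. B i) = space G"
    and \<alpha>: "0 < \<alpha>"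
    and f [measurable]: "f \<in> borel_measurable (borel_on {..<k})"
  defines "D \<equiv> dirichlet_on {..<k} (\<lambda>i. \<alpha> * measure G (B i))"
  shows "(\<integral>\<^sup>+p. \<integral>\<^sup>+z. f (stick_step {..<k} (\<lambda>j. indicator (B j) (snd p)) (fst p) z) \<partial>D \<partial>(stick_law \<alpha> \<Otimes>\<^sub>M G)) = (\<integral>\<^sup>+z. f z \<partial>D)"
proof -
  interpret G: prob_space G by fact
  define a where "a = (\<lambda>i. \<alpha> * measure G (B i))"
  define P where "P = gammas {..<k} a"
  define I where "I = {..<k}"
  have a: "0 \<le> a i" for i using \<alpha> by (simp add: a_def)
  have sum_a: "(sum a I) = \<alpha>"
  proof -
    have "(\<Sum>i<k. measure G (B i)) = measure G (\<Union>i<k. B i)"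
      using B disj by (intro G.finite_measure_finite_Union[symmetric]) auto
    then show ?thesis by (simp add: a_def I_def sum_distrib_left[symmetric] un G.prob_space)
  qed
  have D: "D = dirichlet_on I a" by (simp add: D_def a_def I_def)
  interpret D: prob_space D unfolding D by (rule prob_space_dirichlet_on) (auto simp: a I_def)
  interpret SL: prob_space "stick_law \<alpha>" using \<alpha> by (intro prob_space_stick_law) simp
  interpret pair_sigma_finite "stick_law \<alpha>" G ..
  have [measurable_cong]: "sets D = sets (borel_on I)" by (simp add: D)
  have fI [measurable]: "f \<in> borel_measurable (borel_on I)" using f by (simp add: I_def)
  \<comment> \<open>\<open>J i\<close> is the value of the two inner integrals when the atom falls
    into the \<open>i\<close>-th block.\<close>
  define J where "J = (\<lambda>i. \<integral>\<^sup>+v. \<integral>\<^sup>+z. f (stick_step I (indicator {i}) v z) \<partial>D \<partial>stick_law \<alpha>)"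
  have [measurable]: "(\<lambda>p. restrict (\<lambda>j. indicator (B j) (snd p)) I) \<in> stick_law \<alpha> \<Otimes>\<^sub>M G \<rightarrow>\<^sub>M borel_on I"
    using B by (intro measurable_restrict) (auto simp: I_def)
  have "(\<lambda>p. \<integral>\<^sup>+z. f (stick_step I (restrict (\<lambda>j. indicator (B j) (snd p)) I) (fst p) z) \<partial>D) \<in> borel_measurable (stick_law \<alpha> \<Otimes>\<^sub>M G)"
    by measurable
  then have m: "(\<lambda>p. \<integral>\<^sup>+z. f (stick_step I (\<lambda>j. indicator (B j) (snd p)) (fst p) z) \<partial>D) \<in> borel_measurable (stick_law \<alpha> \<Otimes>\<^sub>M G)"
    by simp
  have "(\<integral>\<^sup>+p. \<integral>\<^sup>+z. f (stick_step I (\<lambda>j. indicator (B j) (snd p)) (fst p) z) \<partial>D \<partial>(stick_law \<alpha> \<Otimes>\<^sub>M G)) =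
    (\<integral>\<^sup>+x. \<integral>\<^sup>+v. \<integral>\<^sup>+z. f (stick_step I (\<lambda>j. indicator (B j) x) v z) \<partial>D \<partial>stick_law \<alpha> \<partial>G)"
    using nn_integral_snd[OF m] by simp
  also have "\<dots> = (\<integral>\<^sup>+x. (\<Sum>i\<in>I. J i * indicator (B i) x) \<partial>G)"
  proof (intro nn_integral_cong)
    fix x assume "x \<in> space G"
    then obtain i where i: "i \<in> I" "x \<in> B i" using un by (auto simp: I_def)
    have ind: "(indicator (B j) x :: 'b::zero_neq_one) = indicator {i} j" if "j \<in> I" for j
      using disj i that by (auto simp: disjoint_family_on_def indicator_def I_def)
    have "(\<integral>\<^sup>+v. \<integral>\<^sup>+z. f (stick_step I (\<lambda>j. indicator (B j) x) v z) \<partial>D \<partial>stick_law \<alpha>) = J i"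
      unfolding J_def
      by (intro nn_integral_cong arg_cong[where f=f]) (auto simp: stick_step_def ind)
    moreover have "(\<Sum>j\<in>I. J j * indicator (B j) x) = (\<Sum>j\<in>I. if j = i then J i else 0)"
      using disj i by (intro sum.cong) (auto simp: disjoint_family_on_def indicator_def I_def)
    ultimately show "(\<integral>\<^sup>+v. \<integral>\<^sup>+z. f (stick_step I (\<lambda>j. indicator (B j) x) v z) \<partial>D \<partial>stick_law \<alpha>) =
      (\<Sum>i\<in>I. J i * indicator (B i) x)"
      using i by (simp add: I_def)
  qed
  also have "\<dots> = (\<Sum>i\<in>I. J i * emeasure G (B i))"
    using B by (subst nn_integral_sum) (auto simp: I_def nn_integral_cmult)
  also have "\<dots> = (\<Sum>i\<in>I. \<integral>\<^sup>+y. f (normalize_on I y) * ennreal (y i / \<alpha>) \<partial>P)"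
  proof (intro sum.cong refl)
    fix i assume i: "i \<in> I"
    interpret PP: product_prob_space "\<lambda>i. gamma_measure (a i)" I
      by (rule product_prob_space_gamma_measure) fact
    have my: "(\<lambda>y. y i) \<in> borel_measurable P"
      unfolding P_def using i by (simp add: I_def)
    have mN: "(\<lambda>y. f (normalize_on I y)) \<in> borel_measurable P"
      unfolding P_def I_def by measurable
    show "J i * emeasure G (B i) = (\<integral>\<^sup>+y. f (normalize_on I y) * ennreal (y i / \<alpha>) \<partial>P)"
    proof (cases "a i = 0")
      \<comment> \<open>A block of mass zero: the left side vanishes with
        \<open>emeasure G (B i)\<close>, the right side because a Gamma variable of parameter zero
        is zero.\<close>
      case True
      then have "emeasure G (B i) = 0" using \<alpha> by (simp add: a_def G.emeasure_eq_measure)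
      moreover have "AE y in P. y i = 0"
        unfolding P_def I_def[symmetric] using i a True
      proof (intro AE_PiM_component[where P="\<lambda>x. x = 0"])
        show "AE x in gamma_measure (a i). x = 0"
          using AE_return[of "0::real" borel "\<lambda>x. x = 0"] True unfolding gamma_measure_def by simp
      qed (use i a in \<open>auto intro: prob_space_gamma_measure\<close>)
      then have "(\<integral>\<^sup>+y. f (normalize_on I y) * ennreal (y i / \<alpha>) \<partial>P) = (\<integral>\<^sup>+y. 0 \<partial>P)"
        by (intro nn_integral_cong_AE) (auto elim!: eventually_mono)
      ultimately show ?thesis by simp
    next
      case False
      then have ai: "0 < a i" using a[of i] by simp
      have "J i = (\<integral>\<^sup>+y. f (normalize_on I y) * ennreal (y i / a i) \<partial>P)"
        unfolding J_def D P_def sum_a[symmetric] I_def[symmetric]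
        using i a ai by (intro dirichlet_stick_step) (auto simp: I_def)
      then have "J i * emeasure G (B i) = (\<integral>\<^sup>+y. f (normalize_on I y) * ennreal (y i / a i) * emeasure G (B i) \<partial>P)"
        using my mN by (subst nn_integral_multc) auto
      also have "\<dots> = (\<integral>\<^sup>+y. f (normalize_on I y) * ennreal (y i / \<alpha>) \<partial>P)"
      proof (intro nn_integral_cong)
        fix y :: "nat \<Rightarrow> real"
        have "ennreal (y i / a i) * emeasure G (B i) = ennreal (y i / a i * measure G (B i))"
          by (simp add: G.emeasure_eq_measure ennreal_mult''[symmetric])
        also have "y i / a i * measure G (B i) = y i / \<alpha>"
        proof -
          have "0 < measure G (B i)" using ai \<alpha> by (simp add: a_def zero_less_mult_iff)
          then show ?thesis by (simp add: a_def)
        qed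
        finally show "f (normalize_on I y) * ennreal (y i / a i) * emeasure G (B i) = f (normalize_on I y) * ennreal (y i / \<alpha>)"
          by (simp add: mult.assoc)
      qed
      finally show ?thesis .
    qed
  qed
  also have "\<dots> = (\<integral>\<^sup>+y. (\<Sum>i\<in>I. f (normalize_on I y) * ennreal (y i / \<alpha>)) \<partial>P)"
    unfolding P_def I_def by (subst nn_integral_sum) auto
  also have "\<dots> = (\<integral>\<^sup>+y. f (normalize_on I y) * ennreal ((sum y I) / \<alpha>) \<partial>P)"
  proof (rule nn_integral_cong_AE)
    show "AE y in P. (\<Sum>i\<in>I. f (normalize_on I y) * ennreal (y i / \<alpha>)) = f (normalize_on I y) * ennreal ((sum y I) / \<alpha>)"
      using AE_PiM_gamma_measure_nonneg[OF finite_lessThan a, of k] unfolding P_def I_def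
    proof eventually_elim
      case (elim y)
      have "(\<Sum>i<k. ennreal (y i / \<alpha>)) = ennreal (\<Sum>i<k. y i / \<alpha>)"
        using elim \<alpha> by (intro sum_ennreal) auto
      then show ?case by (simp add: sum_distrib_left[symmetric] sum_divide_distrib)
    qed
  qed
  also have "\<dots> = (\<integral>\<^sup>+s. \<integral>\<^sup>+z. f z * ennreal (s / \<alpha>) \<partial>dirichlet_on I a \<partial>gamma_measure (sum a I))"
    unfolding P_def I_def[symmetric] using sum_a \<alpha> a
    by (subst nn_integral_sum_normalize_gamma[symmetric]) (auto simp: I_def)
  also have "\<dots> = (\<integral>\<^sup>+s. (\<integral>\<^sup>+z. f z \<partial>D) * ennreal (s / \<alpha>) \<partial>gamma_measure \<alpha>)"
    unfolding sum_a D[symmetric] by (subst nn_integral_multc) auto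
  also have "\<dots> = (\<integral>\<^sup>+z. f z \<partial>D) * (\<integral>\<^sup>+s. ennreal (1 / \<alpha>) * ennreal s \<partial>gamma_measure \<alpha>)"
    using \<alpha> by (subst nn_integral_cmult) (auto simp: ennreal_mult'[symmetric])
  also have "(\<integral>\<^sup>+s. ennreal (1 / \<alpha>) * ennreal s \<partial>gamma_measure \<alpha>) = 1"
    using \<alpha> by (subst nn_integral_cmult) (auto simp: nn_integral_gamma_measure_id ennreal_mult'[symmetric])
  finally show ?thesis by (simp add: I_def)
qed

section \<open>Finite-dimensional laws and almost sure limits\<close>

lemma sets_PiM_eq_sigma_atMost:
  fixes I :: "'i set"
  assumes "finite I"
  shows "sets (borel_on I) =
    sigma_sets (Pi\<^sub>E I (\<lambda>_. UNIV)) (range (\<lambda>c. Pi\<^sub>E I (\<lambda>i. {..c i})))" (is "_ = sigma_sets ?\<Omega> ?E")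
proof
  have E: "?E \<subseteq> Pow ?\<Omega>" by (auto simp: PiE_iff)
  have coord: "(\<lambda>x. x i) \<in> borel_measurable (sigma ?\<Omega> ?E)" if i: "i \<in> I" for i
  proof (rule borel_measurableI_le)
    fix c :: real
    \<comment> \<open>The coordinates other than \<open>i\<close> are freed by letting their common
      bound run through the naturals.\<close>
    have "{x \<in> space (sigma ?\<Omega> ?E). x i \<le> c} = (\<Union>n::nat. Pi\<^sub>E I (\<lambda>j. {..if j = i then c else real n}))"
    proof (intro set_eqI iffI)
      fix x assume x: "x \<in> {x \<in> space (sigma ?\<Omega> ?E). x i \<le> c}"
      obtain n :: nat where n: "(\<Sum>j\<in>I. \<bar>x j\<bar>) \<le> real n" using real_arch_simple by blast
      have "x j \<le> real n" if "j \<in> I" for j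
        using member_le_sum[OF that, of "\<lambda>j. \<bar>x j\<bar>"] assms n by auto
      then show "x \<in> (\<Union>n::nat. Pi\<^sub>E I (\<lambda>j. {..if j = i then c else real n}))"
        using x E by (auto simp: PiE_iff intro!: exI[of _ n])
    qed (use i E in \<open>auto simp: PiE_iff\<close>)
    also have "\<dots> \<in> sets (sigma ?\<Omega> ?E)"
      using E by (intro sets.countable_UN) auto
    finally show "{x \<in> space (sigma ?\<Omega> ?E). x i \<le> c} \<in> sets (sigma ?\<Omega> ?E)" .
  qed
  have id: "(\<lambda>x i. x i) \<in> sigma ?\<Omega> ?E \<rightarrow>\<^sub>M borel_on I"
    using coord E by (intro measurable_PiM_single') auto
  show "sets (borel_on I) \<subseteq> sigma_sets ?\<Omega> ?E"
  proof
    fix A assume A: "A \<in> sets (borel_on I)"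
    have "A \<subseteq> ?\<Omega>" using sets.sets_into_space[OF A] by (simp add: space_PiM)
    then have "(\<lambda>x i. x i) -` A \<inter> space (sigma ?\<Omega> ?E) = A" using E by auto
    then show "A \<in> sigma_sets ?\<Omega> ?E"
      using measurable_sets[OF id A] E by simp
  qed
  have "?E \<subseteq> sets (borel_on I)"
    using assms by (auto intro!: sets_PiM_I_finite)
  then show "sigma_sets ?\<Omega> ?E \<subseteq> sets (borel_on I)"
    using sets.sigma_sets_subset[of ?E "borel_on I"] by (simp add: space_PiM)
qed

lemma measure_eqI_PiM_atMost:
  fixes I :: "'i set"
  assumes I: "finite I" and sets: "sets M = sets (borel_on I)" "sets N = sets (borel_on I)"
    and M: "finite_measure M"
    and eq: "\<And>c. emeasure M (Pi\<^sub>E I (\<lambda>i. {..c i})) = emeasure N (Pi\<^sub>E I (\<lambda>i. {..c i}))"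
  shows "M = N"
proof (rule measure_eqI_generator_eq[where E="range (\<lambda>c. Pi\<^sub>E I (\<lambda>i. {..c i}))" and \<Omega>="Pi\<^sub>E I (\<lambda>_. UNIV)"
      and A="\<lambda>n. Pi\<^sub>E I (\<lambda>i. {..real n})"])
  have "Pi\<^sub>E I (\<lambda>i. {..c i}) \<inter> Pi\<^sub>E I (\<lambda>i. {..d i}) = Pi\<^sub>E I (\<lambda>i. {..min (c i) (d i)})" for c d :: "'i \<Rightarrow> real"
    by (auto simp: PiE_iff)
  then show "Int_stable (range (\<lambda>c. Pi\<^sub>E I (\<lambda>i. {..c i :: real})))"
    by (fastforce simp: Int_stable_def)
  show "sets M = sigma_sets (Pi\<^sub>E I (\<lambda>_. UNIV)) (range (\<lambda>c. Pi\<^sub>E I (\<lambda>i. {..c i})))"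
    "sets N = sigma_sets (Pi\<^sub>E I (\<lambda>_. UNIV)) (range (\<lambda>c. Pi\<^sub>E I (\<lambda>i. {..c i})))"
    using sets sets_PiM_eq_sigma_atMost[OF I] by auto
  show "(\<Union>n::nat. Pi\<^sub>E I (\<lambda>i. {..real n})) = Pi\<^sub>E I (\<lambda>_. UNIV)"
  proof (intro set_eqI iffI)
    fix x :: "'i \<Rightarrow> real" assume x: "x \<in> Pi\<^sub>E I (\<lambda>_. UNIV)"
    obtain n :: nat where n: "(\<Sum>j\<in>I. \<bar>x j\<bar>) \<le> real n" using real_arch_simple by blast
    have "x j \<le> real n" if "j \<in> I" for j
      using member_le_sum[OF that, of "\<lambda>j. \<bar>x j\<bar>"] I n by auto
    then show "x \<in> (\<Union>n::nat. Pi\<^sub>E I (\<lambda>i. {..real n}))"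
      using x by (auto simp: PiE_iff intro!: exI[of _ n])
  qed (auto simp: PiE_iff)
  show "emeasure M (Pi\<^sub>E I (\<lambda>i. {..real n})) \<noteq> \<infinity>" for n
    using M by (simp add: finite_measure.emeasure_finite)
qed (auto simp: eq PiE_iff)

text \<open>Almost sure convergence passes to expectations of bounded continuous functions.
  Continuous functions converging to the indicator of a closed lower box then transfer the law,
  because such boxes determine a finite measure.\<close>

lemma distr_eq_if_AE_limit:
  fixes I :: "'i set" and X :: "nat \<Rightarrow> 'w \<Rightarrow> 'i \<Rightarrow> real"
  assumes I: "finite I" and \<Omega>: "prob_space \<Omega>"
    and X [measurable]: "\<And>n. X n \<in> \<Omega> \<rightarrow>\<^sub>M borel_on I" and Y [measurable]: "Y \<in> \<Omega> \<rightarrow>\<^sub>M borel_on I"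
    and law: "\<And>n. distr \<Omega> (borel_on I) (X n) = L"
    and lim: "AE \<omega> in \<Omega>. \<forall>i\<in>I. (\<lambda>n. X n \<omega> i) \<longlonglongrightarrow> Y \<omega> i"
  shows "distr \<Omega> (borel_on I) Y = L"
proof (rule measure_eqI_PiM_atMost[OF I])
  interpret prob_space \<Omega> by fact
  have L: "prob_space L" "sets L = sets (borel_on I)"
    using law[of 0] by (auto intro!: prob_space_distr)
  interpret L: prob_space L by fact
  have Y': "prob_space (distr \<Omega> (borel_on I) Y)" by (rule prob_space_distr) measurable
  then show "finite_measure (distr \<Omega> (borel_on I) Y)" by (simp add: prob_space_def)
  show "sets L = sets (borel_on I)" by fact
  fix c :: "'i \<Rightarrow> real"
  \<comment> \<open>A product of ramps: one on the box and, for positive \<open>m\<close>, zero as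
    soon as some coordinate exceeds its bound by \<open>1 / m\<close>.\<close>
  define g where "g = (\<lambda>m::nat. \<lambda>x. \<Prod>i\<in>I. max 0 (1 - real m * max 0 (x i - c i)))"
  have g [measurable]: "g m \<in> borel_measurable (borel_on I)" for m
    unfolding g_def by measurable
  have g01: "0 \<le> g m x" "g m x \<le> 1" for m x
    unfolding g_def by (auto intro!: prod_nonneg prod_le_1)
  have box: "(\<lambda>m. \<integral>x. g m x \<partial>N) \<longlonglongrightarrow> measure N (Pi\<^sub>E I (\<lambda>i. {..c i}))"
    if N: "prob_space N" and setsN [measurable_cong]: "sets N = sets (borel_on I)" for N
  proof -
    interpret N: prob_space N by fact
    have "Pi\<^sub>E I (\<lambda>i. {..c i}) \<in> sets N" using I setsN by simp
    moreover have "(\<lambda>m. \<integral>x. g m x \<partial>N) \<longlonglongrightarrow> (\<integral>x. indicator (Pi\<^sub>E I (\<lambda>i. {..c i})) x \<partial>N)"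
    proof (rule integral_dominated_convergence[where w="\<lambda>_. 1"])
      show "AE x in N. (\<lambda>m. g m x) \<longlonglongrightarrow> indicator (Pi\<^sub>E I (\<lambda>i. {..c i})) x"
      proof (rule AE_I2)
        fix x assume "x \<in> space N"
        then have ext: "x \<in> extensional I" using sets_eq_imp_space_eq[OF setsN] by (simp add: space_PiM PiE_iff)
        show "(\<lambda>m. g m x) \<longlonglongrightarrow> indicator (Pi\<^sub>E I (\<lambda>i. {..c i})) x"
        proof (cases "\<forall>i\<in>I. x i \<le> c i")
          case True
          then have "g m x = 1" for m unfolding g_def by (auto intro!: prod.neutral)
          then show ?thesis using True ext by (simp add: indicator_def PiE_iff)
        next
          case False
          then obtain i where i: "i \<in> I" "c i < x i" by auto
          obtain m0 :: nat where m0: "1 \<le> real m0 * (x i - c i)"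
            using i reals_Archimedean3[of "x i - c i"] by (meson diff_gt_0_iff_gt less_imp_le)
          have "g m x = 0" if "m0 \<le> m" for m
          proof -
            have "real m0 * (x i - c i) \<le> real m * (x i - c i)"
              using that i by (intro mult_right_mono) auto
            then have "1 \<le> real m * (x i - c i)" using m0 by linarith
            then have "max 0 (1 - real m * max 0 (x i - c i)) = 0"
              using i by (simp add: max_def)
            then show ?thesis
              unfolding g_def using i I by (intro prod_zero bexI[of _ i])
          qed
          then have "(\<lambda>m. g m x) \<longlonglongrightarrow> 0"
            by (intro tendsto_eventually) (auto simp: eventually_sequentially)
          moreover have "x \<notin> Pi\<^sub>E I (\<lambda>i. {..c i})" using i by (auto simp: PiE_iff not_le intro!: bexI[of _ i])
          ultimately show ?thesis by simp
        qed
      qed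
    qed (use g01 I setsN in \<open>auto\<close>)
    ultimately show ?thesis by (simp add: N.emeasure_eq_measure)
  qed
  have "(\<integral>x. g m x \<partial>distr \<Omega> (borel_on I) Y) = (\<integral>x. g m x \<partial>L)" for m
  proof -
    have "(\<lambda>n. \<integral>\<omega>. g m (X n \<omega>) \<partial>\<Omega>) \<longlonglongrightarrow> (\<integral>\<omega>. g m (Y \<omega>) \<partial>\<Omega>)"
    proof (rule integral_dominated_convergence[where w="\<lambda>_. 1"])
      show "AE \<omega> in \<Omega>. (\<lambda>n. g m (X n \<omega>)) \<longlonglongrightarrow> g m (Y \<omega>)"
        using lim unfolding g_def by eventually_elim (intro tendsto_intros, auto)
    qed (use g01 in \<open>auto\<close>)
    moreover have "(\<integral>\<omega>. g m (X n \<omega>) \<partial>\<Omega>) = (\<integral>x. g m x \<partial>L)" for n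
      unfolding law[of n, symmetric] by (subst integral_distr) auto
    ultimately have "(\<integral>\<omega>. g m (Y \<omega>) \<partial>\<Omega>) = (\<integral>x. g m x \<partial>L)"
      by (simp add: LIMSEQ_const_iff)
    then show ?thesis by (subst integral_distr) auto
  qed
  then have "measure (distr \<Omega> (borel_on I) Y) (Pi\<^sub>E I (\<lambda>i. {..c i})) = measure L (Pi\<^sub>E I (\<lambda>i. {..c i}))"
    using box[OF Y'] box[OF L] by (intro LIMSEQ_unique) auto
  then show "emeasure (distr \<Omega> (borel_on I) Y) (Pi\<^sub>E I (\<lambda>i. {..c i})) = emeasure L (Pi\<^sub>E I (\<lambda>i. {..c i}))"
    using Y' by (simp add: L.emeasure_eq_measure finite_measure.emeasure_eq_measure prob_space_def)
qed simp

section \<open>Stick-breaking construction\<close>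

lemma AE_stick_law:
  assumes "0 < \<alpha>"
  shows "AE v in stick_law \<alpha>. 0 < v \<and> v < 1"
proof -
  have "emeasure (stick_law \<alpha>) (- {0<..<1}) = (\<integral>\<^sup>+v. indicator (- {0<..<1}) v \<partial>stick_law \<alpha>)"
    by simp
  also have "\<dots> = (\<integral>\<^sup>+e. \<integral>\<^sup>+t. indicator (- {0<..<1}) (e / (e + t)) \<partial>gamma_measure \<alpha> \<partial>gamma_measure 1)"
    using assms by (intro nn_integral_stick_law) auto
  also have "\<dots> = (\<integral>\<^sup>+e. \<integral>\<^sup>+t. 0 \<partial>gamma_measure \<alpha> \<partial>gamma_measure 1)"
  proof (intro nn_integral_cong_AE)
    show "AE e in gamma_measure 1. (\<integral>\<^sup>+t. indicator (- {0<..<1}) (e / (e + t)) \<partial>gamma_measure \<alpha>) = (\<integral>\<^sup>+t. 0 \<partial>gamma_measure \<alpha>)"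
      using AE_gamma_measure_pos[of 1, simplified]
    proof eventually_elim
      case (elim e)
      have "AE t in gamma_measure \<alpha>. 0 < t" using assms by (intro AE_gamma_measure_pos) simp
      then show ?case
        by (intro nn_integral_cong_AE) (use elim in \<open>auto elim!: eventually_mono simp: indicator_def\<close>)
    qed
  qed
  finally have "emeasure (stick_law \<alpha>) (- {0<..<1}) = 0" by simp
  then show ?thesis
    by (intro AE_I[where N="- {0<..<1}"]) auto
qed

definition stick_rest :: "(nat \<Rightarrow> real \<times> 'a) \<Rightarrow> nat \<Rightarrow> real" where
  "stick_rest \<omega> n = (\<Prod>l<n. 1 - fst (\<omega> l))"

definition stick_weight :: "(nat \<Rightarrow> real \<times> 'a) \<Rightarrow> nat \<Rightarrow> real" where
  "stick_weight \<omega> n = fst (\<omega> n) * stick_rest \<omega> n"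

lemma sum_stick_weight: "(\<Sum>j<n. stick_weight \<omega> j) = 1 - stick_rest \<omega> n"
  by (induction n) (auto simp: stick_weight_def stick_rest_def algebra_simps)

lemma stick_rest_case_nat: "stick_rest (case_nat s \<omega>) (Suc n) = (1 - fst s) * stick_rest \<omega> n"
  unfolding stick_rest_def by (subst prod.lessThan_Suc_shift) simp

lemma stick_weight_case_nat:
  "stick_weight (case_nat s \<omega>) 0 = fst s"
  "stick_weight (case_nat s \<omega>) (Suc n) = (1 - fst s) * stick_weight \<omega> n"
  by (simp_all add: stick_weight_def stick_rest_case_nat) (simp add: stick_rest_def)

text \<open>The unbroken remainder is distributed according to a further vector \<open>z\<close>.
  With \<open>z\<close> independent and Dirichlet, the truncation has the exact Dirichlet law for
  each \<open>n\<close>, not only in the limit.\<close>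

definition stick_truncation :: "(nat \<Rightarrow> 'a set) \<Rightarrow> nat \<Rightarrow> nat \<Rightarrow> (nat \<Rightarrow> real \<times> 'a) \<Rightarrow> (nat \<Rightarrow> real) \<Rightarrow> nat \<Rightarrow> real" where
  "stick_truncation B k n \<omega> z =
    (\<lambda>i\<in>{..<k}. (\<Sum>j<n. stick_weight \<omega> j * indicator (B i) (snd (\<omega> j))) + stick_rest \<omega> n * z i)"

lemma stick_truncation_0: "z \<in> extensional {..<k} \<Longrightarrow> stick_truncation B k 0 \<omega> z = z"
  by (auto simp: stick_truncation_def stick_rest_def fun_eq_iff extensional_def)

text \<open>The recursion works at the front and not at the end: removing the first stick leaves an
  i.i.d. sequence of the same law, so that one stick step is applied to a truncation of the same
  kind.\<close>

lemma stick_truncation_case_nat: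
  "stick_truncation B k (Suc n) (case_nat s \<omega>) z =
    stick_step {..<k} (\<lambda>i. indicator (B i) (snd s)) (fst s) (stick_truncation B k n \<omega> z)"
proof -
  have "(\<Sum>j<Suc n. stick_weight (case_nat s \<omega>) j * u (snd (case_nat s \<omega> j))) =
    fst s * u (snd s) + (1 - fst s) * (\<Sum>j<n. stick_weight \<omega> j * u (snd (\<omega> j)))" for u :: "'a \<Rightarrow> real"
    by (simp add: sum.lessThan_Suc_shift stick_weight_case_nat sum_distrib_left mult.assoc del: sum.lessThan_Suc)
  from this[of "indicator (B _)"] show ?thesis
    unfolding stick_truncation_def stick_step_def
    by (intro ext) (simp add: restrict_def stick_rest_case_nat distrib_left mult.assoc del: sum.lessThan_Suc)
qed

text \<open>The fallback \<open>G\<close>, used where the weights do not sum to one, makes the value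
  a probability measure at every sample point, as a map into \<open>prob_algebra G\<close> requires.
  Under the stick law this event is null.\<close>

definition stick_measure :: "'a measure \<Rightarrow> (nat \<Rightarrow> real \<times> 'a) \<Rightarrow> 'a measure" where
  "stick_measure G \<omega> = (if (\<Sum>n. ennreal (stick_weight \<omega> n)) = 1
     then distr (density (count_space UNIV) (\<lambda>n. ennreal (stick_weight \<omega> n))) G (\<lambda>n. snd (\<omega> n))
     else G)"

locale stick_breaking = prob_space G for G :: "'a measure" +
  fixes \<alpha> :: real
  assumes \<alpha>_pos: "0 < \<alpha>"
begin

sublocale SL: prob_space "stick_law \<alpha>"
  using \<alpha>_pos by (intro prob_space_stick_law) simp

sublocale SG: pair_prob_space "stick_law \<alpha>" G ..

sublocale seq: sequence_space "stick_law \<alpha> \<Otimes>\<^sub>M G"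
  by (intro sequence_space.intro product_prob_spaceI SG.prob_space_axioms)

abbreviation "sticks \<equiv> PiM (UNIV :: nat set) (\<lambda>_. stick_law \<alpha> \<Otimes>\<^sub>M G)"

lemma measurable_stick_component [measurable]:
  "(\<lambda>\<omega>. fst (\<omega> n)) \<in> borel_measurable sticks" "(\<lambda>\<omega>. snd (\<omega> n)) \<in> sticks \<rightarrow>\<^sub>M G"
proof -
  have "(\<lambda>\<omega>. \<omega> n) \<in> sticks \<rightarrow>\<^sub>M stick_law \<alpha> \<Otimes>\<^sub>M G" by measurable
  from measurable_compose[OF this measurable_fst] measurable_compose[OF this measurable_snd]
  show "(\<lambda>\<omega>. fst (\<omega> n)) \<in> borel_measurable sticks" "(\<lambda>\<omega>. snd (\<omega> n)) \<in> sticks \<rightarrow>\<^sub>M G"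
    by (simp_all add: measurable_cong_sets[OF refl sets_stick_law])
qed

lemma measurable_stick_rest [measurable]: "(\<lambda>\<omega>. stick_rest \<omega> n) \<in> borel_measurable sticks"
  unfolding stick_rest_def by measurable

lemma measurable_stick_weight [measurable]: "(\<lambda>\<omega>. stick_weight \<omega> n) \<in> borel_measurable sticks"
  unfolding stick_weight_def by measurable

lemma nn_integral_sticks_shift:
  assumes f [measurable]: "f \<in> borel_measurable sticks"
  shows "(\<integral>\<^sup>+\<omega>. f \<omega> \<partial>sticks) = (\<integral>\<^sup>+s. \<integral>\<^sup>+\<omega>. f (case_nat s \<omega>) \<partial>sticks \<partial>(stick_law \<alpha> \<Otimes>\<^sub>M G))"
proof -
  have "(\<integral>\<^sup>+\<omega>. f \<omega> \<partial>sticks) = (\<integral>\<^sup>+p. (\<lambda>(s, \<omega>). f (case_nat s \<omega>)) p \<partial>((stick_law \<alpha> \<Otimes>\<^sub>M G) \<Otimes>\<^sub>M sticks))"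
    by (subst seq.PiM_iter[symmetric], subst nn_integral_distr) (auto simp: case_prod_beta')
  also have "\<dots> = (\<integral>\<^sup>+s. \<integral>\<^sup>+\<omega>. f (case_nat s \<omega>) \<partial>sticks \<partial>(stick_law \<alpha> \<Otimes>\<^sub>M G))"
    by (subst seq.P.nn_integral_fst[symmetric]) (auto simp: case_prod_beta')
  finally show ?thesis .
qed

lemma AE_stick_bounds: "AE \<omega> in sticks. \<forall>n. 0 < fst (\<omega> n) \<and> fst (\<omega> n) < 1"
proof (subst AE_all_countable, intro allI)
  fix n
  have "AE p in stick_law \<alpha> \<Otimes>\<^sub>M G. 0 < fst p \<and> fst p < 1"
  proof (rule SG.AE_pair_measure)
    show "{x \<in> space (stick_law \<alpha> \<Otimes>\<^sub>M G). 0 < fst x \<and> fst x < 1} \<in> sets (stick_law \<alpha> \<Otimes>\<^sub>M G)"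
      by measurable
    show "AE x in stick_law \<alpha>. AE y in G. 0 < fst (x, y) \<and> fst (x, y) < 1"
      using AE_stick_law[OF \<alpha>_pos] by simp
  qed
  then show "AE \<omega> in sticks. 0 < fst (\<omega> n) \<and> fst (\<omega> n) < 1"
    by (intro AE_PiM_component[where P="\<lambda>p. 0 < fst p \<and> fst p < 1"] SG.prob_space_axioms) auto
qed

text \<open>The factors are independent, so the mean remainder is \<open>q ^ n\<close>, where
  \<open>q < 1\<close> is the mean of \<open>1 - v\<close>. The infimum over \<open>n\<close>
  therefore has mean zero, and a decreasing sequence tends to its infimum.\<close>

lemma stick_rest_tendsto_0: "AE \<omega> in sticks. stick_rest \<omega> \<longlonglongrightarrow> 0"
proof -
  define q where "q = (\<integral>\<^sup>+v. ennreal (1 - v) \<partial>stick_law \<alpha>)"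
  have "q < 1"
  proof -
    have "q + (\<integral>\<^sup>+v. ennreal v \<partial>stick_law \<alpha>) = (\<integral>\<^sup>+v. ennreal (1 - v) + ennreal v \<partial>stick_law \<alpha>)"
      unfolding q_def by (subst nn_integral_add) auto
    also have "\<dots> = (\<integral>\<^sup>+v. 1 \<partial>stick_law \<alpha>)"
    proof (intro nn_integral_cong_AE)
      show "AE v in stick_law \<alpha>. ennreal (1 - v) + ennreal v = 1"
        using AE_stick_law[OF \<alpha>_pos] by eventually_elim (simp flip: ennreal_plus)
    qed
    finally have eq: "q + (\<integral>\<^sup>+v. ennreal v \<partial>stick_law \<alpha>) = 1"
      using SL.emeasure_space_1 by simp
    then have "q \<le> 1" by (metis le_iff_add)
    have "(\<integral>\<^sup>+v. ennreal v \<partial>stick_law \<alpha>) \<noteq> 0"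
    proof
      assume "(\<integral>\<^sup>+v. ennreal v \<partial>stick_law \<alpha>) = 0"
      then have "AE v in stick_law \<alpha>. ennreal v = 0" by (subst (asm) nn_integral_0_iff_AE) auto
      with AE_stick_law[OF \<alpha>_pos] have "AE v in stick_law \<alpha>. False" by eventually_elim auto
      then show False by (simp add: SL.AE_False)
    qed
    then have "q \<noteq> 1"
      using eq ennreal_add_left_cancel[of 1 "\<integral>\<^sup>+v. ennreal v \<partial>stick_law \<alpha>" 0] by auto
    with \<open>q \<le> 1\<close> show "q < 1" by simp
  qed
  have rest_int: "(\<integral>\<^sup>+\<omega>. (\<Prod>l<n. ennreal (1 - fst (\<omega> l))) \<partial>sticks) = q ^ n" for n
  proof (induction n)
    case 0
    then show ?case using seq.P.emeasure_space_1 by simp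
  next
    case (Suc n)
    have "(\<integral>\<^sup>+\<omega>. (\<Prod>l<Suc n. ennreal (1 - fst (\<omega> l))) \<partial>sticks) =
      (\<integral>\<^sup>+s. \<integral>\<^sup>+\<omega>. ennreal (1 - fst s) * (\<Prod>l<n. ennreal (1 - fst (\<omega> l))) \<partial>sticks \<partial>(stick_law \<alpha> \<Otimes>\<^sub>M G))"
      by (subst nn_integral_sticks_shift) (auto simp: prod.lessThan_Suc_shift simp del: prod.lessThan_Suc)
    also have "\<dots> = (\<integral>\<^sup>+s. ennreal (1 - fst s) * q ^ n \<partial>(stick_law \<alpha> \<Otimes>\<^sub>M G))"
      by (subst nn_integral_cmult) (auto simp: Suc)
    also have "\<dots> = q * q ^ n"
      unfolding q_def by (subst nn_integral_multc) (auto simp: nn_integral_fst[symmetric] emeasure_space_1)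
    finally show ?case by simp
  qed
  have "(\<integral>\<^sup>+\<omega>. (INF n. \<Prod>l<n. ennreal (1 - fst (\<omega> l))) \<partial>sticks) \<le> q ^ n" for n
    unfolding rest_int[symmetric] by (intro nn_integral_mono INF_lower) auto
  moreover have "(\<lambda>n. q ^ n) \<longlonglongrightarrow> 0"
  proof -
    obtain r where r: "0 \<le> r" "q = ennreal r" using \<open>q < 1\<close> by (cases q) auto
    with \<open>q < 1\<close> have "r < 1" by simp
    then have "(\<lambda>n. ennreal (r ^ n)) \<longlonglongrightarrow> ennreal 0"
      using r by (intro tendsto_ennrealI LIMSEQ_power_zero) auto
    then show ?thesis using r by (simp add: ennreal_power)
  qed
  ultimately have "(\<integral>\<^sup>+\<omega>. (INF n. \<Prod>l<n. ennreal (1 - fst (\<omega> l))) \<partial>sticks) \<le> 0"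
    by (intro LIMSEQ_le_const[where X="\<lambda>n. q ^ n"]) auto
  then have "AE \<omega> in sticks. (INF n. \<Prod>l<n. ennreal (1 - fst (\<omega> l))) = 0"
    by (subst (asm) le_zero_eq, subst (asm) nn_integral_0_iff_AE) auto
  with AE_stick_bounds show ?thesis
  proof eventually_elim
    case (elim \<omega>)
    have eq: "(\<Prod>l<n. ennreal (1 - fst (\<omega> l))) = ennreal (stick_rest \<omega> n)" for n
      unfolding stick_rest_def using elim by (intro prod_ennreal) (auto intro: less_imp_le)
    have nonneg: "0 \<le> stick_rest \<omega> n" for n
      unfolding stick_rest_def using elim by (intro prod_nonneg) (auto intro: less_imp_le)
    have "decseq (\<lambda>n. ennreal (stick_rest \<omega> n))"
    proof (rule decseq_SucI)
      fix n
      have "stick_rest \<omega> n * (1 - fst (\<omega> n)) \<le> stick_rest \<omega> n * 1"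
        using nonneg elim by (intro mult_left_mono) (auto intro: less_imp_le)
      then show "ennreal (stick_rest \<omega> (Suc n)) \<le> ennreal (stick_rest \<omega> n)"
        by (intro ennreal_leI) (simp add: stick_rest_def)
    qed
    then have "(\<lambda>n. ennreal (stick_rest \<omega> n)) \<longlonglongrightarrow> ennreal 0"
      using LIMSEQ_INF[of "\<lambda>n. ennreal (stick_rest \<omega> n)"] elim(2) by (simp add: eq)
    then show ?case using nonneg by (subst (asm) tendsto_ennreal_iff) auto
  qed
qed

lemma AE_stick_weight_sums: "AE \<omega> in sticks. (\<forall>n. 0 \<le> stick_weight \<omega> n) \<and> stick_weight \<omega> sums 1"
  using AE_stick_bounds stick_rest_tendsto_0
proof eventually_elim
  case (elim \<omega>)
  have "0 \<le> stick_weight \<omega> n" for n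
    unfolding stick_weight_def stick_rest_def using elim
    by (intro mult_nonneg_nonneg prod_nonneg) (auto intro: less_imp_le)
  moreover have "(\<lambda>n. 1 - stick_rest \<omega> n) \<longlonglongrightarrow> 1 - 0"
    using elim by (intro tendsto_intros) auto
  ultimately show ?case by (simp add: sums_def sum_stick_weight)
qed

section \<open>The random discrete measure and its laws on partitions\<close>

lemma sticks_snd_in_space:
  assumes "\<omega> \<in> space sticks"
  shows "snd (\<omega> n) \<in> space G"
proof -
  have "\<omega> n \<in> space (stick_law \<alpha> \<Otimes>\<^sub>M G)" using assms by (auto simp: space_PiM)
  then show ?thesis by (auto simp: space_pair_measure mem_Times_iff)
qed

lemma emeasure_stick_measure:
  assumes \<omega>: "\<omega> \<in> space sticks" and A: "A \<in> sets G"
  shows "emeasure (stick_measure G \<omega>) A = (if (\<Sum>n. ennreal (stick_weight \<omega> n)) = 1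
     then \<Sum>n. ennreal (stick_weight \<omega> n) * indicator A (snd (\<omega> n)) else emeasure G A)"
proof -
  have "snd (\<omega> n) \<in> space G" for n
    using \<omega> by (rule sticks_snd_in_space)
  then have "(\<lambda>n. snd (\<omega> n)) \<in> density (count_space UNIV) (\<lambda>n. ennreal (stick_weight \<omega> n)) \<rightarrow>\<^sub>M G"
    by auto
  then show ?thesis
    using A unfolding stick_measure_def
    by (auto simp: emeasure_distr emeasure_density nn_integral_count_space_nat indicator_def intro!: suminf_cong)
qed

lemma sets_stick_measure [simp]: "sets (stick_measure G \<omega>) = sets G"
  by (simp add: stick_measure_def)

lemma prob_space_stick_measure:
  assumes "\<omega> \<in> space sticks"
  shows "prob_space (stick_measure G \<omega>)"
proof
  have "(\<Sum>n. ennreal (stick_weight \<omega> n) * indicator (space G) (snd (\<omega> n))) = (\<Sum>n. ennreal (stick_weight \<omega> n))"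
    using assms by (intro suminf_cong) (auto simp: sticks_snd_in_space)
  moreover have "space (stick_measure G \<omega>) = space G" by (intro sets_eq_imp_space_eq) simp
  ultimately show "emeasure (stick_measure G \<omega>) (space (stick_measure G \<omega>)) = 1"
    using assms by (simp add: emeasure_stick_measure emeasure_space_1)
qed

lemma measurable_stick_measure [measurable]: "stick_measure G \<in> sticks \<rightarrow>\<^sub>M prob_algebra G"
proof (intro measurable_prob_algebraI measurable_subprob_algebra)
  fix A assume [measurable]: "A \<in> sets G"
  have "(\<lambda>\<omega>. if (\<Sum>n. ennreal (stick_weight \<omega> n)) = 1
     then \<Sum>n. ennreal (stick_weight \<omega> n) * indicator A (snd (\<omega> n)) else emeasure G A) \<in> borel_measurable sticks"
    by measurable
  then show "(\<lambda>\<omega>. emeasure (stick_measure G \<omega>) A) \<in> borel_measurable sticks"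
    by (subst measurable_cong[OF emeasure_stick_measure]) auto
qed (auto intro: prob_space_stick_measure prob_space_imp_subprob_space)

context
  fixes B :: "nat \<Rightarrow> 'a set" and k :: nat
  assumes B: "\<And>i. i < k \<Longrightarrow> B i \<in> sets G"
    and disj: "disjoint_family_on B {..<k}" and un: "(\<Union>i<k. B i) = space G"
begin

abbreviation "D \<equiv> dirichlet_on {..<k} (\<lambda>i. \<alpha> * measure G (B i))"

lemma measurable_stick_truncation [measurable]:
  "(\<lambda>(\<omega>, z). stick_truncation B k n \<omega> z) \<in> sticks \<Otimes>\<^sub>M borel_on {..<k} \<rightarrow>\<^sub>M borel_on {..<k}"
proof -
  note B[measurable]
  show ?thesis
    unfolding stick_truncation_def case_prod_beta
    by (intro measurable_restrict borel_measurable_add borel_measurable_sum borel_measurable_times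
        borel_measurable_indicator') auto
qed

lemma prob_space_D: "prob_space D"
  using \<alpha>_pos by (intro prob_space_dirichlet_on) auto

text \<open>Stick steps are absorbed into the test function: with the first stick fixed, the
  induction hypothesis removes the other \<open>n\<close> for \<open>f\<close> composed with the
  step of the first, and the fixed-point identity then removes the first. Hence \<open>f\<close> is
  arbitrary in the induction.\<close>

lemma nn_integral_stick_truncation:
  assumes f [measurable]: "f \<in> borel_measurable (borel_on {..<k})"
  shows "(\<integral>\<^sup>+\<omega>. \<integral>\<^sup>+z. f (stick_truncation B k n \<omega> z) \<partial>D \<partial>sticks) = (\<integral>\<^sup>+z. f z \<partial>D)"
  using f
proof (induction n arbitrary: f)
  case 0
  have "(\<integral>\<^sup>+z. f (stick_truncation B k 0 \<omega> z) \<partial>D) = (\<integral>\<^sup>+z. f z \<partial>D)" for \<omega>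
    by (intro nn_integral_cong) (simp add: stick_truncation_0 PiE_iff)
  then show ?case using seq.P.emeasure_space_1 by simp
next
  case (Suc n)
  interpret D: prob_space D by (rule prob_space_D)
  note [measurable] = Suc.prems
  have [measurable]: "(\<lambda>z. stick_step {..<k} u v z) \<in> borel_on {..<k} \<rightarrow>\<^sub>M borel_on {..<k}" for u v
    unfolding stick_step_def by (intro measurable_restrict) measurable
  have "(\<integral>\<^sup>+\<omega>. \<integral>\<^sup>+z. f (stick_truncation B k (Suc n) \<omega> z) \<partial>D \<partial>sticks) =
    (\<integral>\<^sup>+s. \<integral>\<^sup>+\<omega>. \<integral>\<^sup>+z. f (stick_step {..<k} (\<lambda>i. indicator (B i) (snd s)) (fst s) (stick_truncation B k n \<omega> z)) \<partial>D \<partial>sticks \<partial>(stick_law \<alpha> \<Otimes>\<^sub>M G))"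
    by (subst nn_integral_sticks_shift) (auto simp: stick_truncation_case_nat)
  also have "\<dots> = (\<integral>\<^sup>+s. \<integral>\<^sup>+z. f (stick_step {..<k} (\<lambda>i. indicator (B i) (snd s)) (fst s) z) \<partial>D \<partial>(stick_law \<alpha> \<Otimes>\<^sub>M G))"
    by (intro nn_integral_cong Suc.IH) measurable
  also have "\<dots> = (\<integral>\<^sup>+z. f z \<partial>D)"
    by (rule dirichlet_stick_fixed_point[OF prob_space_axioms B disj un \<alpha>_pos Suc.prems])
  finally show ?case .
qed

lemma distr_stick_truncation:
  "distr (sticks \<Otimes>\<^sub>M D) (borel_on {..<k}) (\<lambda>p. stick_truncation B k n (fst p) (snd p)) = D"
proof (rule measure_eqI)
  interpret D: prob_space D by (rule prob_space_D)
  fix A assume "A \<in> sets (distr (sticks \<Otimes>\<^sub>M D) (borel_on {..<k}) (\<lambda>p. stick_truncation B k n (fst p) (snd p)))"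
  then have A [measurable]: "A \<in> sets (borel_on {..<k})" by simp
  have [measurable]: "(\<lambda>p. stick_truncation B k n (fst p) (snd p)) \<in> sticks \<Otimes>\<^sub>M D \<rightarrow>\<^sub>M borel_on {..<k}"
    using measurable_stick_truncation[of n]
    by (simp add: case_prod_beta' measurable_cong_sets[OF sets_pair_measure_cong[OF refl sets_dirichlet_on] refl])
  have "emeasure (distr (sticks \<Otimes>\<^sub>M D) (borel_on {..<k}) (\<lambda>p. stick_truncation B k n (fst p) (snd p))) A =
    (\<integral>\<^sup>+p. indicator A (stick_truncation B k n (fst p) (snd p)) \<partial>(sticks \<Otimes>\<^sub>M D))"
    by (subst nn_integral_indicator[symmetric], simp, subst nn_integral_distr) auto
  also have "\<dots> = (\<integral>\<^sup>+\<omega>. \<integral>\<^sup>+z. indicator A (stick_truncation B k n \<omega> z) \<partial>D \<partial>sticks)"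
    by (subst D.nn_integral_fst[symmetric]) auto
  also have "\<dots> = emeasure D A"
    by (subst nn_integral_stick_truncation) auto
  finally show "emeasure (distr (sticks \<Otimes>\<^sub>M D) (borel_on {..<k}) (\<lambda>p. stick_truncation B k n (fst p) (snd p))) A = emeasure D A" .
qed simp

lemma stick_truncation_limit:
  assumes \<omega>: "\<omega> \<in> space sticks" "\<forall>n. 0 \<le> stick_weight \<omega> n" "stick_weight \<omega> sums 1" and i: "i < k"
  shows "(\<lambda>n. stick_truncation B k n \<omega> z i) \<longlonglongrightarrow> measure (stick_measure G \<omega>) (B i)"
proof -
  let ?u = "\<lambda>n. stick_weight \<omega> n * indicator (B i) (snd (\<omega> n))"
  have u: "summable ?u"
  proof (rule summable_comparison_test'[OF sums_summable[OF \<omega>(3)], of 0])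
    show "norm (?u n) \<le> stick_weight \<omega> n" for n
      using \<omega>(2)[rule_format, of n] by (simp add: indicator_def)
  qed
  have "(\<Sum>n. ennreal (stick_weight \<omega> n)) = 1"
    using suminf_ennreal_eq[OF \<omega>(2)[rule_format] \<omega>(3)] by simp
  then have "emeasure (stick_measure G \<omega>) (B i) = (\<Sum>n. ennreal (?u n))"
    using \<omega>(2) by (simp add: emeasure_stick_measure[OF \<omega>(1) B[OF i]] ennreal_mult' ennreal_indicator)
  also have "\<dots> = ennreal (\<Sum>n. ?u n)"
    using u \<omega>(2) by (intro suminf_ennreal_eq summable_sums) auto
  finally have "measure (stick_measure G \<omega>) (B i) = (\<Sum>n. ?u n)"
    using u \<omega>(2) by (simp add: measure_def suminf_nonneg)
  moreover have "(\<lambda>n. \<Sum>j<n. ?u j) \<longlonglongrightarrow> (\<Sum>n. ?u n)"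
    using summable_LIMSEQ[OF u] .
  moreover have "stick_rest \<omega> \<longlonglongrightarrow> 0"
  proof -
    have "(\<lambda>n. 1 - (\<Sum>j<n. stick_weight \<omega> j)) \<longlonglongrightarrow> 1 - 1"
      using \<omega>(3) by (intro tendsto_intros) (simp add: sums_def)
    then show ?thesis by (simp add: sum_stick_weight)
  qed
  ultimately have "(\<lambda>n. (\<Sum>j<n. ?u j) + stick_rest \<omega> n * z i) \<longlonglongrightarrow> measure (stick_measure G \<omega>) (B i) + 0 * z i"
    by (intro tendsto_intros) auto
  then show ?thesis using i by (simp add: stick_truncation_def)
qed

text \<open>The probability space is enlarged by an independent Dirichlet vector, so that
  truncations of law \<open>D\<close> live on it. Their limit no longer depends on that vector,
  whose coefficient is the vanishing remainder.\<close>

lemma distr_stick_measure_partition: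
  "distr sticks (borel_on {..<k}) (\<lambda>\<omega>. \<lambda>i\<in>{..<k}. measure (stick_measure G \<omega>) (B i)) = D"
proof -
  interpret D: prob_space D by (rule prob_space_D)
  interpret SD: pair_prob_space sticks D ..
  let ?X = "\<lambda>\<omega>. \<lambda>i\<in>{..<k}. measure (stick_measure G \<omega>) (B i)"
  have X [measurable]: "?X \<in> sticks \<rightarrow>\<^sub>M borel_on {..<k}"
    using B by (intro measurable_restrict) auto
  have "distr sticks (borel_on {..<k}) ?X =
    distr (distr (sticks \<Otimes>\<^sub>M D) sticks fst) (borel_on {..<k}) ?X"
    by (simp add: D.distr_pair_fst)
  also have "\<dots> = distr (sticks \<Otimes>\<^sub>M D) (borel_on {..<k}) (\<lambda>p. ?X (fst p))"
    by (subst distr_distr) (auto simp: comp_def)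
  also have "\<dots> = D"
  proof (rule distr_eq_if_AE_limit[where X="\<lambda>n p. stick_truncation B k n (fst p) (snd p)"])
    show "(\<lambda>p. stick_truncation B k n (fst p) (snd p)) \<in> sticks \<Otimes>\<^sub>M D \<rightarrow>\<^sub>M borel_on {..<k}" for n
      using measurable_stick_truncation[of n]
      by (simp add: case_prod_beta' measurable_cong_sets[OF sets_pair_measure_cong[OF refl sets_dirichlet_on] refl])
    have "AE \<omega> in distr (sticks \<Otimes>\<^sub>M D) sticks fst. \<omega> \<in> space sticks \<and> (\<forall>n. 0 \<le> stick_weight \<omega> n) \<and> stick_weight \<omega> sums 1"
      unfolding D.distr_pair_fst using AE_stick_weight_sums AE_space by eventually_elim simp
    then have "AE p in sticks \<Otimes>\<^sub>M D. fst p \<in> space sticks \<and> (\<forall>n. 0 \<le> stick_weight (fst p) n) \<and> stick_weight (fst p) sums 1"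
      by (rule AE_distrD[rotated]) measurable
    then show "AE p in sticks \<Otimes>\<^sub>M D. \<forall>i\<in>{..<k}. (\<lambda>n. stick_truncation B k n (fst p) (snd p) i) \<longlonglongrightarrow> ?X (fst p) i"
      by eventually_elim (auto intro: stick_truncation_limit)
  qed (auto intro: SD.prob_space_axioms distr_stick_truncation)
  finally show ?thesis .
qed

end

lemma is_dirichlet_stick_measure:
  assumes "sets G = sets M"
  shows "is_dirichlet M \<alpha> G (distr sticks (prob_algebra M) (stick_measure G))"
proof -
  have pa: "prob_algebra M = prob_algebra G"
    using assms by (simp add: prob_algebra_def cong: subprob_algebra_cong)
  show ?thesis
    unfolding is_dirichlet_def pa
  proof (intro conjI allI impI)
    show "distr sticks (prob_algebra G) (stick_measure G) \<in> space (prob_algebra (prob_algebra G))"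
      by (simp add: space_prob_algebra seq.P.prob_space_distr)
    fix k :: nat and B :: "nat \<Rightarrow> 'a set" assume "(\<forall>i<k. B i \<in> sets M) \<and> disjoint_family_on B {..<k} \<and> (\<Union>i<k. B i) = space M"
    then have B: "\<And>i. i < k \<Longrightarrow> B i \<in> sets G" and d: "disjoint_family_on B {..<k}" and u: "(\<Union>i<k. B i) = space G"
      using assms sets_eq_imp_space_eq[OF assms] by auto
    have [measurable]: "(\<lambda>Q. \<lambda>i\<in>{..<k}. measure Q (B i)) \<in> prob_algebra G \<rightarrow>\<^sub>M borel_on {..<k}"
      using B by (intro measurable_restrict) auto
    have "distr (distr sticks (prob_algebra G) (stick_measure G)) (borel_on {..<k}) (\<lambda>Q. \<lambda>i\<in>{..<k}. measure Q (B i)) =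
      distr sticks (borel_on {..<k}) (\<lambda>\<omega>. \<lambda>i\<in>{..<k}. measure (stick_measure G \<omega>) (B i))"
      by (subst distr_distr) (auto simp: comp_def)
    then show "distr (distr sticks (prob_algebra G) (stick_measure G)) (borel_on {..<k}) (\<lambda>Q. \<lambda>i\<in>{..<k}. measure Q (B i)) =
      dirichlet_dist k (\<lambda>i. \<alpha> * measure G (B i))"
      using distr_stick_measure_partition[OF B d u] by (simp add: dirichlet_dist_eq)
  qed
qed

end

section \<open>Uniqueness and means of Dirichlet measures\<close>

abbreviation (input) probs :: "'a measure \<Rightarrow> 'a measure set" where
  "probs M \<equiv> space (prob_algebra M)"

lemma space_prob_algebraD:
  assumes "Q \<in> probs M"
  shows "sets Q = sets M" "space Q = space M" "prob_space Q"
  using assms sets_eq_imp_space_eq[of Q M] by (simp_all add: space_prob_algebra)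

definition eval_rectangle :: "'a measure \<Rightarrow> 'a set set \<Rightarrow> ('a set \<Rightarrow> real set) \<Rightarrow> 'a measure set" where
  "eval_rectangle M F J = {Q \<in> probs M. \<forall>A\<in>F. measure Q A \<in> J A}"

text \<open>Finite families \<open>F\<close>, rather than single sets, make the class closed under
  intersection.\<close>

definition eval_rectangles :: "'a measure \<Rightarrow> 'a measure set set" where
  "eval_rectangles M = {eval_rectangle M F J | F J. finite F \<and> F \<subseteq> sets M \<and> (\<forall>A. J A \<in> sets borel)}"

lemma eval_rectanglesI:
  "finite F \<Longrightarrow> F \<subseteq> sets M \<Longrightarrow> (\<And>A. J A \<in> sets borel) \<Longrightarrow> eval_rectangle M F J \<in> eval_rectangles M"
  by (auto simp: eval_rectangles_def)

lemma Int_stable_eval_rectangles: "Int_stable (eval_rectangles M)"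
proof (rule Int_stableI)
  fix X Y assume "X \<in> eval_rectangles M" "Y \<in> eval_rectangles M"
  then obtain F J F' J' where F: "finite F" "F \<subseteq> sets M" "\<And>A. J A \<in> sets borel" "X = eval_rectangle M F J"
    and F': "finite F'" "F' \<subseteq> sets M" "\<And>A. J' A \<in> sets borel" "Y = eval_rectangle M F' J'"
    by (auto simp: eval_rectangles_def)
  have "X \<inter> Y = eval_rectangle M (F \<union> F') (\<lambda>A. (if A \<in> F then J A else UNIV) \<inter> (if A \<in> F' then J' A else UNIV))"
    unfolding F F' eval_rectangle_def by auto
  also have "\<dots> \<in> eval_rectangles M"
    using F F' by (intro eval_rectanglesI) auto
  finally show "X \<inter> Y \<in> eval_rectangles M" .
qed

lemma sets_prob_algebra_eq:
  "sets (prob_algebra M) = sigma_sets (probs M) (eval_rectangles M)"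
proof
  let ?\<Omega> = "probs M" and ?E = "eval_rectangles M"
  have E: "?E \<subseteq> Pow ?\<Omega>" by (auto simp: eval_rectangles_def eval_rectangle_def)
  have "?E \<subseteq> sets (prob_algebra M)"
  proof
    fix X assume "X \<in> ?E"
    then obtain F J where F: "finite F" "F \<subseteq> sets M" "\<And>A. J A \<in> sets borel" "X = eval_rectangle M F J"
      by (auto simp: eval_rectangles_def)
    have "{Q \<in> ?\<Omega>. measure Q A \<in> J A} \<in> sets (prob_algebra M)" if "A \<in> F" for A
    proof -
      have [measurable]: "A \<in> sets M" "J A \<in> sets borel" using that F by auto
      show ?thesis by measurable
    qed
    then show "X \<in> sets (prob_algebra M)"
      unfolding F eval_rectangle_def using F by (intro sets.sets_Collect_finite_All) auto
  qed
  then show "sigma_sets ?\<Omega> ?E \<subseteq> sets (prob_algebra M)"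
    by (rule sets.sigma_sets_subset)
  have id: "(\<lambda>Q. Q) \<in> sigma ?\<Omega> ?E \<rightarrow>\<^sub>M prob_algebra M"
  proof (intro measurable_prob_algebraI measurable_subprob_algebra)
    fix A assume A: "A \<in> sets M"
    have "(\<lambda>Q. measure Q A) \<in> borel_measurable (sigma ?\<Omega> ?E)"
    proof (rule measurableI)
      fix J :: "real set" assume J: "J \<in> sets borel"
      have "(\<lambda>Q. measure Q A) -` J \<inter> space (sigma ?\<Omega> ?E) = eval_rectangle M {A} (\<lambda>_. J)"
        using E by (auto simp: eval_rectangle_def)
      moreover have "eval_rectangle M {A} (\<lambda>_. J) \<in> ?E" using A J by (intro eval_rectanglesI) auto
      ultimately show "(\<lambda>Q. measure Q A) -` J \<inter> space (sigma ?\<Omega> ?E) \<in> sets (sigma ?\<Omega> ?E)"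
        using E by auto
    qed simp
    then have "(\<lambda>Q. ennreal (measure Q A)) \<in> borel_measurable (sigma ?\<Omega> ?E)" by measurable
    then show "(\<lambda>Q. emeasure Q A) \<in> borel_measurable (sigma ?\<Omega> ?E)"
      by (rule measurable_cong[THEN iffD1, rotated])
        (use E in \<open>auto simp: space_prob_algebra prob_space_def finite_measure.emeasure_eq_measure\<close>)
  qed (use E in \<open>auto simp: space_prob_algebra prob_space_imp_subprob_space\<close>)
  show "sets (prob_algebra M) \<subseteq> sigma_sets ?\<Omega> ?E"
  proof
    fix X assume X: "X \<in> sets (prob_algebra M)"
    then have "X \<subseteq> ?\<Omega>" by (rule sets.sets_into_space)
    then have "(\<lambda>Q. Q) -` X \<inter> space (sigma ?\<Omega> ?E) = X" using E by auto
    then show "X \<in> sigma_sets ?\<Omega> ?E" using measurable_sets[OF id X] E by simp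
  qed
qed

text \<open>The members of \<open>F\<close> generate a finite algebra whose atoms partition the
  space. The mass of each member is a sum of masses of these atoms, and their joint law is
  prescribed by \<open>is_dirichlet\<close>.\<close>

lemma emeasure_eval_rectangle_dirichlet:
  assumes D: "is_dirichlet M \<alpha> G D" "is_dirichlet M \<alpha> G D'"
    and F: "finite F" "F \<subseteq> sets M" "\<And>A. J A \<in> sets borel"
  shows "emeasure D (eval_rectangle M F J) = emeasure D' (eval_rectangle M F J)"
proof -
  \<comment> \<open>The blocks are indexed by the subsets of \<open>F\<close>: \<open>B i\<close>
    will hold the points lying in exactly the members \<open>e i\<close>. Some blocks may be empty,
    which the partitions in \<open>is_dirichlet\<close> permit.\<close>
  obtain e where "bij_betw e {0..<card (Pow F)} (Pow F)"
    using ex_bij_betw_nat_finite[of "Pow F"] F by auto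
  define N where "N = card (Pow F)"
  have e: "bij_betw e {..<N} (Pow F)"
    using \<open>bij_betw e {0..<card (Pow F)} (Pow F)\<close> by (simp add: N_def atLeast0LessThan)
  define B where "B = (\<lambda>i. {x \<in> space M. \<forall>A\<in>F. (x \<in> A) = (A \<in> e i)})"
  have eF: "e i \<subseteq> F" if "i < N" for i using e that by (auto simp: bij_betw_def)
  have B_eq: "x \<in> B i \<longleftrightarrow> x \<in> space M \<and> {A \<in> F. x \<in> A} = e i" if "i < N" for i x
    using eF[OF that] by (auto simp: B_def)
  have Bs: "B i \<in> sets M" for i
    unfolding B_def
  proof (intro sets.sets_Collect_finite_All)
    fix A assume "A \<in> F"
    then have [measurable]: "A \<in> sets M" using F by auto
    show "{x \<in> space M. (x \<in> A) = (A \<in> e i)} \<in> sets M" by measurable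
  qed (use F in auto)
  have disj: "disjoint_family_on B {..<N}"
    using e by (auto simp: disjoint_family_on_def B_eq bij_betw_def inj_on_def)
  have un: "(\<Union>i<N. B i) = space M"
  proof (intro set_eqI iffI)
    fix x assume x: "x \<in> space M"
    have "{A \<in> F. x \<in> A} \<in> e ` {..<N}" using e by (auto simp: bij_betw_def)
    then show "x \<in> (\<Union>i<N. B i)" using x by (auto simp: B_eq)
  qed (auto simp: B_def)
  let ?v = "\<lambda>Q. \<lambda>i\<in>{..<N}. measure Q (B i)"
  let ?P = "borel_on {..<N}"
  define Z where "Z = {z \<in> space ?P. \<forall>A\<in>F. (\<Sum>i\<in>{i\<in>{..<N}. A \<in> e i}. z i) \<in> J A}"
  have Z: "Z \<in> sets ?P"
    unfolding Z_def
  proof (intro sets.sets_Collect_finite_All)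
    fix A assume "A \<in> F"
    have [measurable]: "J A \<in> sets borel" by (rule F)
    have [measurable]: "(\<lambda>z. \<Sum>i\<in>{i\<in>{..<N}. A \<in> e i}. z i) \<in> borel_measurable ?P"
      by (intro borel_measurable_sum) auto
    show "{z \<in> space ?P. (\<Sum>i\<in>{i\<in>{..<N}. A \<in> e i}. z i) \<in> J A} \<in> sets ?P" by measurable
  qed (use F in auto)
  have v: "?v \<in> prob_algebra M \<rightarrow>\<^sub>M ?P"
    using Bs by (intro measurable_restrict) auto
  have rect: "?v -` Z \<inter> probs M = eval_rectangle M F J"
  proof -
    have "(\<Sum>i\<in>{i\<in>{..<N}. A \<in> e i}. ?v Q i) = measure Q A" if Q: "Q \<in> probs M" and A: "A \<in> F" for Q A
    proof -
      interpret Q: prob_space Q using Q by (simp add: space_prob_algebra)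
      have sQ: "sets Q = sets M" using Q by (simp add: space_prob_algebra)
      have "A = (\<Union>i\<in>{i\<in>{..<N}. A \<in> e i}. B i)"
      proof (intro set_eqI iffI)
        fix x assume x: "x \<in> A"
        then have "x \<in> space M" using A F sets.sets_into_space by blast
        then obtain i where "i < N" "x \<in> B i" using un by blast
        then show "x \<in> (\<Union>i\<in>{i\<in>{..<N}. A \<in> e i}. B i)" using x A by (auto simp: B_eq)
      qed (use A in \<open>auto simp: B_def\<close>)
      also have "measure Q \<dots> = (\<Sum>i\<in>{i\<in>{..<N}. A \<in> e i}. measure Q (B i))"
        using Bs sQ disj by (intro Q.finite_measure_finite_Union) (auto simp: disjoint_family_on_def)
      finally show ?thesis by simp
    qed
    then show ?thesis by (auto simp: Z_def eval_rectangle_def space_PiM)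
  qed
  have "emeasure D (eval_rectangle M F J) = emeasure (distr D ?P ?v) Z" if "is_dirichlet M \<alpha> G D" for D
  proof -
    have sD: "sets D = sets (prob_algebra M)" using that by (simp add: is_dirichlet_def space_prob_algebra)
    have "?v \<in> D \<rightarrow>\<^sub>M ?P" unfolding measurable_cong_sets[OF sD refl] by (rule v)
    then show ?thesis
      using rect by (simp add: emeasure_distr Z sets_eq_imp_space_eq[OF sD])
  qed
  moreover have "distr D ?P ?v = dirichlet_dist N (\<lambda>i. \<alpha> * measure G (B i))" if "is_dirichlet M \<alpha> G D" for D
    using that Bs disj un unfolding is_dirichlet_def by blast
  ultimately show ?thesis using D by simp
qed

lemma is_dirichlet_unique:
  assumes D: "is_dirichlet M \<alpha> G D" "is_dirichlet M \<alpha> G D'"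
  shows "D = D'"
proof (rule measure_eqI_generator_eq[OF Int_stable_eval_rectangles[of M], of "probs M" _ _ "\<lambda>_. probs M"])
  show "eval_rectangles M \<subseteq> Pow (probs M)"
    by (auto simp: eval_rectangles_def eval_rectangle_def)
  show "sets D = sigma_sets (probs M) (eval_rectangles M)"
    "sets D' = sigma_sets (probs M) (eval_rectangles M)"
    unfolding sets_prob_algebra_eq[symmetric] using D by (auto simp: is_dirichlet_def space_prob_algebra)
  have "eval_rectangle M {} (\<lambda>_. UNIV) \<in> eval_rectangles M" by (intro eval_rectanglesI) auto
  then show "range (\<lambda>_. probs M) \<subseteq> eval_rectangles M"
    by (auto simp: eval_rectangle_def)
  have "prob_space D" using D by (simp add: is_dirichlet_def space_prob_algebra)
  then show "emeasure D (probs M) \<noteq> \<infinity>"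
    by (simp add: prob_space_def finite_measure.emeasure_finite)
  show "emeasure D X = emeasure D' X" if "X \<in> eval_rectangles M" for X
    using that emeasure_eval_rectangle_dirichlet[OF D] by (auto simp: eval_rectangles_def)
qed auto

lemma is_dirichlet_dirichlet_measure:
  assumes "G \<in> probs M" "0 < \<alpha>"
  shows "is_dirichlet M \<alpha> G (dirichlet_measure M \<alpha> G)"
proof -
  interpret stick_breaking G \<alpha>
    using assms by (auto simp: space_prob_algebra stick_breaking_def stick_breaking_axioms_def)
  have D: "is_dirichlet M \<alpha> G (distr sticks (prob_algebra M) (stick_measure G))"
    using assms by (intro is_dirichlet_stick_measure) (simp add: space_prob_algebra)
  show ?thesis
    unfolding dirichlet_measure_def by (rule theI[where P="is_dirichlet M \<alpha> G", OF D is_dirichlet_unique[OF _ D]])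
qed

lemma measurable_ennreal_gamma_measure [simp]: "ennreal \<in> borel_measurable (gamma_measure a)"
  by (simp add: measurable_cong_sets[OF sets_gamma_measure refl])

text \<open>With \<open>S\<close> the Gamma sum, independence of \<open>S\<close> and the direction
  gives \<open>E S * E z_i = E (S * z_i) = E y_i\<close>, and both Gamma means are known.\<close>

lemma dirichlet_on_mean:
  assumes I: "finite I" "i \<in> I" and a: "\<And>i. 0 \<le> a i" and s: "0 < (sum a I)"
  shows "(\<integral>\<^sup>+z. ennreal (z i) \<partial>dirichlet_on I a) = ennreal (a i / (sum a I))"
proof -
  let ?s = "sum a I" and ?P = "gammas I a"
  interpret PP: product_prob_space "\<lambda>i. gamma_measure (a i)" I
    by (rule product_prob_space_gamma_measure) fact
  have [measurable]: "(\<lambda>z. z i) \<in> borel_measurable (borel_on I)" using I by measurable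
  have "(\<integral>\<^sup>+z. ennreal (z i) \<partial>dirichlet_on I a) * ennreal ?s = (\<integral>\<^sup>+s. \<integral>\<^sup>+z. ennreal s * ennreal (z i) \<partial>dirichlet_on I a \<partial>gamma_measure ?s)"
  proof -
    have "(\<integral>\<^sup>+s. \<integral>\<^sup>+z. ennreal s * ennreal (z i) \<partial>dirichlet_on I a \<partial>gamma_measure ?s) =
      (\<integral>\<^sup>+s. ennreal s * (\<integral>\<^sup>+z. ennreal (z i) \<partial>dirichlet_on I a) \<partial>gamma_measure ?s)"
      by (intro nn_integral_cong nn_integral_cmult) measurable
    also have "\<dots> = (\<integral>\<^sup>+s. ennreal s \<partial>gamma_measure ?s) * (\<integral>\<^sup>+z. ennreal (z i) \<partial>dirichlet_on I a)"
      by (rule nn_integral_multc[where f="\<lambda>s. ennreal s"]) simp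
    finally show ?thesis
      using s by (simp add: nn_integral_gamma_measure_id mult.commute)
  qed
  also have "\<dots> = (\<integral>\<^sup>+y. ennreal (sum y I) * ennreal (normalize_on I y i) \<partial>?P)"
    by (rule nn_integral_sum_normalize_gamma[where f="\<lambda>s z. ennreal s * ennreal (z i)", symmetric, OF I(1) a s]) measurable
  also have "\<dots> = (\<integral>\<^sup>+y. ennreal (y i) \<partial>?P)"
    using AE_sum_gamma_pos[OF I(1) a s] I
    by (intro nn_integral_cong_AE) (auto elim!: eventually_mono simp: normalize_on_def ennreal_mult'[symmetric])
  also have "\<dots> = (\<integral>\<^sup>+x. ennreal x \<partial>distr ?P (gamma_measure (a i)) (\<lambda>y. y i))"
    using I by (subst nn_integral_distr) auto
  also have "\<dots> = ennreal (a i)"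
    using I a by (subst PP.PiM_component) (auto simp: nn_integral_gamma_measure_id)
  finally have "(\<integral>\<^sup>+z. ennreal (z i) \<partial>dirichlet_on I a) * ennreal ?s * ennreal (1 / ?s) = ennreal (a i) * ennreal (1 / ?s)"
    by simp
  then show ?thesis
    using s a[of i] by (simp add: mult.assoc ennreal_mult'[symmetric])
qed

lemma nn_integral_dirichlet_measure_eval:
  assumes G: "G \<in> probs M" and \<alpha>: "0 < \<alpha>" and A: "A \<in> sets M"
    and f [measurable]: "f \<in> borel_measurable borel"
  defines "a \<equiv> (\<lambda>i::nat. \<alpha> * measure G (if i = 0 then A else space M - A))"
  shows "(\<integral>\<^sup>+Q. f (measure Q A) \<partial>dirichlet_measure M \<alpha> G) = (\<integral>\<^sup>+z. f (z 0) \<partial>dirichlet_on {..<2} a)"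
proof -
  let ?D = "dirichlet_measure M \<alpha> G"
  let ?B = "\<lambda>i::nat. if i = 0 then A else space M - A"
  let ?v = "\<lambda>Q. \<lambda>i\<in>{..<2::nat}. measure Q (?B i)"
  let ?P = "borel_on {..<2}"
  have D: "is_dirichlet M \<alpha> G ?D" by (rule is_dirichlet_dirichlet_measure[OF G \<alpha>])
  have sD: "sets ?D = sets (prob_algebra M)" using D by (simp add: is_dirichlet_def space_prob_algebra)
  have "(\<Union>i<2. ?B i) = space M"
    using sets.sets_into_space[OF A] by (auto simp: numeral_2_eq_2 lessThan_Suc)
  moreover have "disjoint_family_on ?B {..<2}" by (auto simp: disjoint_family_on_def)
  moreover have "\<forall>i<2. ?B i \<in> sets M" using A by auto
  ultimately have law: "distr ?D ?P ?v = dirichlet_on {..<2} a"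
    using D[unfolded is_dirichlet_def, THEN conjunct2, THEN spec[of _ 2], THEN spec[of _ ?B], THEN mp]
    by (simp add: a_def dirichlet_dist_eq)
  have v: "?v \<in> ?D \<rightarrow>\<^sub>M ?P"
    unfolding measurable_cong_sets[OF sD refl] using A by (intro measurable_restrict) auto
  show ?thesis
    unfolding law[symmetric] using v by (subst nn_integral_distr) auto
qed

lemma dirichlet_measure_props:
  assumes G: "G \<in> probs M" and \<alpha>: "0 < \<alpha>"
  shows sets_dirichlet_measure: "sets (dirichlet_measure M \<alpha> G) = sets (prob_algebra M)"
    and prob_space_dirichlet_measure: "prob_space (dirichlet_measure M \<alpha> G)"
  using is_dirichlet_dirichlet_measure[OF G \<alpha>, unfolded is_dirichlet_def, THEN conjunct1]
  by (simp_all add: space_prob_algebra)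

lemma dirichlet_measure_mean:
  assumes G: "G \<in> probs M" and \<alpha>: "0 < \<alpha>" and A: "A \<in> sets M"
  shows "(\<integral>\<^sup>+Q. emeasure Q A \<partial>dirichlet_measure M \<alpha> G) = emeasure G A"
proof -
  interpret G: prob_space G using G by (simp add: space_prob_algebra)
  have sG: "sets G = sets M" "space G = space M" using space_prob_algebraD[OF G] by auto
  define a where "a = (\<lambda>i::nat. \<alpha> * measure G (if i = 0 then A else space M - A))"
  have "measure G (space M - A) = 1 - measure G A"
    using G.prob_compl[of A] A sG by simp
  then have "(\<Sum>i<2. a i) = \<alpha> * measure G A + \<alpha> * (1 - measure G A)"
    by (simp add: a_def numeral_2_eq_2 del: distrib_left_numeral)
  then have sum: "(\<Sum>i<2. a i) = \<alpha>" by (simp add: algebra_simps)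
  have "space (dirichlet_measure M \<alpha> G) = probs M"
    using sets_dirichlet_measure[OF G \<alpha>] by (rule sets_eq_imp_space_eq)
  then have "(\<integral>\<^sup>+Q. emeasure Q A \<partial>dirichlet_measure M \<alpha> G) = (\<integral>\<^sup>+Q. ennreal (measure Q A) \<partial>dirichlet_measure M \<alpha> G)"
    by (intro nn_integral_cong) (auto simp: space_prob_algebra prob_space_def finite_measure.emeasure_eq_measure)
  also have "\<dots> = (\<integral>\<^sup>+z. ennreal (z 0) \<partial>dirichlet_on {..<2} a)"
    unfolding a_def by (rule nn_integral_dirichlet_measure_eval[OF G \<alpha> A]) simp
  also have "\<dots> = ennreal (a 0 / \<alpha>)"
    using \<alpha> sum dirichlet_on_mean[of "{..<2}" 0 a] by (simp add: a_def)
  finally show ?thesis using \<alpha> by (simp add: a_def G.emeasure_eq_measure)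
qed

text \<open>Binding the Dirichlet measure with the identity gives back \<open>G\<close>; this
  upgrades the mean formula from sets to all nonnegative measurable functions.\<close>

lemma nn_integral_dirichlet_measure_mean:
  assumes G: "G \<in> probs M" and \<alpha>: "0 < \<alpha>" and f: "f \<in> borel_measurable M"
  shows "(\<integral>\<^sup>+Q. (\<integral>\<^sup>+x. f x \<partial>Q) \<partial>dirichlet_measure M \<alpha> G) = (\<integral>\<^sup>+x. f x \<partial>G)"
proof -
  let ?D = "dirichlet_measure M \<alpha> G"
  have sD: "sets ?D = sets (prob_algebra M)" by (rule sets_dirichlet_measure[OF G \<alpha>])
  have sG: "sets G = sets M" using G by (auto simp: space_prob_algebra)
  have id: "(\<lambda>Q. Q) \<in> ?D \<rightarrow>\<^sub>M subprob_algebra M"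
    unfolding measurable_cong_sets[OF sD refl] by (rule measurable_prob_algebraD) simp
  interpret D: prob_space ?D by (rule prob_space_dirichlet_measure[OF G \<alpha>])
  have bind: "?D \<bind> (\<lambda>Q. Q) = G"
  proof (rule measure_eqI)
    show "sets (?D \<bind> (\<lambda>Q. Q)) = sets G"
      unfolding sG by (rule sets_bind[OF _ D.not_empty]) (use id in \<open>auto dest: measurable_space simp: space_subprob_algebra\<close>)
    fix A assume "A \<in> sets (?D \<bind> (\<lambda>Q. Q))"
    then have A: "A \<in> sets M" using \<open>sets (?D \<bind> (\<lambda>Q. Q)) = sets G\<close> sG by simp
    show "emeasure (?D \<bind> (\<lambda>Q. Q)) A = emeasure G A"
      using emeasure_bind[OF D.not_empty id A] dirichlet_measure_mean[OF G \<alpha> A] by simp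
  qed
  have "(\<integral>\<^sup>+x. f x \<partial>(?D \<bind> (\<lambda>Q. Q))) = (\<integral>\<^sup>+Q. (\<integral>\<^sup>+x. f x \<partial>Q) \<partial>?D)"
    by (rule nn_integral_bind[OF f id])
  then show ?thesis by (simp add: bind)
qed

section \<open>Concentration of the mass of a set\<close>

text \<open>For \<open>p \<le> 1\<close> the density \<open>x powr (p - 1)\<close> does not
  increase, so among intervals of length \<open>l\<close> the one starting at the origin has the
  largest mass, \<open>l powr p / p\<close>. The factor \<open>exp (- x)\<close> is bounded by
  one.\<close>

lemma emeasure_gamma_measure_le_diameter:
  assumes p: "0 < p" "p \<le> 1" and S: "S \<in> sets borel" "S \<subseteq> {0..}"
    and diam: "\<And>x y. x \<in> S \<Longrightarrow> y \<in> S \<Longrightarrow> x - y \<le> l" and l: "0 \<le> l"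
  shows "emeasure (gamma_measure p) S \<le> ennreal (l powr p / (p * Gamma p))"
proof (cases "S = {}")
  case False
  note [measurable] = S(1)
  have Gp: "0 < Gamma p" using p by simp
  define c where "c = Inf S"
  have bdd: "bdd_below S" using S(2) by (auto intro: bdd_belowI[of _ 0])
  have c0: "0 \<le> c" unfolding c_def using False S(2) by (intro cInf_greatest) auto
  have S_sub: "S \<subseteq> {c..c + l}"
  proof
    fix x assume x: "x \<in> S"
    have "x - l \<le> c" unfolding c_def using False diam[OF x] by (intro cInf_greatest) (auto simp: algebra_simps)
    then show "x \<in> {c..c + l}" using cInf_lower[OF x bdd] by (simp add: c_def)
  qed
  let ?h = "\<lambda>x::real. ennreal (if x > 0 then x powr (p - 1) else 0)"
  have "emeasure (gamma_measure p) S = (\<integral>\<^sup>+x. ennreal (if x > 0 then x powr (p - 1) * exp (- x) / Gamma p else 0) * indicator S x \<partial>lborel)"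
    using p by (simp add: gamma_measure_def emeasure_density)
  also have "\<dots> \<le> (\<integral>\<^sup>+x. ennreal (1 / Gamma p) * (?h x * indicator {c..c + l} x) \<partial>lborel)"
  proof (intro nn_integral_mono)
    fix x :: real
    have "x powr (p - 1) * exp (- x) / Gamma p \<le> 1 / Gamma p * x powr (p - 1)" if "0 < x"
      using that Gp by (simp add: divide_simps mult_left_le)
    then show "ennreal (if x > 0 then x powr (p - 1) * exp (- x) / Gamma p else 0) * indicator S x
       \<le> ennreal (1 / Gamma p) * (?h x * indicator {c..c + l} x)"
      using S_sub Gp by (auto simp: indicator_def ennreal_mult'[symmetric] intro!: ennreal_leI)
  qed
  also have "\<dots> = ennreal (1 / Gamma p) * (\<integral>\<^sup>+x. ?h x * indicator {c..c + l} x \<partial>lborel)"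
    by (rule nn_integral_cmult) simp
  also have "(\<integral>\<^sup>+x. ?h x * indicator {c..c + l} x \<partial>lborel) = (\<integral>\<^sup>+x. ?h (c + x) * indicator {c..c + l} (c + x) \<partial>lborel)"
    by (subst nn_integral_real_affine[where c=1 and t=c]) (auto cong: if_cong)
  also have "\<dots> \<le> (\<integral>\<^sup>+x. ?h x * indicator {..l} x \<partial>lborel)"
  proof (intro nn_integral_mono_AE)
    \<comment> \<open>The point zero is left out because \<open>?h\<close> is set to zero there,
      while the shifted density need not vanish.\<close>
    show "AE x in lborel. ?h (c + x) * indicator {c..c + l} (c + x) \<le> ?h x * indicator {..l} x"
      using AE_lborel_singleton[of "0::real"]
    proof eventually_elim
      case (elim x)
      have "(c + x) powr (p - 1) \<le> x powr (p - 1)" if "0 < x"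
        using that c0 p by (intro powr_mono2') auto
      then show ?case using elim c0 by (auto simp: indicator_def intro!: ennreal_leI)
    qed
  qed
  also have "\<dots> = ennreal (l powr p / p)"
    using emeasure_power_measure_atMost[of p l] p l by (simp add: power_measure_def emeasure_density)
  finally show ?thesis
    using Gp p by (simp add: ennreal_mult'[symmetric] mult_left_mono mult.commute[of p])
qed simp

text \<open>For \<open>0 < x \<le> y\<close> the derivative \<open>y / (x + y)^2\<close> of the
  ratio is at least \<open>1 / (4 * y)\<close>, so the admissible \<open>x\<close> form a set of
  diameter at most \<open>4 * s * y\<close>. The resulting factor \<open>y powr p\<close> is
  dominated by \<open>1 + y\<close>, whose mean is finite.\<close>

lemma nn_integral_gamma_ratio_half_le:
  assumes p: "0 < p" "p \<le> 1" and q: "0 \<le> q" "q \<le> 1" and s: "0 \<le> s"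
    and J: "J \<in> sets borel" and diam: "\<And>u w. u \<in> J \<Longrightarrow> w \<in> J \<Longrightarrow> u - w \<le> s"
  shows "(\<integral>\<^sup>+y. \<integral>\<^sup>+x. indicator {x. x \<le> y \<and> x / (x + y) \<in> J} x \<partial>gamma_measure p \<partial>gamma_measure q)
    \<le> ennreal (8 / (p * Gamma p) * s powr p)"
proof -
  note [measurable] = J
  have Gp: "0 < Gamma p" using p by simp
  interpret Q: prob_space "gamma_measure q" by (rule prob_space_gamma_measure) fact
  \<comment> \<open>The 4 bounds \<open>4 powr p\<close>; the mean \<open>1 + q \<le> 2\<close> of
    \<open>1 + y\<close> doubles it to the 8 of the claim.\<close>
  define c where "c = 4 * s powr p / (p * Gamma p)"
  have c: "0 \<le> c" using p Gp by (simp add: c_def)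
  have "(\<integral>\<^sup>+y. \<integral>\<^sup>+x. indicator {x. x \<le> y \<and> x / (x + y) \<in> J} x \<partial>gamma_measure p \<partial>gamma_measure q)
    \<le> (\<integral>\<^sup>+y. ennreal c * (1 + ennreal y) \<partial>gamma_measure q)"
  proof (rule nn_integral_mono_AE)
    show "AE y in gamma_measure q. (\<integral>\<^sup>+x. indicator {x. x \<le> y \<and> x / (x + y) \<in> J} x \<partial>gamma_measure p) \<le> ennreal c * (1 + ennreal y)"
      using AE_gamma_measure_nonneg
    proof eventually_elim
      case (elim y)
      define S where "S = {x. 0 < x \<and> x \<le> y \<and> x / (x + y) \<in> J}"
      have [measurable]: "S \<in> sets borel" unfolding S_def by measurable
      have "AE x in gamma_measure p. 0 < x" using p by (intro AE_gamma_measure_pos) simp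
      then have "(\<integral>\<^sup>+x. indicator {x. x \<le> y \<and> x / (x + y) \<in> J} x \<partial>gamma_measure p) = (\<integral>\<^sup>+x. indicator S x \<partial>gamma_measure p)"
        by (intro nn_integral_cong_AE) (auto elim!: eventually_mono simp: S_def indicator_def)
      also have "\<dots> = emeasure (gamma_measure p) S" by simp
      also have "\<dots> \<le> ennreal ((4 * s * y) powr p / (p * Gamma p))"
      proof (rule emeasure_gamma_measure_le_diameter[OF p])
        fix x x' assume x: "x \<in> S" and x': "x' \<in> S"
        then have pos: "0 < x" "0 < x'" "x \<le> y" "x' \<le> y" by (auto simp: S_def)
        then have y: "0 < y" by simp
        have "x / (x + y) - x' / (x' + y) \<le> s" using x x' by (intro diam) (auto simp: S_def)
        moreover have "x / (x + y) - x' / (x' + y) = y * (x - x') / ((x + y) * (x' + y))"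
          using pos y by (simp add: field_simps)
        ultimately have "y * (x - x') \<le> s * ((x + y) * (x' + y))"
          using pos y by (simp add: divide_le_eq)
        also have "\<dots> \<le> s * ((2 * y) * (2 * y))"
          using pos y s by (intro mult_left_mono mult_mono) auto
        finally have "y * (x - x') \<le> y * (4 * s * y)" by (simp add: mult_ac)
        then show "x - x' \<le> 4 * s * y" using y by (simp only: mult_le_cancel_left_pos)
      qed (use elim s in \<open>auto simp: S_def\<close>)
      also have "\<dots> \<le> ennreal (c * (1 + y))"
      proof (intro ennreal_leI)
        have "(4 * s * y) powr p = 4 powr p * s powr p * y powr p"
          using s elim by (simp add: powr_mult)
        also have "\<dots> \<le> 4 * s powr p * (1 + y)"
        proof -
          have "y powr p \<le> 1 + y"
          proof (cases "y \<le> 1")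
            case True
            then have "y powr p \<le> 1" using elim p by (intro powr_le1) auto
            then show ?thesis using elim by simp
          next
            case False
            then have "y powr p \<le> y powr 1" using p by (intro powr_mono) auto
            then show ?thesis using elim by simp
          qed
          moreover have "4 powr p \<le> (4::real) powr 1" using p by (intro powr_mono) auto
          ultimately show ?thesis using elim by (intro mult_mono) auto
        qed
        finally have "(4 * s * y) powr p / (p * Gamma p) \<le> 4 * s powr p * (1 + y) / (p * Gamma p)"
          using p Gp by (intro divide_right_mono) auto
        then show "(4 * s * y) powr p / (p * Gamma p) \<le> c * (1 + y)" by (simp add: c_def)
      qed
      also have "\<dots> = ennreal c * (1 + ennreal y)"
        using c elim ennreal_plus[of 1 y] by (simp add: ennreal_mult)
      finally show ?case .
    qed
  qed
  also have "\<dots> = ennreal c * (1 + ennreal q)"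
    using q Q.emeasure_space_1 by (simp add: nn_integral_cmult nn_integral_add nn_integral_gamma_measure_id)
  also have "\<dots> = ennreal (c * (1 + q))"
    using c q ennreal_plus[of 1 q] by (simp add: ennreal_mult)
  also have "\<dots> \<le> ennreal (c * 2)"
    using c q by (intro ennreal_leI mult_left_mono) auto
  finally show ?thesis by (simp add: c_def)
qed

text \<open>The region is split according to which variable is larger. Exchanging them replaces a
  ratio \<open>v\<close> by \<open>1 - v\<close>, so the half \<open>y \<le> x\<close> is the
  previous estimate for the reflected set with \<open>p\<close> and \<open>q\<close>
  interchanged.\<close>

lemma nn_integral_gamma_ratio_le:
  assumes p: "0 < p" "p \<le> 1" and q: "0 < q" "q \<le> 1" and s: "0 \<le> s"
    and J: "J \<in> sets borel" and diam: "\<And>u w. u \<in> J \<Longrightarrow> w \<in> J \<Longrightarrow> u - w \<le> s"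
  shows "(\<integral>\<^sup>+y. \<integral>\<^sup>+x. indicator J (x / (x + y)) \<partial>gamma_measure p \<partial>gamma_measure q)
    \<le> ennreal (8 / (p * Gamma p) * s powr p + 8 / (q * Gamma q) * s powr q)"
proof -
  note [measurable] = J
  interpret GP: prob_space "gamma_measure p" using p by (intro prob_space_gamma_measure) simp
  interpret Q: prob_space "gamma_measure q" using q by (intro prob_space_gamma_measure) simp
  interpret pair_sigma_finite "gamma_measure p" "gamma_measure q" ..
  define J' where "J' = (\<lambda>v. 1 - v) -` J"
  have J' [measurable]: "J' \<in> sets borel"
    using measurable_sets_borel[OF _ J, of "\<lambda>v. 1 - v"] by (simp add: J'_def)
  have "(\<integral>\<^sup>+y. \<integral>\<^sup>+x. indicator J (x / (x + y)) \<partial>gamma_measure p \<partial>gamma_measure q) \<le>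
    (\<integral>\<^sup>+y. \<integral>\<^sup>+x. indicator {x. x \<le> y \<and> x / (x + y) \<in> J} x + indicator {y. y \<le> x \<and> y / (y + x) \<in> J'} y \<partial>gamma_measure p \<partial>gamma_measure q)"
  proof (rule nn_integral_mono_AE)
    show "AE y in gamma_measure q. (\<integral>\<^sup>+x. indicator J (x / (x + y)) \<partial>gamma_measure p) \<le>
       (\<integral>\<^sup>+x. indicator {x. x \<le> y \<and> x / (x + y) \<in> J} x + indicator {y. y \<le> x \<and> y / (y + x) \<in> J'} y \<partial>gamma_measure p)"
      using AE_gamma_measure_nonneg
    proof eventually_elim
      case (elim y)
      have "AE x in gamma_measure p. 0 < x" using p by (intro AE_gamma_measure_pos) simp
      then show ?case
      proof (intro nn_integral_mono_AE, eventually_elim)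
        case (elim x)
        have "1 - y / (y + x) = x / (x + y)" using elim \<open>0 \<le> y\<close> by (simp add: field_simps)
        then have "y / (y + x) \<in> J'" if "x / (x + y) \<in> J" using that by (simp add: J'_def)
        then show ?case by (cases "x \<le> y") (auto simp: indicator_def)
      qed
    qed
  qed
  also have "\<dots> = (\<integral>\<^sup>+y. \<integral>\<^sup>+x. indicator {x. x \<le> y \<and> x / (x + y) \<in> J} x \<partial>gamma_measure p \<partial>gamma_measure q) +
    (\<integral>\<^sup>+y. \<integral>\<^sup>+x. indicator {y. y \<le> x \<and> y / (y + x) \<in> J'} y \<partial>gamma_measure p \<partial>gamma_measure q)"
  proof -
    have 1: "(\<lambda>(y, x). indicator {x. x \<le> y \<and> x / (x + y) \<in> J} x :: ennreal) \<in> borel_measurable (gamma_measure q \<Otimes>\<^sub>M gamma_measure p)"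
      and 2: "(\<lambda>(y, x). indicator {y. y \<le> x \<and> y / (y + x) \<in> J'} y :: ennreal) \<in> borel_measurable (gamma_measure q \<Otimes>\<^sub>M gamma_measure p)"
      unfolding indicator_def by measurable
    have "(\<lambda>x. indicator {x. x \<le> y \<and> x / (x + y) \<in> J} x :: ennreal) \<in> borel_measurable (gamma_measure p)"
      "(\<lambda>x. indicator {y. y \<le> x \<and> y / (y + x) \<in> J'} y :: ennreal) \<in> borel_measurable (gamma_measure p)" for y
      unfolding indicator_def by measurable
    moreover have "(\<lambda>y. \<integral>\<^sup>+x. indicator {x. x \<le> y \<and> x / (x + y) \<in> J} x \<partial>gamma_measure p) \<in> borel_measurable (gamma_measure q)"
      "(\<lambda>y. \<integral>\<^sup>+x. indicator {y. y \<le> x \<and> y / (y + x) \<in> J'} y \<partial>gamma_measure p) \<in> borel_measurable (gamma_measure q)"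
      using GP.borel_measurable_nn_integral[OF 1]
        GP.borel_measurable_nn_integral[OF 2] by auto
    ultimately show ?thesis by (simp add: nn_integral_add del: nn_integral_indicator)
  qed
  also have "(\<integral>\<^sup>+y. \<integral>\<^sup>+x. indicator {y. y \<le> x \<and> y / (y + x) \<in> J'} y \<partial>gamma_measure p \<partial>gamma_measure q) =
    (\<integral>\<^sup>+x. \<integral>\<^sup>+y. indicator {y. y \<le> x \<and> y / (y + x) \<in> J'} y \<partial>gamma_measure q \<partial>gamma_measure p)"
    by (rule Fubini') (simp add: indicator_def)
  also have "(\<integral>\<^sup>+y. \<integral>\<^sup>+x. indicator {x. x \<le> y \<and> x / (x + y) \<in> J} x \<partial>gamma_measure p \<partial>gamma_measure q) +
      (\<integral>\<^sup>+x. \<integral>\<^sup>+y. indicator {y. y \<le> x \<and> y / (y + x) \<in> J'} y \<partial>gamma_measure q \<partial>gamma_measure p) \<le>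
    ennreal (8 / (p * Gamma p) * s powr p) + ennreal (8 / (q * Gamma q) * s powr q)"
  proof (intro add_mono nn_integral_gamma_ratio_half_le)
    fix u w assume "u \<in> J'" "w \<in> J'"
    then show "u - w \<le> s" using diam[of "1 - w" "1 - u"] by (simp add: J'_def)
  qed (use p q s J diam in auto)
  also have "\<dots> = ennreal (8 / (p * Gamma p) * s powr p + 8 / (q * Gamma q) * s powr q)"
    using p q by (intro ennreal_plus[symmetric]) (auto intro!: mult_nonneg_nonneg divide_nonneg_nonneg less_imp_le[OF Gamma_real_pos])
  finally show ?thesis .
qed

abbreviation (input) mass_between :: "'a measure \<Rightarrow> 'a set \<Rightarrow> real \<Rightarrow> real \<Rightarrow> 'a measure set" where
  "mass_between M A t s \<equiv> {Q \<in> probs M. t < measure Q A \<and> measure Q A \<le> t + s}"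

text \<open>The mass of \<open>A\<close> is Beta distributed with parameters
  \<open>p = \<alpha> * measure G A\<close> and \<open>q = \<alpha> - p\<close>, both at most one
  since \<open>\<alpha> \<le> 1\<close>, and both at least \<open>b\<close>.\<close>

lemma dirichlet_measure_interval_le:
  assumes G: "G \<in> probs M" and \<alpha>: "0 < \<alpha>" "\<alpha> \<le> 1" and A: "A \<in> sets M"
    and b: "0 < b" "b \<le> \<alpha> * measure G A" "b \<le> \<alpha> * (1 - measure G A)"
  shows "\<exists>C>0. \<forall>t. \<forall>s>0. measure (dirichlet_measure M \<alpha> G)
    (mass_between M A t s) \<le> C * s powr b"
proof -
  let ?D = "dirichlet_measure M \<alpha> G"
  interpret G: prob_space G using G by (simp add: space_prob_algebra)
  interpret D: prob_space ?D using G \<alpha>(1) by (rule prob_space_dirichlet_measure)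
  have sG: "sets G = sets M" "space G = space M" using space_prob_algebraD[OF G] by auto
  have sD: "sets ?D = sets (prob_algebra M)" using G \<alpha>(1) by (rule sets_dirichlet_measure)
  have spD: "space ?D = probs M" using sD by (rule sets_eq_imp_space_eq)
  define p where "p = \<alpha> * measure G A"
  define q where "q = \<alpha> * (1 - measure G A)"
  define a where "a = (\<lambda>i::nat. \<alpha> * measure G (if i = 0 then A else space M - A))"
  have compl: "measure G (space M - A) = 1 - measure G A"
    using G.prob_compl[of A] A sG by simp
  have a: "a 0 = p" "a 1 = q" "\<And>i. 0 \<le> a i" using \<alpha> by (auto simp: a_def p_def q_def compl)
  have p: "0 < p" "b \<le> p" and q: "0 < q" "b \<le> q" using b by (auto simp: p_def q_def)
  have p1: "p \<le> 1" unfolding p_def using \<alpha> by (intro mult_le_one) auto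
  have q1: "q \<le> 1" unfolding q_def using \<alpha> by (intro mult_le_one) auto
  \<comment> \<open>The summand one makes the bound trivial for \<open>s > 1\<close>; for smaller
    \<open>s\<close> the exponents \<open>p\<close> and \<open>q\<close> may be lowered to
    \<open>b\<close>.\<close>
  define C where "C = 1 + 8 / (p * Gamma p) + 8 / (q * Gamma q)"
  have Cge: "0 \<le> 8 / (p * Gamma p)" "0 \<le> 8 / (q * Gamma q)"
    using p q by (auto intro!: divide_nonneg_nonneg mult_nonneg_nonneg less_imp_le[OF Gamma_real_pos])
  have "measure ?D (mass_between M A t s) \<le> C * s powr b"
    if s: "0 < s" for t s
  proof (cases "s \<le> 1")
    case False
    have "measure ?D (mass_between M A t s) \<le> 1" by simp
    also have "\<dots> \<le> C * 1" using Cge by (simp add: C_def)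
    also have "\<dots> \<le> C * s powr b"
      using False b Cge by (intro mult_left_mono ge_one_powr_ge_zero) (auto simp: C_def)
    finally show ?thesis .
  next
    case True
    define J where "J = {t<..t + s}"
    have [measurable]: "J \<in> sets borel" by (simp add: J_def)
    have [measurable]: "A \<in> sets M" by (rule A)
    interpret product_sigma_finite "\<lambda>i. gamma_measure (a i)"
      by (rule product_sigma_finite_gamma_measure) (rule a)
    have ev: "mass_between M A t s \<in> sets (prob_algebra M)"
      by measurable
    have "emeasure ?D (mass_between M A t s) =
      (\<integral>\<^sup>+Q. indicator (mass_between M A t s) Q \<partial>?D)"
      using ev sD by simp
    also have "\<dots> = (\<integral>\<^sup>+Q. indicator J (measure Q A) \<partial>?D)"
      by (intro nn_integral_cong) (auto simp: J_def indicator_def spD)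
    also have "\<dots> = (\<integral>\<^sup>+z. indicator J (z 0) \<partial>dirichlet_on {..<2} a)"
      unfolding a_def by (rule nn_integral_dirichlet_measure_eval[OF G \<alpha>(1) A]) simp
    also have "\<dots> = (\<integral>\<^sup>+y. indicator J (normalize_on {..<2} y 0) \<partial>gammas {..<2} a)"
      unfolding dirichlet_on_def by (subst nn_integral_distr) auto
    also have "\<dots> = (\<integral>\<^sup>+y. indicator J (y 0 / (y 0 + y 1)) \<partial>PiM (insert 0 {1}) (\<lambda>i. gamma_measure (a i)))"
    proof -
      have 2: "{..<2} = insert 0 {1::nat}" by auto
      show ?thesis unfolding 2 by (simp add: normalize_on_def)
    qed
    also have "\<dots> = (\<integral>\<^sup>+x. \<integral>\<^sup>+y. indicator J (y / (y + x 1)) \<partial>gamma_measure (a 0) \<partial>PiM {1} (\<lambda>i. gamma_measure (a i)))"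
      by (subst product_nn_integral_insert) auto
    also have "\<dots> = (\<integral>\<^sup>+x. \<integral>\<^sup>+y. indicator J (y / (y + x)) \<partial>gamma_measure p \<partial>gamma_measure q)"
    proof -
      interpret P: prob_space "gamma_measure p" using p by (intro prob_space_gamma_measure) simp
      show ?thesis unfolding a(1) a(2)[symmetric] by (rule product_nn_integral_singleton) measurable
    qed
    also have "\<dots> \<le> ennreal (8 / (p * Gamma p) * s powr p + 8 / (q * Gamma q) * s powr q)"
      using p q p1 q1 s by (intro nn_integral_gamma_ratio_le) (auto simp: J_def)
    finally have "ennreal (measure ?D (mass_between M A t s)) \<le>
      ennreal (8 / (p * Gamma p) * s powr p + 8 / (q * Gamma q) * s powr q)"
      by (simp only: D.emeasure_eq_measure)
    then have "measure ?D (mass_between M A t s) \<le>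
      8 / (p * Gamma p) * s powr p + 8 / (q * Gamma q) * s powr q"
      by (rule ennreal_le_iff[THEN iffD1, rotated]) (intro add_nonneg_nonneg mult_nonneg_nonneg Cge powr_ge_zero)
    also have "\<dots> \<le> 8 / (p * Gamma p) * s powr b + 8 / (q * Gamma q) * s powr b"
      using Cge p q s True by (intro add_mono mult_left_mono powr_mono') auto
    also have "\<dots> \<le> C * s powr b" by (simp add: C_def algebra_simps)
    finally show ?thesis .
  qed
  moreover have "0 < C" unfolding C_def by (intro add_pos_nonneg Cge zero_less_one)
  ultimately show ?thesis by blast
qed

text \<open>The mean mass of the complement of \<open>A\<close> is its mass under \<open>G\<close>,
  hence zero, and a nonnegative variable of mean zero vanishes almost surely.\<close>

lemma AE_dirichlet_measure_support:
  assumes G: "G \<in> probs M" and \<alpha>: "0 < \<alpha>" and A: "A \<in> sets M" and "measure G A = 1"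
  shows "AE Q in dirichlet_measure M \<alpha> G. measure Q A = 1"
proof -
  let ?D = "dirichlet_measure M \<alpha> G"
  interpret G: prob_space G using G by (simp add: space_prob_algebra)
  have sG: "sets G = sets M" "space G = space M" using space_prob_algebraD[OF G] by auto
  have sD: "sets ?D = sets (prob_algebra M)" using G \<alpha> by (rule sets_dirichlet_measure)
  have spD: "space ?D = probs M" using sD by (rule sets_eq_imp_space_eq)
  have "measure G (space M - A) = 0" using G.prob_compl[of A] A sG assms(4) by simp
  then have "(\<integral>\<^sup>+Q. emeasure Q (space M - A) \<partial>?D) = 0"
    using A by (subst dirichlet_measure_mean[OF G \<alpha>]) (auto simp: G.emeasure_eq_measure)
  moreover have "(\<lambda>Q. emeasure Q (space M - A)) \<in> borel_measurable ?D"
    unfolding measurable_cong_sets[OF sD refl] prob_algebra_def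
    using A by (intro measurable_restrict_space1 measurable_emeasure_subprob_algebra) auto
  ultimately have "AE Q in ?D. emeasure Q (space M - A) = 0"
    by (subst (asm) nn_integral_0_iff_AE) auto
  then show ?thesis
    using AE_space
  proof eventually_elim
    case (elim Q)
    then interpret Q: prob_space Q by (simp add: spD space_prob_algebra)
    have "sets Q = sets M" "space Q = space M" using elim space_prob_algebraD[of Q M] by (auto simp: spD)
    then show ?case using elim A Q.prob_compl[of A] by (simp add: Q.emeasure_eq_measure)
  qed
qed

text \<open>Fubini: for a fixed outcome, the levels \<open>t\<close> of the unit interval that are
  at least \<open>X x\<close> have total length \<open>1 - X x\<close>.\<close>

lemma (in prob_space) nn_integral_cdf_unit_interval:
  assumes X [measurable]: "X \<in> borel_measurable M" and X01: "\<And>x. x \<in> space M \<Longrightarrow> 0 \<le> X x \<and> X x \<le> 1"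
  shows "(\<integral>\<^sup>+t. emeasure M {x \<in> space M. X x \<le> t} * indicator {0..1} t \<partial>lborel) = ennreal (1 - expectation X)"
proof -
  interpret pair_sigma_finite lborel M ..
  have "(\<integral>\<^sup>+t. emeasure M {x \<in> space M. X x \<le> t} * indicator {0..1} t \<partial>lborel) =
    (\<integral>\<^sup>+t. \<integral>\<^sup>+x. indicator {X x..1} t * indicator {0..1} t \<partial>M \<partial>lborel)"
  proof (rule nn_integral_cong)
    fix t :: real
    have "(\<integral>\<^sup>+x. indicator {X x..1} t * indicator {0..1} t \<partial>M) =
      (\<integral>\<^sup>+x. indicator {x \<in> space M. X x \<le> t} x * indicator {0..1} t \<partial>M)"
      by (intro nn_integral_cong) (auto simp: indicator_def)
    also have "\<dots> = emeasure M {x \<in> space M. X x \<le> t} * indicator {0..1} t"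
      by (subst nn_integral_multc) auto
    finally show "emeasure M {x \<in> space M. X x \<le> t} * indicator {0..1} t = (\<integral>\<^sup>+x. indicator {X x..1} t * indicator {0..1} t \<partial>M)" ..
  qed
  also have "\<dots> = (\<integral>\<^sup>+x. \<integral>\<^sup>+t. indicator {X x..1} t * indicator {0..1} t \<partial>lborel \<partial>M)"
    by (rule Fubini'[symmetric]) (simp add: indicator_def)
  also have "\<dots> = (\<integral>\<^sup>+x. ennreal (1 - X x) \<partial>M)"
  proof (rule nn_integral_cong)
    fix x assume "x \<in> space M"
    then have "(\<integral>\<^sup>+t. indicator {X x..1} t * indicator {0..1} t \<partial>lborel) = (\<integral>\<^sup>+t. indicator {X x..1} t \<partial>lborel)"
      using X01 by (intro nn_integral_cong) (force simp: indicator_def)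
    then show "(\<integral>\<^sup>+t. indicator {X x..1} t * indicator {0..1} t \<partial>lborel) = ennreal (1 - X x)"
      using X01 \<open>x \<in> space M\<close> by simp
  qed
  also have "\<dots> = ennreal (1 - expectation X)"
  proof -
    have "integrable M X"
      using X01 by (intro integrable_const_bound[where B=1]) auto
    then show ?thesis
      using X01 by (subst nn_integral_eq_integral) (auto simp: prob_space)
  qed
  finally show ?thesis .
qed

text \<open>If at every level the distribution function of \<open>Y\<close> exceeded that of
  \<open>X\<close> by at most \<open>d / 2\<close>, integration over the unit interval would bound
  the difference of the means by \<open>d / 2\<close>. Halving \<open>d\<close> leaves room for the
  contradiction.\<close>

lemma exists_cdf_gap:
  assumes N: "prob_space N" "X \<in> borel_measurable N" "\<And>x. x \<in> space N \<Longrightarrow> 0 \<le> X x \<and> X x \<le> 1"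
    and N': "prob_space N'" "Y \<in> borel_measurable N'" "\<And>x. x \<in> space N' \<Longrightarrow> 0 \<le> Y x \<and> Y x \<le> 1"
    and d: "0 < d" "(\<integral>x. Y x \<partial>N') + d \<le> (\<integral>x. X x \<partial>N)"
  shows "\<exists>t. measure N {x \<in> space N. X x \<le> t} + d / 2 \<le> measure N' {x \<in> space N'. Y x \<le> t}"
proof (rule ccontr)
  interpret N: prob_space N by fact
  interpret N': prob_space N' by fact
  note [measurable] = N(2) N'(2)
  assume "\<not> ?thesis"
  then have less: "measure N' {x \<in> space N'. Y x \<le> t} \<le> measure N {x \<in> space N. X x \<le> t} + d / 2" for t
    by (meson linear)
  have EX: "(\<integral>x. X x \<partial>N) \<le> 1"
  proof -
    have "integrable N X" using N(3) by (intro N.integrable_const_bound[where B=1]) auto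
    then have "(\<integral>x. X x \<partial>N) \<le> (\<integral>x. 1 \<partial>N)" using N(3) by (intro integral_mono) auto
    then show ?thesis by (simp add: N.prob_space)
  qed
  have mN: "(\<lambda>t. emeasure N {x \<in> space N. X x \<le> t}) \<in> borel_measurable borel"
    by measurable
  have "ennreal (1 - N'.expectation Y) = (\<integral>\<^sup>+t. emeasure N' {x \<in> space N'. Y x \<le> t} * indicator {0..1} t \<partial>lborel)"
    by (rule N'.nn_integral_cdf_unit_interval[symmetric]) (use N' in auto)
  also have "\<dots> \<le> (\<integral>\<^sup>+t. emeasure N {x \<in> space N. X x \<le> t} * indicator {0..1} t + ennreal (d / 2) * indicator {0..1} t \<partial>lborel)"
  proof (intro nn_integral_mono)
    fix t :: real
    show "emeasure N' {x \<in> space N'. Y x \<le> t} * indicator {0..1} t \<le>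
      emeasure N {x \<in> space N. X x \<le> t} * indicator {0..1} t + ennreal (d / 2) * indicator {0..1} t"
      using less[of t] d
      by (auto simp: indicator_def N.emeasure_eq_measure N'.emeasure_eq_measure ennreal_plus[symmetric]
          simp del: ennreal_plus intro!: ennreal_leI)
  qed
  also have "\<dots> = ennreal (1 - N.expectation X) + ennreal (d / 2)"
    using mN by (subst nn_integral_add) (auto simp: N.nn_integral_cdf_unit_interval N(3) nn_integral_cmult)
  also have "\<dots> = ennreal (1 - N.expectation X + d / 2)"
    using EX d by (intro ennreal_plus[symmetric]) auto
  finally have "1 - N'.expectation Y \<le> 1 - N.expectation X + d / 2"
    using EX d by (subst (asm) ennreal_le_iff) auto
  then show False using d by simp
qed

section \<open>Transport cost and Voronoi cells\<close>

locale bounded_transport =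
  fixes \<Theta> :: "'a::euclidean_space set" and r R :: real
  assumes r_ge_1: "1 \<le> r" and R_pos: "0 < R"
    and diam: "\<And>x y. x \<in> \<Theta> \<Longrightarrow> y \<in> \<Theta> \<Longrightarrow> norm (x - y) \<le> R"
begin

abbreviation "M \<equiv> restrict_space borel \<Theta>"

definition cost :: "'a \<times> 'a \<Rightarrow> real" where
  "cost p = norm (fst p - snd p) powr r"

lemma space_M [simp]: "space M = \<Theta>"
  by (simp add: space_restrict_space)

lemma measurable_M_borel [measurable]: "(\<lambda>x. x) \<in> M \<rightarrow>\<^sub>M borel"
  by (rule measurable_restrict_space1) simp

lemma measurable_cost [measurable]: "cost \<in> borel_measurable (M \<Otimes>\<^sub>M M)"
proof -
  have [measurable]: "fst \<in> M \<Otimes>\<^sub>M M \<rightarrow>\<^sub>M borel" "snd \<in> M \<Otimes>\<^sub>M M \<rightarrow>\<^sub>M borel"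
    using measurable_compose[OF measurable_fst measurable_M_borel] measurable_compose[OF measurable_snd measurable_M_borel]
    by auto
  show ?thesis unfolding cost_def[abs_def] by measurable
qed

lemma cost_nonneg [simp]: "0 \<le> cost p"
  by (simp add: cost_def)

lemma powr_dist_le: "x \<in> \<Theta> \<Longrightarrow> y \<in> \<Theta> \<Longrightarrow> norm (x - y) powr r \<le> R powr r"
  using diam r_ge_1 by (intro powr_mono2) auto

lemma cost_le: "p \<in> space (M \<Otimes>\<^sub>M M) \<Longrightarrow> cost p \<le> R powr r"
  unfolding cost_def by (intro powr_dist_le) (auto simp: space_pair_measure)

lemma couplingsD:
  assumes "\<kappa> \<in> couplings M G G'"
  shows "sets \<kappa> = sets (M \<Otimes>\<^sub>M M)" "space \<kappa> = space (M \<Otimes>\<^sub>M M)" "prob_space \<kappa>"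
    "distr \<kappa> M fst = G" "distr \<kappa> M snd = G'"
  using assms space_prob_algebraD[of \<kappa> "M \<Otimes>\<^sub>M M"] by (auto simp: couplings_def)

lemma integrable_cost:
  assumes "\<kappa> \<in> couplings M G G'"
  shows "integrable \<kappa> cost"
proof -
  note \<kappa> = couplingsD[OF assms]
  interpret prob_space \<kappa> by (rule \<kappa>(3))
  have "cost \<in> borel_measurable \<kappa>"
    unfolding measurable_cong_sets[OF \<kappa>(1) refl] by (rule measurable_cost)
  then show ?thesis
    using cost_le by (intro integrable_const_bound[where B="R powr r"]) (auto simp: \<kappa>(2))
qed

text \<open>The product measure is a coupling. This matters because an infimum over an empty set of
  reals is unspecified.\<close>

lemma couplings_nonempty:
  assumes G: "G \<in> probs M" and G': "G' \<in> probs M"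
  shows "couplings M G G' \<noteq> {}"
proof -
  note g = space_prob_algebraD[OF G] and g' = space_prob_algebraD[OF G']
  interpret G: prob_space G by (rule g)
  interpret G': prob_space G' by (rule g')
  interpret pair_prob_space G G' ..
  have s: "sets (G \<Otimes>\<^sub>M G') = sets (M \<Otimes>\<^sub>M M)" using g g' by (intro sets_pair_measure_cong) auto
  have "distr (G \<Otimes>\<^sub>M G') M fst = distr (G \<Otimes>\<^sub>M G') G fst"
    using g by (intro distr_cong) auto
  moreover have "distr (G \<Otimes>\<^sub>M G') M snd = G'"
  proof (rule measure_eqI)
    fix A assume "A \<in> sets (distr (G \<Otimes>\<^sub>M G') M snd)"
    then have A: "A \<in> sets G'" using g' by simp
    have m: "snd \<in> G \<Otimes>\<^sub>M G' \<rightarrow>\<^sub>M M"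
      unfolding measurable_cong_sets[OF refl g'(1)[symmetric]] by (rule measurable_snd)
    have "snd -` A \<inter> space (G \<Otimes>\<^sub>M G') = space G \<times> A"
      using A sets.sets_into_space[OF A] by (auto simp: space_pair_measure)
    then show "emeasure (distr (G \<Otimes>\<^sub>M G') M snd) A = emeasure G' A"
      using A g' by (simp add: emeasure_distr[OF m] G'.emeasure_pair_measure_Times G.emeasure_space_1)
  qed (use g' in simp)
  ultimately have "G \<Otimes>\<^sub>M G' \<in> couplings M G G'"
    using s by (simp add: couplings_def space_prob_algebra G'.distr_pair_fst prob_space_axioms)
  then show ?thesis by auto
qed

text \<open>The infimum is nonnegative, so the root in \<open>wass\<close> can be undone. The
  transport estimates below are proved for this power, one coupling at a time.\<close>

lemma wass_powr:
  assumes "G \<in> probs M" "G' \<in> probs M"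
  shows "wass r M G G' powr r = (INF \<kappa>\<in>couplings M G G'. \<integral>x. cost x \<partial>\<kappa>)"
proof -
  let ?I = "INF \<kappa>\<in>couplings M G G'. \<integral>x. cost x \<partial>\<kappa>"
  have "0 \<le> ?I"
    using couplings_nonempty[OF assms] by (intro cINF_greatest) (auto intro!: integral_nonneg_AE)
  then have "(?I powr (1 / r)) powr r = ?I"
    using r_ge_1 by (simp add: powr_powr)
  then show ?thesis by (simp add: wass_def cost_def)
qed

lemma wass_powr_le:
  assumes "G \<in> probs M" "G' \<in> probs M" "\<kappa> \<in> couplings M G G'"
  shows "wass r M G G' powr r \<le> (\<integral>x. cost x \<partial>\<kappa>)"
  unfolding wass_powr[OF assms(1,2)] using assms(3)
  by (intro cINF_lower bdd_belowI[of _ 0]) (auto intro!: integral_nonneg_AE)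

lemma wass_powr_ge:
  assumes "G \<in> probs M" "G' \<in> probs M"
    and "\<And>\<kappa>. \<kappa> \<in> couplings M G G' \<Longrightarrow> c \<le> (\<integral>x. cost x \<partial>\<kappa>)"
  shows "c \<le> wass r M G G' powr r"
  unfolding wass_powr[OF assms(1,2)] using couplings_nonempty[OF assms(1,2)] assms(3)
  by (intro cINF_greatest) auto

lemma wass_nonneg: "0 \<le> wass r M G G'"
  by (simp add: wass_def)

lemma wass_le:
  assumes "G \<in> probs M" "G' \<in> probs M"
  shows "wass r M G G' \<le> R"
proof -
  obtain \<kappa> where \<kappa>: "\<kappa> \<in> couplings M G G'" using couplings_nonempty[OF assms] by auto
  note k = couplingsD[OF \<kappa>]
  interpret prob_space \<kappa> by (rule k)
  have "wass r M G G' powr r \<le> (\<integral>x. cost x \<partial>\<kappa>)" by (rule wass_powr_le[OF assms \<kappa>])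
  also have "\<dots> \<le> (\<integral>x. R powr r \<partial>\<kappa>)"
    using integrable_cost[OF \<kappa>] cost_le by (intro integral_mono) (auto simp: k(2))
  finally have "wass r M G G' powr r \<le> R powr r" by (simp add: prob_space)
  then show ?thesis
    using r_ge_1 R_pos wass_nonneg[of G G'] powr_less_mono2[of r R "wass r M G G'"] by (meson less_le_trans not_le less_imp_le zero_less_one)
qed

end

section \<open>Voronoi cells of finitely many atoms\<close>

locale transport_atoms = bounded_transport +
  fixes \<theta> :: "nat \<Rightarrow> 'a" and n :: nat
  assumes n_pos: "0 < n" and atoms_in: "\<And>i. i < n \<Longrightarrow> \<theta> i \<in> \<Theta>" and inj: "inj_on \<theta> {..<n}"
begin

text \<open>The least index breaks ties, so the cells partition \<open>\<Theta>\<close> even where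
  several atoms are equally near.\<close>

definition nearest :: "'a \<Rightarrow> nat" where
  "nearest x = (LEAST j. j < n \<and> (\<forall>i<n. norm (x - \<theta> j) \<le> norm (x - \<theta> i)))"

definition cell :: "nat \<Rightarrow> 'a set" where
  "cell j = {x \<in> \<Theta>. nearest x = j}"

definition atoms :: "'a set" where
  "atoms = \<theta> ` {..<n}"

definition spread :: "'a \<Rightarrow> real" where
  "spread x = norm (x - \<theta> (nearest x)) powr r"

lemma nearest: "nearest x < n" "i < n \<Longrightarrow> norm (x - \<theta> (nearest x)) \<le> norm (x - \<theta> i)"
proof -
  let ?S = "(\<lambda>i. norm (x - \<theta> i)) ` {..<n}"
  have "Min ?S \<in> ?S" using n_pos by (intro Min_in) auto
  then obtain j where j: "j < n" "Min ?S = norm (x - \<theta> j)" by auto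
  then have "\<forall>i<n. norm (x - \<theta> j) \<le> norm (x - \<theta> i)"
    using Min_le[of ?S] by (metis finite_imageI finite_lessThan imageI lessThan_iff)
  then have "nearest x < n \<and> (\<forall>i<n. norm (x - \<theta> (nearest x)) \<le> norm (x - \<theta> i))"
    unfolding nearest_def using j LeastI[of "\<lambda>j. j < n \<and> (\<forall>i<n. norm (x - \<theta> j) \<le> norm (x - \<theta> i))" j] by simp
  then show "nearest x < n" "i < n \<Longrightarrow> norm (x - \<theta> (nearest x)) \<le> norm (x - \<theta> i)" by auto
qed

lemma nearest_atom: "i < n \<Longrightarrow> nearest (\<theta> i) = i"
  using nearest(2)[of i "\<theta> i"] nearest(1)[of "\<theta> i"] inj by (auto simp: inj_on_def)

lemma measurable_nearest [measurable]: "nearest \<in> M \<rightarrow>\<^sub>M count_space UNIV"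
  unfolding nearest_def[abs_def] by measurable

lemma sets_cell [measurable]: "cell j \<in> sets M"
proof -
  have "cell j = {x \<in> space M. nearest x = j}" by (simp add: cell_def)
  also have "\<dots> \<in> sets M" by measurable
  finally show ?thesis .
qed

lemma sets_atom [measurable]: "i < n \<Longrightarrow> {\<theta> i} \<in> sets M"
  using atoms_in[of i] by (auto simp: sets_restrict_space image_iff intro!: bexI[of _ "{\<theta> i}"])

lemma sets_atoms [measurable]: "atoms \<in> sets M"
proof -
  have "atoms = (\<Union>i\<in>{..<n}. {\<theta> i})" by (auto simp: atoms_def)
  also have "\<dots> \<in> sets M" by (intro sets.finite_UN) auto
  finally show ?thesis .
qed

lemma measurable_spread [measurable]: "spread \<in> borel_measurable M"
proof -
  have "(\<lambda>x. \<theta> (nearest x)) \<in> borel_measurable M"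
    by (rule measurable_compose[OF measurable_nearest]) simp
  then show ?thesis unfolding spread_def[abs_def] by measurable
qed

lemma spread_nonneg [simp]: "0 \<le> spread x"
  by (simp add: spread_def)

lemma spread_le: "i < n \<Longrightarrow> spread x \<le> norm (x - \<theta> i) powr r"
  unfolding spread_def using nearest r_ge_1 by (intro powr_mono2) auto

lemma spread_le_R: "x \<in> \<Theta> \<Longrightarrow> spread x \<le> R powr r"
  unfolding spread_def using nearest(1) atoms_in by (intro powr_dist_le) auto

lemma integrable_spread:
  assumes "Q \<in> probs M"
  shows "integrable Q spread"
proof -
  note q = space_prob_algebraD[OF assms]
  interpret prob_space Q by (rule q)
  have "spread \<in> borel_measurable Q" unfolding measurable_cong_sets[OF q(1) refl] by measurable
  then show ?thesis
    using spread_le_R q(2) by (intro integrable_const_bound[where B="R powr r"]) auto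
qed

text \<open>In every coupling the second point is almost surely an atom, hence no closer to the
  first point than the atom nearest to it.\<close>

lemma spread_integral_le_wass:
  assumes Q: "Q \<in> probs M" and P: "P \<in> probs M" and supp: "measure P atoms = 1"
  shows "(\<integral>x. spread x \<partial>Q) \<le> wass r M Q P powr r"
proof (rule wass_powr_ge[OF Q P])
  fix \<kappa> assume \<kappa>: "\<kappa> \<in> couplings M Q P"
  note k = couplingsD[OF \<kappa>] and p = space_prob_algebraD[OF P]
  interpret prob_space \<kappa> by (rule k)
  interpret P: prob_space P by (rule p)
  have fst_m: "fst \<in> \<kappa> \<rightarrow>\<^sub>M M" and snd_m: "snd \<in> \<kappa> \<rightarrow>\<^sub>M M"
    unfolding measurable_cong_sets[OF k(1) refl] by auto
  have "AE x in distr \<kappa> M snd. x \<in> atoms"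
    unfolding k(5) using supp sets_atoms p by (intro P.AE_prob_1) auto
  then have supp': "AE x in \<kappa>. snd x \<in> atoms" by (rule AE_distrD[OF snd_m])
  have "(\<integral>x. spread x \<partial>Q) = (\<integral>x. spread (fst x) \<partial>\<kappa>)"
    unfolding k(4)[symmetric] by (rule integral_distr[OF fst_m]) measurable
  also have "\<dots> \<le> (\<integral>x. cost x \<partial>\<kappa>)"
  proof (rule integral_mono_AE[OF _ integrable_cost[OF \<kappa>]])
    show "integrable \<kappa> (\<lambda>x. spread (fst x))"
      using integrable_spread[OF Q] unfolding k(4)[symmetric] by (subst (asm) integrable_distr_eq[OF fst_m]) auto
    show "AE x in \<kappa>. spread (fst x) \<le> cost x"
      using supp' by eventually_elim (auto simp: atoms_def cost_def intro!: spread_le)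
  qed
  finally show "(\<integral>x. spread x \<partial>Q) \<le> (\<integral>x. cost x \<partial>\<kappa>)" .
qed

text \<open>Mass that leaves a Voronoi cell towards a different atom travels at least half the minimal gap.\<close>

lemma cell_measure_le_wass:
  assumes Q: "Q \<in> probs M" and P: "P \<in> probs M" and supp: "measure P atoms = 1"
    and m: "0 < m" "\<And>i j. i < n \<Longrightarrow> j < n \<Longrightarrow> i \<noteq> j \<Longrightarrow> m \<le> norm (\<theta> i - \<theta> j)"
  shows "measure P (cell j) \<le> measure Q (cell j) + (2 / m) powr r * wass r M Q P powr r"
proof -
  have "(m / 2) powr r * (measure P (cell j) - measure Q (cell j)) \<le> wass r M Q P powr r"
  proof (rule wass_powr_ge[OF Q P])
    fix \<kappa> assume \<kappa>: "\<kappa> \<in> couplings M Q P"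
    note k = couplingsD[OF \<kappa>] and p = space_prob_algebraD[OF P]
    interpret prob_space \<kappa> by (rule k)
    interpret P: prob_space P by (rule p)
    have fst_m: "fst \<in> \<kappa> \<rightarrow>\<^sub>M M" and snd_m: "snd \<in> \<kappa> \<rightarrow>\<^sub>M M"
      unfolding measurable_cong_sets[OF k(1) refl] by auto
    have "AE x in distr \<kappa> M snd. x \<in> atoms"
      unfolding k(5) using supp sets_atoms p by (intro P.AE_prob_1) auto
    then have supp': "AE x in \<kappa>. snd x \<in> atoms" by (rule AE_distrD[OF snd_m])
    have cell_Int: "cell j \<inter> \<Theta> = cell j" by (auto simp: cell_def)
    let ?c = "(m / 2) powr r"
    have i1: "integrable \<kappa> (\<lambda>x. indicator (cell j) (snd x) :: real)" and i2: "integrable \<kappa> (\<lambda>x. indicator (cell j) (fst x) :: real)"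
      using measurable_compose[OF fst_m borel_measurable_indicator[OF sets_cell]]
        measurable_compose[OF snd_m borel_measurable_indicator[OF sets_cell]]
      by (auto intro!: integrable_const_bound[where B=1])
    have e1: "measure P (cell j) = (\<integral>x. indicator (cell j) (snd x) \<partial>\<kappa>)"
      using integral_distr[OF snd_m, of "indicator (cell j) :: 'a \<Rightarrow> real"] p
      unfolding k(5) by (simp add: cell_Int)
    have e2: "measure Q (cell j) = (\<integral>x. indicator (cell j) (fst x) \<partial>\<kappa>)"
      using integral_distr[OF fst_m, of "indicator (cell j) :: 'a \<Rightarrow> real"] space_prob_algebraD[OF Q]
      unfolding k(4) by (simp add: cell_Int)
    have "?c * (measure P (cell j) - measure Q (cell j)) = (\<integral>x. ?c * (indicator (cell j) (snd x) - indicator (cell j) (fst x)) \<partial>\<kappa>)"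
      unfolding e1 e2 using i1 i2 by simp
    also have "\<dots> \<le> (\<integral>x. cost x \<partial>\<kappa>)"
    proof (rule integral_mono_AE[OF _ integrable_cost[OF \<kappa>]])
      show "integrable \<kappa> (\<lambda>x. ?c * (indicator (cell j) (snd x) - indicator (cell j) (fst x)))"
        using i1 i2 by simp
      show "AE x in \<kappa>. ?c * (indicator (cell j) (snd x) - indicator (cell j) (fst x)) \<le> cost x"
        using supp' AE_space
      proof eventually_elim
        case (elim x)
        obtain i where i: "i < n" "snd x = \<theta> i" using elim by (auto simp: atoms_def)
        have x: "fst x \<in> \<Theta>" "snd x \<in> \<Theta>" using elim by (auto simp: k(2) space_pair_measure)
        show ?case
        proof (cases "snd x \<in> cell j \<and> fst x \<notin> cell j")
          case True
          then have ij: "i = j" "nearest (fst x) \<noteq> j" using i x nearest_atom[of i] by (auto simp: cell_def)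
          define l where "l = nearest (fst x)"
          have l: "l < n" "l \<noteq> i" using nearest(1) ij by (auto simp: l_def)
          \<comment> \<open>\<open>\<theta> l\<close> is nearest to \<open>fst x\<close>, so the
            triangle inequality between the two atoms makes the distance of \<open>fst x\<close> to
            \<open>\<theta> i\<close> at least \<open>m / 2\<close>.\<close>
          have "m \<le> norm (\<theta> l - \<theta> i)" using m l i by auto
          also have "\<dots> \<le> norm (fst x - \<theta> l) + norm (fst x - \<theta> i)"
            using norm_triangle_ineq4[of "fst x - \<theta> i" "fst x - \<theta> l"] by (simp add: add.commute)
          also have "\<dots> \<le> 2 * norm (fst x - \<theta> i)"
            using nearest(2)[of i "fst x"] i by (simp add: l_def)
          finally have "?c \<le> cost x"
            unfolding cost_def i(2) using m r_ge_1 by (intro powr_mono2) auto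
          then show ?thesis using True by simp
        next
          case False
          then have "indicator (cell j) (snd x) - indicator (cell j) (fst x) \<le> (0::real)"
            by (auto simp: indicator_def)
          then have "?c * (indicator (cell j) (snd x) - indicator (cell j) (fst x)) \<le> 0"
            by (rule mult_nonneg_nonpos[rotated]) simp
          then show ?thesis using cost_nonneg[of x] by linarith
        qed
      qed
    qed
    finally show "?c * (measure P (cell j) - measure Q (cell j)) \<le> (\<integral>x. cost x \<partial>\<kappa>)" .
  qed
  then have "(2 / m) powr r * ((m / 2) powr r * (measure P (cell j) - measure Q (cell j))) \<le> (2 / m) powr r * wass r M Q P powr r"
    by (rule mult_left_mono) simp
  moreover have "(2 / m) powr r * (m / 2) powr r = 1"
    using m by (simp add: powr_mult[symmetric])
  ultimately show ?thesis by (simp add: mult.assoc[symmetric])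
qed

end

text \<open>Keep as much mass as possible in place and redistribute the surplus proportionally to the deficits.\<close>

lemma transport_matrix:
  fixes b \<beta> :: "nat \<Rightarrow> real"
  assumes b: "\<And>i. i < n \<Longrightarrow> 0 \<le> b i" "(\<Sum>i<n. b i) = 1" and \<beta>: "\<And>i. i < n \<Longrightarrow> 0 \<le> \<beta> i" "(\<Sum>i<n. \<beta> i) = 1"
  obtains \<rho> :: "nat \<Rightarrow> nat \<Rightarrow> real" where "\<And>i j. i < n \<Longrightarrow> j < n \<Longrightarrow> 0 \<le> \<rho> i j"
    "\<And>i. i < n \<Longrightarrow> (\<Sum>j<n. \<rho> i j) = 1" "\<And>j. j < n \<Longrightarrow> (\<Sum>i<n. b i * \<rho> i j) = \<beta> j"
    "(\<Sum>i<n. b i * (1 - \<rho> i i)) \<le> (\<Sum>j<n. max 0 (\<beta> j - b j))"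
proof -
  \<comment> \<open>This is the fraction of block \<open>i\<close> that stays in place. For
    \<open>i < n\<close> the first branch has \<open>b i > \<beta> i \<ge> 0\<close>, so the
    division is genuine.\<close>
  define u where "u = (\<lambda>i. if b i > \<beta> i then \<beta> i / b i else 1)"
  define e where "e = (\<lambda>j. max 0 (\<beta> j - b j))"
  define \<Delta> where "\<Delta> = (\<Sum>j<n. e j)"
  define \<rho> where "\<rho> = (\<lambda>i j. (if i = j then u i else 0) + (1 - u i) * (e j / \<Delta>))"
  have e0: "0 \<le> e j" for j by (simp add: e_def)
  have \<Delta>0: "0 \<le> \<Delta>" unfolding \<Delta>_def by (intro sum_nonneg e0)
  have u01: "0 \<le> u i" "u i \<le> 1" if "i < n" for i
    using b(1)[OF that] \<beta>(1)[OF that] by (auto simp: u_def divide_le_eq)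
  have bu: "b i * u i = min (b i) (\<beta> i)" if "i < n" for i
    using b(1)[OF that] \<beta>(1)[OF that] by (auto simp: u_def)
  have sum_bu: "(\<Sum>i<n. b i * (1 - u i)) = \<Delta>"
  proof -
    have "(\<Sum>i<n. b i * (1 - u i)) = (\<Sum>i<n. b i - min (b i) (\<beta> i))"
      by (intro sum.cong) (auto simp: right_diff_distrib bu)
    also have "\<dots> = (\<Sum>i<n. (b i - \<beta> i) + e i)"
      by (intro sum.cong) (auto simp: e_def)
    also have "\<dots> = \<Delta>" using b \<beta> by (simp add: sum.distrib sum_subtractf \<Delta>_def)
    finally show ?thesis .
  qed
  \<comment> \<open>Without deficit, \<open>e j / \<Delta>\<close> takes the default value 0 of
    division by zero. Nothing has to move then, since equal totals force \<open>b\<close> and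
    \<open>\<beta>\<close> to agree.\<close>
  have \<Delta>_zero: "e j = 0" "u j = 1" if "\<Delta> = 0" "j < n" for j
  proof -
    have all: "\<forall>j\<in>{..<n}. e j = 0"
      using that(1) e0 unfolding \<Delta>_def by (subst (asm) sum_nonneg_eq_0_iff) auto
    then show "e j = 0" using that by simp
    have le: "\<beta> i \<le> b i" if "i < n" for i
      using all that max.cobounded2[of "\<beta> i - b i" 0] by (simp add: e_def)
    have "\<forall>i\<in>{..<n}. b i - \<beta> i = 0"
    proof (subst sum_nonneg_eq_0_iff[symmetric])
      show "(\<Sum>i<n. b i - \<beta> i) = 0" using b \<beta> by (simp add: sum_subtractf)
    qed (use le in auto)
    then show "u j = 1" using that by (auto simp: u_def)
  qed
  have rate: "(\<Sum>j<n. e j / \<Delta>) = (if \<Delta> = 0 then 0 else 1)"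
    by (simp add: sum_divide_distrib[symmetric] \<Delta>_def)
  show ?thesis
  proof (rule that[of \<rho>])
    show "0 \<le> \<rho> i j" if "i < n" "j < n" for i j
      using u01[OF that(1)] e0[of j] \<Delta>0 by (auto simp: \<rho>_def intro!: add_nonneg_nonneg mult_nonneg_nonneg)
    show "(\<Sum>j<n. \<rho> i j) = 1" if "i < n" for i
    proof -
      have "(\<Sum>j<n. \<rho> i j) = u i + (1 - u i) * (\<Sum>j<n. e j / \<Delta>)"
        using that by (simp add: \<rho>_def sum.distrib sum_distrib_left)
      then show ?thesis using \<Delta>_zero(2)[of i] that unfolding rate by auto
    qed
    show "(\<Sum>i<n. b i * \<rho> i j) = \<beta> j" if j: "j < n" for j
    proof -
      have "(\<Sum>i<n. b i * \<rho> i j) = (\<Sum>i<n. (if i = j then b j * u j else 0) + b i * (1 - u i) * (e j / \<Delta>))"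
        by (intro sum.cong) (auto simp: \<rho>_def distrib_left)
      also have "\<dots> = (\<Sum>i<n. if i = j then b j * u j else 0) + (\<Sum>i<n. b i * (1 - u i)) * (e j / \<Delta>)"
        by (simp only: sum.distrib sum_distrib_right)
      also have "\<dots> = b j * u j + \<Delta> * (e j / \<Delta>)"
        using j unfolding sum_bu by simp
      also have "\<dots> = min (b j) (\<beta> j) + e j"
        using j \<Delta>_zero(1)[of j] by (simp add: bu)
      finally show ?thesis by (simp add: e_def)
    qed
    have "(\<Sum>i<n. b i * (1 - \<rho> i i)) \<le> (\<Sum>i<n. b i * (1 - u i))"
      using b u01 e0 \<Delta>0 by (intro sum_mono mult_left_mono) (auto simp: \<rho>_def)
    then show "(\<Sum>i<n. b i * (1 - \<rho> i i)) \<le> (\<Sum>j<n. max 0 (\<beta> j - b j))"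
      by (simp add: sum_bu \<Delta>_def e_def)
  qed
qed

context transport_atoms
begin

lemma nn_integral_nearest:
  assumes Q: "Q \<in> probs M" and g: "\<And>i. i < n \<Longrightarrow> 0 \<le> g i"
  shows "(\<integral>\<^sup>+x. ennreal (g (nearest x)) \<partial>Q) = ennreal (\<Sum>i<n. measure Q (cell i) * g i)"
proof -
  note q = space_prob_algebraD[OF Q]
  interpret Q: prob_space Q by (rule q)
  have "(\<integral>\<^sup>+x. ennreal (g (nearest x)) \<partial>Q) = (\<integral>\<^sup>+x. (\<Sum>i<n. ennreal (g i) * indicator (cell i) x) \<partial>Q)"
  proof (intro nn_integral_cong)
    fix x assume "x \<in> space Q"
    then have "x \<in> \<Theta>" using q by simp
    then have "(\<Sum>i<n. ennreal (g i) * indicator (cell i) x) = (\<Sum>i<n. if i = nearest x then ennreal (g i) else 0)"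
      by (intro sum.cong) (auto simp: cell_def indicator_def)
    then show "ennreal (g (nearest x)) = (\<Sum>i<n. ennreal (g i) * indicator (cell i) x)"
      using nearest(1)[of x] by simp
  qed
  also have "\<dots> = (\<Sum>i<n. ennreal (g i) * emeasure Q (cell i))"
    using q(1) by (subst nn_integral_sum) (auto simp: nn_integral_cmult_indicator)
  also have "\<dots> = (\<Sum>i<n. ennreal (measure Q (cell i) * g i))"
    using g by (intro sum.cong) (auto simp: Q.emeasure_eq_measure ennreal_mult mult.commute)
  also have "\<dots> = ennreal (\<Sum>i<n. measure Q (cell i) * g i)"
    using g by (intro sum_ennreal) auto
  finally show ?thesis .
qed

text \<open>A point \<open>x\<close> is paired with atom \<open>j\<close> with probability
  \<open>\<rho> (nearest x) j\<close>, which depends on \<open>x\<close> only through its cell. The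
  atom is the first coordinate because \<open>G\<close> is to be the first marginal.\<close>

definition atom_coupling :: "'a measure \<Rightarrow> (nat \<Rightarrow> nat \<Rightarrow> real) \<Rightarrow> ('a \<times> 'a) measure" where
  "atom_coupling Q \<rho> = distr (density (Q \<Otimes>\<^sub>M count_space {..<n}) (\<lambda>p. ennreal (\<rho> (nearest (fst p)) (snd p))))
     (M \<Otimes>\<^sub>M M) (\<lambda>p. (\<theta> (snd p), fst p))"

lemma nn_integral_atom_coupling:
  assumes Q: "Q \<in> probs M" and h [measurable]: "h \<in> borel_measurable (M \<Otimes>\<^sub>M M)"
  shows "(\<integral>\<^sup>+p. h p \<partial>atom_coupling Q \<rho>) = (\<integral>\<^sup>+x. (\<Sum>j<n. ennreal (\<rho> (nearest x) j) * h (\<theta> j, x)) \<partial>Q)"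
proof -
  note q = space_prob_algebraD[OF Q]
  interpret Q: prob_space Q by (rule q)
  let ?C = "count_space {..<n}"
  interpret C: sigma_finite_measure ?C by (rule sigma_finite_measure_count_space_finite) simp
  have snd_m: "snd \<in> Q \<Otimes>\<^sub>M ?C \<rightarrow>\<^sub>M ?C" and fst_m: "fst \<in> Q \<Otimes>\<^sub>M ?C \<rightarrow>\<^sub>M M"
    using q(1) by (auto simp: measurable_cong_sets[OF refl q(1)[symmetric]])
  have [measurable]: "(\<lambda>p. nearest (fst p)) \<in> Q \<Otimes>\<^sub>M ?C \<rightarrow>\<^sub>M count_space UNIV"
    by (rule measurable_compose[OF fst_m measurable_nearest])
  have [measurable]: "(\<lambda>p. ennreal (\<rho> (nearest (fst p)) (snd p))) \<in> borel_measurable (Q \<Otimes>\<^sub>M ?C)"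
  proof (rule measurable_compose_countable[where f="\<lambda>i p. ennreal (\<rho> i (snd p))" and g="\<lambda>p. nearest (fst p)"])
    show "(\<lambda>p. ennreal (\<rho> i (snd p))) \<in> borel_measurable (Q \<Otimes>\<^sub>M ?C)" for i
      by (rule measurable_compose[OF snd_m]) simp
  qed measurable
  have "(\<lambda>p. \<theta> (snd p)) \<in> Q \<Otimes>\<^sub>M ?C \<rightarrow>\<^sub>M M"
    by (rule measurable_compose[OF snd_m]) (auto simp: measurable_count_space_eq1 intro: atoms_in)
  then have [measurable]: "(\<lambda>p. (\<theta> (snd p), fst p)) \<in> Q \<Otimes>\<^sub>M ?C \<rightarrow>\<^sub>M M \<Otimes>\<^sub>M M"
    using fst_m by (intro measurable_Pair)
  have "(\<integral>\<^sup>+p. h p \<partial>atom_coupling Q \<rho>) = (\<integral>\<^sup>+p. ennreal (\<rho> (nearest (fst p)) (snd p)) * h (\<theta> (snd p), fst p) \<partial>(Q \<Otimes>\<^sub>M ?C))"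
    unfolding atom_coupling_def by (subst nn_integral_distr, simp, simp, subst nn_integral_density) auto
  also have "\<dots> = (\<integral>\<^sup>+x. \<integral>\<^sup>+j. ennreal (\<rho> (nearest x) j) * h (\<theta> j, x) \<partial>?C \<partial>Q)"
    by (subst C.nn_integral_fst[symmetric]) auto
  also have "\<dots> = (\<integral>\<^sup>+x. (\<Sum>j<n. ennreal (\<rho> (nearest x) j) * h (\<theta> j, x)) \<partial>Q)"
    by (simp add: nn_integral_count_space_finite)
  finally show ?thesis .
qed

text \<open>Unit row sums of \<open>\<rho>\<close> give the second marginal \<open>Q\<close>; the
  column sums weighted by the cell masses give the weights of \<open>G\<close>.\<close>

lemma atom_coupling_in_couplings:
  assumes G: "G \<in> probs M" and Q: "Q \<in> probs M"
    and G_eq: "\<And>A. A \<in> sets M \<Longrightarrow> measure G A = (\<Sum>i<n. \<beta> i * indicator A (\<theta> i))" and \<beta>: "\<And>i. i < n \<Longrightarrow> 0 \<le> \<beta> i"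
    and \<rho>: "\<And>i j. i < n \<Longrightarrow> j < n \<Longrightarrow> 0 \<le> \<rho> i j" "\<And>i. i < n \<Longrightarrow> (\<Sum>j<n. \<rho> i j) = 1"
      "\<And>j. j < n \<Longrightarrow> (\<Sum>i<n. measure Q (cell i) * \<rho> i j) = \<beta> j"
  shows "atom_coupling Q \<rho> \<in> couplings M G Q"
proof -
  note q = space_prob_algebraD[OF Q] and g = space_prob_algebraD[OF G]
  interpret Q: prob_space Q by (rule q)
  interpret G: prob_space G by (rule g)
  let ?\<kappa> = "atom_coupling Q \<rho>"
  have sets_\<kappa>: "sets ?\<kappa> = sets (M \<Otimes>\<^sub>M M)" by (simp add: atom_coupling_def)
  have space_\<kappa>: "space ?\<kappa> = space (M \<Otimes>\<^sub>M M)" by (simp add: atom_coupling_def)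
  have row: "(\<Sum>j<n. ennreal (\<rho> (nearest x) j)) = 1" for x
    using \<rho> nearest(1)[of x] by (subst sum_ennreal) auto
  have fst_m: "fst \<in> ?\<kappa> \<rightarrow>\<^sub>M M" and snd_m: "snd \<in> ?\<kappa> \<rightarrow>\<^sub>M M"
    unfolding measurable_cong_sets[OF sets_\<kappa> refl] by auto
  have "prob_space ?\<kappa>"
  proof
    have "emeasure ?\<kappa> (space ?\<kappa>) = (\<integral>\<^sup>+p. 1 \<partial>?\<kappa>)" by simp
    also have "\<dots> = (\<integral>\<^sup>+x. 1 \<partial>Q)"
      by (subst nn_integral_atom_coupling[OF Q]) (auto simp: row)
    finally show "emeasure ?\<kappa> (space ?\<kappa>) = 1" using Q.emeasure_space_1 by simp
  qed
  moreover have "distr ?\<kappa> M snd = Q"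
  proof (rule measure_eqI)
    fix A assume "A \<in> sets (distr ?\<kappa> M snd)"
    then have A [measurable]: "A \<in> sets M" by simp
    have "emeasure (distr ?\<kappa> M snd) A = (\<integral>\<^sup>+p. indicator A (snd p) \<partial>?\<kappa>)"
      using A by (subst nn_integral_indicator[symmetric], simp, subst nn_integral_distr[OF snd_m]) auto
    also have "\<dots> = (\<integral>\<^sup>+x. (\<Sum>j<n. ennreal (\<rho> (nearest x) j)) * indicator A x \<partial>Q)"
      by (subst nn_integral_atom_coupling[OF Q]) (auto simp: sum_distrib_right)
    finally show "emeasure (distr ?\<kappa> M snd) A = emeasure Q A"
      using A q by (simp add: row)
  qed (use q in simp)
  moreover have "distr ?\<kappa> M fst = G"
  proof (rule measure_eqI)
    fix A assume "A \<in> sets (distr ?\<kappa> M fst)"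
    then have A [measurable]: "A \<in> sets M" by simp
    have mn: "(\<lambda>x. ennreal (\<rho> (nearest x) j)) \<in> borel_measurable Q" for j
      unfolding measurable_cong_sets[OF q(1) refl] by (rule measurable_compose[OF measurable_nearest]) simp
    have "emeasure (distr ?\<kappa> M fst) A = (\<integral>\<^sup>+p. indicator A (fst p) \<partial>?\<kappa>)"
      using A by (subst nn_integral_indicator[symmetric], simp, subst nn_integral_distr[OF fst_m]) auto
    also have "\<dots> = (\<integral>\<^sup>+x. (\<Sum>j<n. ennreal (\<rho> (nearest x) j) * indicator A (\<theta> j)) \<partial>Q)"
      by (subst nn_integral_atom_coupling[OF Q]) auto
    also have "\<dots> = (\<Sum>j<n. (\<integral>\<^sup>+x. ennreal (\<rho> (nearest x) j) \<partial>Q) * indicator A (\<theta> j))"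
      using mn by (subst nn_integral_sum) (auto simp: nn_integral_multc)
    also have "\<dots> = (\<Sum>j<n. ennreal (\<beta> j * indicator A (\<theta> j)))"
      using \<rho> by (intro sum.cong) (auto simp: nn_integral_nearest[OF Q, of "\<lambda>i. \<rho> i _"] indicator_def)
    also have "\<dots> = ennreal (measure G A)"
      unfolding G_eq[OF A] using \<beta> by (intro sum_ennreal) auto
    finally show "emeasure (distr ?\<kappa> M fst) A = emeasure G A" by (simp add: G.emeasure_eq_measure)
  qed (use g in simp)
  ultimately show ?thesis
    using sets_\<kappa> by (simp add: couplings_def space_prob_algebra)
qed

text \<open>Mass paired with its own nearest atom pays \<open>spread\<close>. Any other transfer
  pays at most \<open>R powr r\<close>, and \<open>transport_matrix\<close> limits the amount of
  such mass to the total deficit.\<close>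

lemma wass_powr_le_spread_deficit:
  assumes G: "G \<in> probs M" and Q: "Q \<in> probs M"
    and G_eq: "\<And>A. A \<in> sets M \<Longrightarrow> measure G A = (\<Sum>i<n. \<beta> i * indicator A (\<theta> i))"
    and \<beta>: "\<And>i. i < n \<Longrightarrow> 0 \<le> \<beta> i" "(\<Sum>i<n. \<beta> i) = 1"
  shows "wass r M G Q powr r \<le> (\<integral>x. spread x \<partial>Q) + R powr r * (\<Sum>j<n. max 0 (\<beta> j - measure Q (cell j)))"
proof -
  note q = space_prob_algebraD[OF Q]
  interpret Q: prob_space Q by (rule q)
  define b where "b = (\<lambda>i. measure Q (cell i))"
  have b0: "0 \<le> b i" for i by (simp add: b_def)
  have b1: "(\<Sum>i<n. b i) = 1"
    using nn_integral_nearest[OF Q, of "\<lambda>_. 1"] Q.emeasure_space_1 by (simp add: b_def sum_nonneg)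
  obtain \<rho> where \<rho>: "\<And>i j. i < n \<Longrightarrow> j < n \<Longrightarrow> 0 \<le> \<rho> i j" "\<And>i. i < n \<Longrightarrow> (\<Sum>j<n. \<rho> i j) = 1"
      "\<And>j. j < n \<Longrightarrow> (\<Sum>i<n. b i * \<rho> i j) = \<beta> j" "(\<Sum>i<n. b i * (1 - \<rho> i i)) \<le> (\<Sum>j<n. max 0 (\<beta> j - b j))"
    using transport_matrix[OF b0 b1 \<beta>] by blast
  have diag: "\<rho> i i \<le> 1" if "i < n" for i
    using member_le_sum[of i "{..<n}" "\<rho> i"] \<rho>(1,2) that by simp
  let ?\<kappa> = "atom_coupling Q \<rho>"
  have \<kappa>: "?\<kappa> \<in> couplings M G Q"
    using \<rho> \<beta> G_eq by (intro atom_coupling_in_couplings[OF G Q]) (auto simp: b_def)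
  have "ennreal (\<integral>p. cost p \<partial>?\<kappa>) = (\<integral>\<^sup>+p. ennreal (cost p) \<partial>?\<kappa>)"
    using integrable_cost[OF \<kappa>] by (intro nn_integral_eq_integral[symmetric]) auto
  also have "\<dots> = (\<integral>\<^sup>+x. (\<Sum>j<n. ennreal (\<rho> (nearest x) j) * ennreal (cost (\<theta> j, x))) \<partial>Q)"
    by (rule nn_integral_atom_coupling[OF Q]) measurable
  also have "\<dots> \<le> (\<integral>\<^sup>+x. ennreal (spread x) + ennreal (R powr r * (1 - \<rho> (nearest x) (nearest x))) \<partial>Q)"
  proof (intro nn_integral_mono)
    fix x assume "x \<in> space Q"
    then have x: "x \<in> \<Theta>" using q by simp
    define i where "i = nearest x"
    have i: "i < n" using nearest(1) by (simp add: i_def)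
    have "(\<Sum>j<n. \<rho> i j * cost (\<theta> j, x)) = \<rho> i i * cost (\<theta> i, x) + (\<Sum>j\<in>{..<n} - {i}. \<rho> i j * cost (\<theta> j, x))"
      using i by (intro sum.remove) auto
    also have "\<dots> \<le> 1 * spread x + (\<Sum>j\<in>{..<n} - {i}. \<rho> i j * R powr r)"
    proof (intro add_mono sum_mono)
      show "\<rho> i i * cost (\<theta> i, x) \<le> 1 * spread x"
        using diag[OF i] by (intro mult_mono) (auto simp: cost_def spread_def i_def norm_minus_commute)
      show "\<rho> i j * cost (\<theta> j, x) \<le> \<rho> i j * R powr r" if "j \<in> {..<n} - {i}" for j
        using \<rho>(1) i that x powr_dist_le[OF atoms_in[of j] x] by (intro mult_left_mono) (auto simp: cost_def)
    qed
    also have "(\<Sum>j\<in>{..<n} - {i}. \<rho> i j * R powr r) = R powr r * (1 - \<rho> i i)"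
      using \<rho>(2)[OF i] i by (simp add: sum_distrib_right[symmetric] sum_diff1)
    finally have le: "(\<Sum>j<n. \<rho> i j * cost (\<theta> j, x)) \<le> spread x + R powr r * (1 - \<rho> i i)" by simp
    have "(\<Sum>j<n. ennreal (\<rho> i j) * ennreal (cost (\<theta> j, x))) = (\<Sum>j<n. ennreal (\<rho> i j * cost (\<theta> j, x)))"
      using \<rho>(1) i by (intro sum.cong) (auto simp: ennreal_mult)
    also have "\<dots> = ennreal (\<Sum>j<n. \<rho> i j * cost (\<theta> j, x))"
      using \<rho>(1) i by (intro sum_ennreal) auto
    also have "\<dots> \<le> ennreal (spread x + R powr r * (1 - \<rho> i i))"
      by (rule ennreal_leI[OF le])
    also have "\<dots> = ennreal (spread x) + ennreal (R powr r * (1 - \<rho> i i))"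
      using diag[OF i] by (intro ennreal_plus) auto
    finally show "(\<Sum>j<n. ennreal (\<rho> (nearest x) j) * ennreal (cost (\<theta> j, x)))
        \<le> ennreal (spread x) + ennreal (R powr r * (1 - \<rho> (nearest x) (nearest x)))"
      by (simp add: i_def)
  qed
  also have "\<dots> = (\<integral>\<^sup>+x. ennreal (spread x) \<partial>Q) + (\<integral>\<^sup>+x. ennreal (R powr r * (1 - \<rho> (nearest x) (nearest x))) \<partial>Q)"
  proof (rule nn_integral_add)
    show "(\<lambda>x. ennreal (spread x)) \<in> borel_measurable Q"
      unfolding measurable_cong_sets[OF q(1) refl] by measurable
    show "(\<lambda>x. ennreal (R powr r * (1 - \<rho> (nearest x) (nearest x)))) \<in> borel_measurable Q"
      unfolding measurable_cong_sets[OF q(1) refl] by (rule measurable_compose[OF measurable_nearest]) simp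
  qed
  also have "(\<integral>\<^sup>+x. ennreal (spread x) \<partial>Q) = ennreal (\<integral>x. spread x \<partial>Q)"
    using integrable_spread[OF Q] by (intro nn_integral_eq_integral) auto
  also have "(\<integral>\<^sup>+x. ennreal (R powr r * (1 - \<rho> (nearest x) (nearest x))) \<partial>Q) =
      ennreal (\<Sum>i<n. measure Q (cell i) * (R powr r * (1 - \<rho> i i)))"
    using diag by (intro nn_integral_nearest[OF Q]) auto
  also have "ennreal (\<integral>x. spread x \<partial>Q) + \<dots> = ennreal ((\<integral>x. spread x \<partial>Q) + (\<Sum>i<n. measure Q (cell i) * (R powr r * (1 - \<rho> i i))))"
    using diag by (intro ennreal_plus[symmetric] sum_nonneg integral_nonneg_AE) auto
  finally have "(\<integral>p. cost p \<partial>?\<kappa>) \<le> (\<integral>x. spread x \<partial>Q) + (\<Sum>i<n. measure Q (cell i) * (R powr r * (1 - \<rho> i i)))"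
    using diag by (subst (asm) ennreal_le_iff) (auto intro!: add_nonneg_nonneg sum_nonneg integral_nonneg_AE)
  also have "(\<Sum>i<n. measure Q (cell i) * (R powr r * (1 - \<rho> i i))) = R powr r * (\<Sum>i<n. b i * (1 - \<rho> i i))"
    by (simp add: sum_distrib_left b_def mult_ac)
  also have "\<dots> \<le> R powr r * (\<Sum>j<n. max 0 (\<beta> j - b j))"
    using \<rho>(4) by (intro mult_left_mono) auto
  finally show ?thesis
    using wass_powr_le[OF G Q \<kappa>] by (simp add: b_def)
qed

end

section \<open>Test sets\<close>

lemma integral_measure_dirichlet_measure:
  assumes G: "G \<in> probs M" and \<alpha>: "0 < \<alpha>" and A: "A \<in> sets M"
  shows "(\<integral>Q. measure Q A \<partial>dirichlet_measure M \<alpha> G) = measure G A"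
proof -
  let ?D = "dirichlet_measure M \<alpha> G"
  have sD: "sets ?D = sets (prob_algebra M)" by (rule sets_dirichlet_measure[OF G \<alpha>])
  have spD: "space ?D = probs M" using sD by (rule sets_eq_imp_space_eq)
  have "(\<lambda>Q. measure Q A) \<in> borel_measurable ?D"
    unfolding measurable_cong_sets[OF sD refl] using A by measurable
  then have "(\<integral>Q. measure Q A \<partial>?D) = enn2real (\<integral>\<^sup>+Q. ennreal (measure Q A) \<partial>?D)"
    by (intro integral_eq_nn_integral) auto
  also have "(\<integral>\<^sup>+Q. ennreal (measure Q A) \<partial>?D) = (\<integral>\<^sup>+Q. emeasure Q A \<partial>?D)"
    by (intro nn_integral_cong) (auto simp: spD space_prob_algebra prob_space_def finite_measure.emeasure_eq_measure)
  also have "\<dots> = emeasure G A" by (rule dirichlet_measure_mean[OF G \<alpha> A])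
  finally show ?thesis by (simp add: measure_def)
qed

context transport_atoms
begin

lemma measurable_spread_integral [measurable]: "(\<lambda>Q. \<integral>x. spread x \<partial>Q) \<in> borel_measurable (prob_algebra M)"
  unfolding prob_algebra_def by (intro measurable_restrict_space1 integral_measurable_subprob_algebra measurable_spread)

lemma spread_integral_bounds:
  assumes Q: "Q \<in> probs M"
  shows "0 \<le> (\<integral>x. spread x \<partial>Q)" "(\<integral>x. spread x \<partial>Q) \<le> R powr r"
proof -
  note q = space_prob_algebraD[OF Q]
  interpret Q: prob_space Q by (rule q)
  show "0 \<le> (\<integral>x. spread x \<partial>Q)" by (intro integral_nonneg_AE) auto
  have "(\<integral>x. spread x \<partial>Q) \<le> (\<integral>x. R powr r \<partial>Q)"
    using integrable_spread[OF Q] spread_le_R q by (intro integral_mono) auto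
  then show "(\<integral>x. spread x \<partial>Q) \<le> R powr r" by (simp add: Q.prob_space)
qed

lemma integral_spread_dirichlet_measure:
  assumes G: "G \<in> probs M" and \<alpha>: "0 < \<alpha>"
  shows "(\<integral>Q. (\<integral>x. spread x \<partial>Q) \<partial>dirichlet_measure M \<alpha> G) = (\<integral>x. spread x \<partial>G)"
proof -
  let ?D = "dirichlet_measure M \<alpha> G"
  have sD: "sets ?D = sets (prob_algebra M)" by (rule sets_dirichlet_measure[OF G \<alpha>])
  have spD: "space ?D = probs M" using sD by (rule sets_eq_imp_space_eq)
  have nn: "(\<integral>\<^sup>+x. ennreal (spread x) \<partial>Q) = ennreal (\<integral>x. spread x \<partial>Q)" if "Q \<in> probs M" for Q
    using integrable_spread[OF that] by (intro nn_integral_eq_integral) auto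
  have "(\<lambda>Q. \<integral>x. spread x \<partial>Q) \<in> borel_measurable ?D"
    unfolding measurable_cong_sets[OF sD refl] by measurable
  then have "(\<integral>Q. (\<integral>x. spread x \<partial>Q) \<partial>?D) = enn2real (\<integral>\<^sup>+Q. ennreal (\<integral>x. spread x \<partial>Q) \<partial>?D)"
    using spread_integral_bounds(1) by (intro integral_eq_nn_integral) (auto simp: spD)
  also have "(\<integral>\<^sup>+Q. ennreal (\<integral>x. spread x \<partial>Q) \<partial>?D) = (\<integral>\<^sup>+Q. (\<integral>\<^sup>+x. ennreal (spread x) \<partial>Q) \<partial>?D)"
    by (intro nn_integral_cong) (auto simp: spD nn)
  also have "\<dots> = (\<integral>\<^sup>+x. ennreal (spread x) \<partial>G)"
    by (rule nn_integral_dirichlet_measure_mean[OF G \<alpha>]) measurable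
  finally show ?thesis using spread_integral_bounds(1)[OF G] by (simp add: nn[OF G])
qed

lemma atom_gap:
  obtains m where "0 < m" "\<And>i j. i < n \<Longrightarrow> j < n \<Longrightarrow> i \<noteq> j \<Longrightarrow> m \<le> norm (\<theta> i - \<theta> j)"
proof
  \<comment> \<open>The element 1 keeps the minimum defined when there is a single atom.\<close>
  let ?S = "insert 1 ((\<lambda>(i, j). norm (\<theta> i - \<theta> j)) ` {(i, j). i < n \<and> j < n \<and> i \<noteq> j})"
  have "finite ({..<n} \<times> {..<n})" by simp
  then have fin: "finite {(i, j). i < n \<and> j < n \<and> i \<noteq> j}"
    by (rule rev_finite_subset) auto
  have "Min ?S \<in> ?S" using fin by (intro Min_in) auto
  then show "0 < Min ?S" using inj by (auto simp: inj_on_def)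
  show "Min ?S \<le> norm (\<theta> i - \<theta> j)" if "i < n" "j < n" "i \<noteq> j" for i j
    using fin that by (intro Min_le) auto
qed

context
  fixes G :: "'a measure" and \<beta> :: "nat \<Rightarrow> real" and \<alpha> :: real
  assumes G: "G \<in> probs M"
    and G_eq: "\<And>A. A \<in> sets M \<Longrightarrow> measure G A = (\<Sum>i<n. \<beta> i * indicator A (\<theta> i))"
    and \<beta>_pos: "\<And>i. i < n \<Longrightarrow> 0 < \<beta> i" and \<beta>_sum: "(\<Sum>i<n. \<beta> i) = 1"
    and \<alpha>: "0 < \<alpha>" "\<alpha> \<le> 1"
begin

abbreviation "DG \<equiv> dirichlet_measure M \<alpha> G"

lemma sets_DG: "sets DG = sets (prob_algebra M)"
  and space_DG: "space DG = probs M"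
  and prob_space_DG: "prob_space DG"
  using sets_dirichlet_measure[OF G \<alpha>(1)] sets_eq_imp_space_eq[OF sets_dirichlet_measure[OF G \<alpha>(1)]]
    prob_space_dirichlet_measure[OF G \<alpha>(1)] by auto

lemma measure_G_atoms: "measure G atoms = 1"
proof -
  have "(\<Sum>i<n. \<beta> i * indicator atoms (\<theta> i)) = (\<Sum>i<n. \<beta> i)"
    by (intro sum.cong) (auto simp: atoms_def)
  then show ?thesis using G_eq[OF sets_atoms] \<beta>_sum by simp
qed

lemma measure_G_cell: "j < n \<Longrightarrow> measure G (cell j) = \<beta> j"
proof -
  assume j: "j < n"
  have "measure G (cell j) = (\<Sum>i<n. if i = j then \<beta> j else 0)"
    unfolding G_eq[OF sets_cell] using atoms_in nearest_atom
    by (intro sum.cong) (auto simp: cell_def indicator_def)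
  then show ?thesis using j by simp
qed

definition off_atoms :: "'a measure set" where
  "off_atoms = {Q \<in> probs M. measure Q atoms \<noteq> 1}"

lemma sets_off_atoms: "off_atoms \<in> sets (prob_algebra M)"
  unfolding off_atoms_def by measurable

lemma measure_off_atoms: "measure DG off_atoms = 0"
proof -
  have "AE Q in DG. Q \<notin> off_atoms"
    using AE_dirichlet_measure_support[OF G \<alpha>(1) sets_atoms measure_G_atoms]
    by eventually_elim (simp add: off_atoms_def)
  then have "emeasure DG off_atoms = 0"
    using sets_off_atoms
    by (subst (asm) AE_iff_measurable[of off_atoms]) (auto simp: sets_DG space_DG off_atoms_def)
  then show ?thesis by (simp add: measure_def)
qed

text \<open>The threshold is half the mean \<open>\<mu>\<close> of the spread integral under the
  competitor. The integral never exceeds \<open>R powr r\<close>, so it passes the threshold with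
  probability at least \<open>\<mu> / (2 * R powr r)\<close>, whereas under \<open>DG\<close> it
  vanishes almost surely. A measure on the atoms within \<open>W / 4\<close> of some
  \<open>Q\<close> forces the integral at \<open>Q\<close> down to
  \<open>W powr r / 4 \<le> \<mu> / 2\<close>, so it is not near the test set.\<close>

lemma spread_test_set:
  assumes G': "G' \<in> probs M" and \<alpha>': "0 < \<alpha>'" and W: "0 < wass r M G G'"
    and large: "wass r M G G' powr r / 2 \<le> (\<integral>x. spread x \<partial>G')"
  shows "\<exists>\<B>\<in>sets (prob_algebra M).
    wass r M G G' powr r / (4 * R powr r) \<le> measure (dirichlet_measure M \<alpha>' G') \<B> - measure DG \<B> \<and>
    (\<forall>\<delta>>0. \<delta> \<le> wass r M G G' / 4 \<longrightarrow> enlarge r M \<B> \<delta> - \<B> \<subseteq> off_atoms)"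
proof -
  define W where "W = wass r M G G'"
  define \<mu> where "\<mu> = (\<integral>x. spread x \<partial>G')"
  let ?F = "\<lambda>Q. \<integral>x. spread x \<partial>Q"
  let ?D' = "dirichlet_measure M \<alpha>' G'"
  define \<B> where "\<B> = {Q \<in> probs M. \<mu> / 2 < ?F Q}"
  have W0: "0 < W" and \<mu>: "W powr r / 2 \<le> \<mu>" using W large by (auto simp: W_def \<mu>_def)
  then have \<mu>0: "0 < \<mu>" by (smt (verit) powr_gt_zero half_gt_zero)
  have Rr: "0 < R powr r" using R_pos by simp
  have \<B> [measurable]: "\<B> \<in> sets (prob_algebra M)" unfolding \<B>_def by measurable
  interpret DG: prob_space DG by (rule prob_space_DG)
  interpret D': prob_space ?D' by (rule prob_space_dirichlet_measure[OF G' \<alpha>'])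
  have sD': "sets ?D' = sets (prob_algebra M)" by (rule sets_dirichlet_measure[OF G' \<alpha>'])
  have spD': "space ?D' = probs M" using sD' by (rule sets_eq_imp_space_eq)
  have zero: "?F Q = 0" if Q: "Q \<in> probs M" "measure Q atoms = 1" for Q
  proof -
    note q = space_prob_algebraD[OF Q(1)]
    interpret Q: prob_space Q by (rule q)
    have "AE x in Q. x \<in> atoms" using Q(2) q sets_atoms by (intro Q.AE_prob_1) auto
    then have "AE x in Q. spread x = 0"
      by eventually_elim (auto simp: atoms_def spread_def nearest_atom)
    then show ?thesis by (simp add: integral_eq_zero_AE)
  qed
  have "\<B> \<subseteq> off_atoms"
    using zero \<mu>0 by (auto simp: \<B>_def off_atoms_def)
  then have "measure DG \<B> \<le> measure DG off_atoms"
    using sets_off_atoms by (intro DG.finite_measure_mono) (auto simp: sets_DG)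
  then have DB: "measure DG \<B> = 0" using measure_off_atoms measure_nonneg[of DG \<B>] by linarith
  have "\<mu> = (\<integral>Q. ?F Q \<partial>?D')"
    unfolding \<mu>_def by (rule integral_spread_dirichlet_measure[OF G' \<alpha>', symmetric])
  also have "\<dots> \<le> (\<integral>Q. \<mu> / 2 + R powr r * indicator \<B> Q \<partial>?D')"
  proof (rule integral_mono)
    have "?F \<in> borel_measurable ?D'" unfolding measurable_cong_sets[OF sD' refl] by measurable
    then show "integrable ?D' ?F"
      using spread_integral_bounds by (intro D'.integrable_const_bound[where B="R powr r"]) (auto simp: spD')
    show "integrable ?D' (\<lambda>Q. \<mu> / 2 + R powr r * indicator \<B> Q)"
      using \<B> sD' by (intro Bochner_Integration.integrable_add integrable_mult_right integrable_real_indicator) (auto simp: D'.emeasure_eq_measure)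
    show "?F Q \<le> \<mu> / 2 + R powr r * indicator \<B> Q" if "Q \<in> space ?D'" for Q
      using that spread_integral_bounds(2)[of Q] \<mu>0 by (auto simp: spD' \<B>_def indicator_def)
  qed
  also have "\<dots> = \<mu> / 2 + R powr r * measure ?D' \<B>"
  proof -
    have "integrable ?D' (indicator \<B> :: _ \<Rightarrow> real)"
      using \<B> sD' by (intro integrable_real_indicator) (auto simp: D'.emeasure_eq_measure)
    moreover have "\<B> \<inter> space ?D' = \<B>" by (auto simp: \<B>_def spD')
    ultimately show ?thesis by (simp add: D'.prob_space)
  qed
  finally have "W powr r / 4 \<le> R powr r * measure ?D' \<B>" using \<mu> by simp
  then have "W powr r / (4 * R powr r) \<le> measure ?D' \<B> - measure DG \<B>"
    using Rr by (simp add: DB field_simps)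
  moreover have "enlarge r M \<B> \<delta> - \<B> \<subseteq> off_atoms" if \<delta>: "0 < \<delta>" "\<delta> \<le> W / 4" for \<delta>
  proof
    fix P assume P: "P \<in> enlarge r M \<B> \<delta> - \<B>"
    then obtain Q where Q: "Q \<in> \<B>" "wass r M Q P \<le> \<delta>" and PM: "P \<in> probs M"
      by (auto simp: enlarge_def)
    have QM: "Q \<in> probs M" using Q by (simp add: \<B>_def)
    show "P \<in> off_atoms"
    proof (rule ccontr)
      assume "P \<notin> off_atoms"
      then have "measure P atoms = 1" using PM by (simp add: off_atoms_def)
      then have "?F Q \<le> wass r M Q P powr r" by (rule spread_integral_le_wass[OF QM PM])
      also have "\<dots> \<le> (W / 4) powr r"
        using Q(2) \<delta> wass_nonneg[of Q P] r_ge_1 by (intro powr_mono2) auto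
      also have "\<dots> = W powr r * (1 / 4) powr r"
        using W0 by (simp add: powr_mult[symmetric])
      also have "\<dots> \<le> W powr r * (1 / 4) powr 1"
        using r_ge_1 by (intro mult_left_mono powr_mono') auto
      also have "\<dots> \<le> \<mu> / 2" using \<mu> by simp
      finally show False using Q by (simp add: \<B>_def)
    qed
  qed
  ultimately show ?thesis using \<B> unfolding W_def by blast
qed

text \<open>The mean mass of the cell is \<open>\<beta> j\<close> under \<open>DG\<close> and lower
  by at least \<open>d\<close> under the competitor, so at some level \<open>t\<close> the
  distribution functions are \<open>d / 2\<close> apart. A nearby measure on the atoms exceeds this
  level by no more than the mass that the distance allows to cross between cells.\<close>

lemma cell_test_set:
  assumes G': "G' \<in> probs M" and \<alpha>': "0 < \<alpha>'"
    and j: "j < n" and d: "0 < d" "measure G' (cell j) + d \<le> \<beta> j"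
    and m: "0 < m" "\<And>i j. i < n \<Longrightarrow> j < n \<Longrightarrow> i \<noteq> j \<Longrightarrow> m \<le> norm (\<theta> i - \<theta> j)"
  shows "\<exists>\<B>\<in>sets (prob_algebra M). d / 2 \<le> measure (dirichlet_measure M \<alpha>' G') \<B> - measure DG \<B> \<and>
    (\<exists>t. \<forall>\<delta>>0. enlarge r M \<B> \<delta> - \<B> \<subseteq>
      off_atoms \<union> mass_between M (cell j) t ((2 * \<delta> / m) powr r))"
proof -
  let ?D' = "dirichlet_measure M \<alpha>' G'"
  have sD': "sets ?D' = sets (prob_algebra M)" by (rule sets_dirichlet_measure[OF G' \<alpha>'])
  have spD': "space ?D' = probs M" using sD' by (rule sets_eq_imp_space_eq)
  have meas: "(\<lambda>Q. measure Q (cell j)) \<in> borel_measurable (prob_algebra M)" by measurable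
  have bounds: "0 \<le> measure Q (cell j) \<and> measure Q (cell j) \<le> 1" if "Q \<in> probs M" for Q
    using space_prob_algebraD(3)[OF that] by (simp add: prob_space.prob_le_1)
  have "\<exists>t. measure DG {Q \<in> space DG. measure Q (cell j) \<le> t} + d / 2 \<le> measure ?D' {Q \<in> space ?D'. measure Q (cell j) \<le> t}"
  proof (rule exists_cdf_gap)
    show "(\<integral>Q. measure Q (cell j) \<partial>?D') + d \<le> (\<integral>Q. measure Q (cell j) \<partial>DG)"
      using d j by (simp add: integral_measure_dirichlet_measure[OF G' \<alpha>' sets_cell]
          integral_measure_dirichlet_measure[OF G \<alpha>(1) sets_cell] measure_G_cell)
  qed (use d prob_space_DG prob_space_dirichlet_measure[OF G' \<alpha>'] meas bounds in
      \<open>auto simp: measurable_cong_sets[OF sets_DG refl] measurable_cong_sets[OF sD' refl] space_DG spD'\<close>)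
  then obtain t where t: "measure DG {Q \<in> space DG. measure Q (cell j) \<le> t} + d / 2 \<le> measure ?D' {Q \<in> space ?D'. measure Q (cell j) \<le> t}"
    by auto
  define \<B> where "\<B> = {Q \<in> probs M. measure Q (cell j) \<le> t}"
  have \<B>: "\<B> \<in> sets (prob_algebra M)" unfolding \<B>_def by measurable
  have "d / 2 \<le> measure ?D' \<B> - measure DG \<B>" using t by (simp add: \<B>_def space_DG spD')
  moreover have "enlarge r M \<B> \<delta> - \<B> \<subseteq>
      off_atoms \<union> mass_between M (cell j) t ((2 * \<delta> / m) powr r)"
    if \<delta>: "0 < \<delta>" for \<delta>
  proof
    fix P assume P: "P \<in> enlarge r M \<B> \<delta> - \<B>"
    then obtain Q where Q: "Q \<in> \<B>" "wass r M Q P \<le> \<delta>" and PM: "P \<in> probs M"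
      by (auto simp: enlarge_def)
    have QM: "Q \<in> probs M" using Q by (simp add: \<B>_def)
    show "P \<in> off_atoms \<union> mass_between M (cell j) t ((2 * \<delta> / m) powr r)"
    proof (cases "measure P atoms = 1")
      case True
      have "measure P (cell j) \<le> measure Q (cell j) + (2 / m) powr r * wass r M Q P powr r"
        by (rule cell_measure_le_wass[OF QM PM True m])
      also have "\<dots> \<le> t + (2 / m) powr r * \<delta> powr r"
        using Q wass_nonneg[of Q P] r_ge_1 by (intro add_mono mult_left_mono powr_mono2) (auto simp: \<B>_def)
      also have "(2 / m) powr r * \<delta> powr r = (2 * \<delta> / m) powr r"
        using m \<delta> by (simp add: powr_mult[symmetric])
      finally show ?thesis using P PM by (auto simp: \<B>_def)
    qed (use PM in \<open>simp add: off_atoms_def\<close>)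
  qed
  ultimately show ?thesis using \<B> by blast
qed

text \<open>A second atom \<open>i\<close> gives \<open>1 - \<beta> j \<ge> \<beta> i\<close>, so
  both Beta parameters of the cell mass are at least \<open>b\<close>. Adding up the constants of
  the finitely many cells yields one that serves all of them.\<close>

lemma cell_interval_bound:
  assumes b: "0 < b" "\<And>i. i < n \<Longrightarrow> b \<le> \<alpha> * \<beta> i" and n: "2 \<le> n"
  obtains C where "0 < C" "\<And>j t s. j < n \<Longrightarrow> 0 < s \<Longrightarrow>
    measure DG (mass_between M (cell j) t s) \<le> C * s powr b"
proof -
  define good where "good = (\<lambda>j C. 0 < C \<and> (\<forall>t. \<forall>s>0. measure DG
    (mass_between M (cell j) t s) \<le> C * s powr b))"
  have "\<exists>C. good j C" if j: "j < n" for j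
    unfolding good_def
  proof (rule dirichlet_measure_interval_le[OF G \<alpha> sets_cell b(1)])
    show "b \<le> \<alpha> * measure G (cell j)" using b(2)[OF j] by (simp add: measure_G_cell[OF j])
    define i :: nat where "i = (if j = 0 then 1 else 0)"
    have i: "i < n" "i \<noteq> j" using n by (auto simp: i_def)
    have "\<beta> i + \<beta> j = (\<Sum>l\<in>{i, j}. \<beta> l)" using i by simp
    also have "\<dots> \<le> (\<Sum>l<n. \<beta> l)"
      using i j \<beta>_pos by (intro sum_mono2) (auto intro: less_imp_le)
    finally have "\<beta> i \<le> 1 - \<beta> j" using \<beta>_sum by simp
    then have "\<alpha> * \<beta> i \<le> \<alpha> * (1 - \<beta> j)" using \<alpha> by (intro mult_left_mono) auto
    then show "b \<le> \<alpha> * (1 - measure G (cell j))" using b(2)[OF i(1)] by (simp add: measure_G_cell[OF j])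
  qed
  then have good_some: "good j (SOME C. good j C)" if "j < n" for j
    by (rule someI_ex[OF _]) (rule that)
  define C where "C = (\<lambda>j. SOME C. good j C)"
  have "good j (C j)" if "j < n" for j
    unfolding C_def by (rule good_some[OF that])
  then have C: "\<And>j. j < n \<Longrightarrow> 0 < C j" "\<And>j t s. j < n \<Longrightarrow> 0 < s \<Longrightarrow>
    measure DG (mass_between M (cell j) t s) \<le> C j * s powr b"
    unfolding good_def by simp_all
  show thesis
  proof (rule that[of "\<Sum>j<n. C j"])
    show "0 < (\<Sum>j<n. C j)" using C(1) n by (intro sum_pos) (auto simp: lessThan_empty_iff)
    fix j t and s :: real assume j: "j < n" and s: "0 < s"
    have "C j \<le> (\<Sum>j<n. C j)" using C(1) j by (intro member_le_sum) (auto intro: less_imp_le)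
    then have "C j * s powr b \<le> (\<Sum>j<n. C j) * s powr b" by (intro mult_right_mono) auto
    then show "measure DG (mass_between M (cell j) t s) \<le> (\<Sum>j<n. C j) * s powr b"
      using C(2)[OF j s, of t] by linarith
  qed
qed

text \<open>\<open>b\<close> is any positive lower bound of the \<open>\<alpha> * \<beta> i\<close>
  and not their minimum, so that it survives the merging of coinciding atoms. The constant
  \<open>1 / 4\<close> limiting \<open>\<delta>\<close> comes from the spread test set.\<close>

lemma regular_boundary_atoms:
  assumes b: "0 < b" "\<And>i. i < n \<Longrightarrow> b \<le> \<alpha> * \<beta> i" and \<alpha>0: "0 < \<alpha>0"
  shows "regular_boundary r M (b * r) \<alpha> G {(\<alpha>', G'). G' \<in> probs M \<and> \<alpha>' \<in> {\<alpha>0..\<alpha>1}}"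
proof -
  obtain m where m: "0 < m" "\<And>i j. i < n \<Longrightarrow> j < n \<Longrightarrow> i \<noteq> j \<Longrightarrow> m \<le> norm (\<theta> i - \<theta> j)"
    using atom_gap by blast
  \<comment> \<open>With a single atom the claim is vacuous and 1 serves as the constant.\<close>
  obtain C where C: "0 < C" "\<And>j t s. 2 \<le> n \<Longrightarrow> j < n \<Longrightarrow> 0 < s \<Longrightarrow>
    measure DG (mass_between M (cell j) t s) \<le> C * s powr b"
  proof (cases "2 \<le> n")
    case True
    show thesis by (rule cell_interval_bound[OF b True]) (use that in auto)
  qed (use that[of 1] in simp)
  interpret DG: prob_space DG by (rule prob_space_DG)
  \<comment> \<open>This covers the gains of both cases: \<open>W powr r / (4 * R powr r)\<close>
    from the spread, and \<open>e / 2\<close> from a cell, where \<open>e\<close> is a further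
    factor \<open>n\<close> smaller.\<close>
  define c0 where "c0 = 1 / (4 * real n * R powr r)"
  \<comment> \<open>This is the interval bound at length \<open>(2 * \<delta> / m) powr r\<close>,
    after \<open>\<delta>\<close> is estimated by \<open>R * (\<delta> / W)\<close>.\<close>
  define C0 where "C0 = C * (2 * R / m) powr (b * r)"
  have Rr: "0 < R powr r" using R_pos by simp
  have c0: "0 < c0" using n_pos Rr by (simp add: c0_def)
  have C0: "0 < C0" using C m R_pos by (simp add: C0_def)
  have core: "\<exists>\<B>\<in>sets (prob_algebra M).
      c0 * wass r M G G' powr r \<le> measure (dirichlet_measure M \<alpha>' G') \<B> - measure DG \<B> \<and>
      (\<forall>\<delta>>0. \<delta> \<le> (1 / 4) * wass r M G G' \<longrightarrow> (\<exists>S\<in>sets (prob_algebra M). enlarge r M \<B> \<delta> - \<B> \<subseteq> S \<and>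
        measure DG S \<le> C0 * (\<delta> / wass r M G G') powr (b * r)))"
    if G': "G' \<in> probs M" and "\<alpha>0 \<le> \<alpha>'" for \<alpha>' G'
  proof -
    have \<alpha>': "0 < \<alpha>'" using \<open>\<alpha>0 \<le> \<alpha>'\<close> \<alpha>0 by simp
    define W where "W = wass r M G G'"
    have W0: "0 \<le> W" by (simp add: W_def wass_nonneg)
    show ?thesis
    proof (cases "W = 0")
      \<comment> \<open>At distance zero the empty set serves: the required gain is zero and no
        positive \<open>\<delta>\<close> is admissible.\<close>
      case True
      show ?thesis
        unfolding W_def[symmetric] True by (intro bexI[of _ "{}"]) auto
    next
      case False
      then have Wpos: "0 < W" using W0 by simp
      show ?thesis
      proof (cases "W powr r / 2 \<le> (\<integral>x. spread x \<partial>G')")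
        case True
        obtain \<B> where \<B>: "\<B> \<in> sets (prob_algebra M)"
          "W powr r / (4 * R powr r) \<le> measure (dirichlet_measure M \<alpha>' G') \<B> - measure DG \<B>"
          "\<And>\<delta>. 0 < \<delta> \<Longrightarrow> \<delta> \<le> W / 4 \<Longrightarrow> enlarge r M \<B> \<delta> - \<B> \<subseteq> off_atoms"
          using spread_test_set[OF G' \<alpha>'] True Wpos unfolding W_def by blast
        have "c0 * W powr r \<le> W powr r / (4 * R powr r)"
        proof -
          have "4 * R powr r \<le> 4 * real n * R powr r"
            using n_pos Rr mult_right_mono[of 1 "real n" "R powr r"] by simp
          then show ?thesis using Rr unfolding c0_def by (simp add: frac_le)
        qed
        moreover have "measure DG off_atoms \<le> C0 * (\<delta> / W) powr (b * r)" for \<delta>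
          using C0 by (simp add: measure_off_atoms)
        ultimately show ?thesis
          using \<B> sets_off_atoms unfolding W_def[symmetric]
          by (intro bexI[OF _ \<B>(1)] conjI allI impI bexI[OF _ sets_off_atoms]) auto
      next
        case False
        \<comment> \<open>Pigeonhole: a total deficit above
          \<open>W powr r / (2 * R powr r)\<close>, spread over \<open>n\<close> cells, leaves some
          cell with a deficit of at least \<open>e\<close>.\<close>
        define e where "e = W powr r / (2 * real n * R powr r)"
        have e0: "0 < e" using Wpos Rr n_pos by (simp add: e_def)
        have "W powr r \<le> (\<integral>x. spread x \<partial>G') + R powr r * (\<Sum>j<n. max 0 (\<beta> j - measure G' (cell j)))"
          unfolding W_def using \<beta>_pos \<beta>_sum
          by (intro wass_powr_le_spread_deficit[OF G G' G_eq]) (auto intro: less_imp_le)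
        with False have big: "W powr r / 2 < R powr r * (\<Sum>j<n. max 0 (\<beta> j - measure G' (cell j)))" by simp
        have "\<exists>j<n. e \<le> max 0 (\<beta> j - measure G' (cell j))"
        proof (rule ccontr)
          assume "\<not> ?thesis"
          then have "max 0 (\<beta> j - measure G' (cell j)) \<le> e" if "j < n" for j
            using that by (auto simp: not_le intro: less_imp_le)
          then have "(\<Sum>j<n. max 0 (\<beta> j - measure G' (cell j))) \<le> (\<Sum>j<n. e)" by (intro sum_mono) auto
          then have "R powr r * (\<Sum>j<n. max 0 (\<beta> j - measure G' (cell j))) \<le> R powr r * (real n * e)"
            using Rr by (intro mult_left_mono) auto
          also have "\<dots> = W powr r / 2" using Rr n_pos by (simp add: e_def)
          finally show False using big by simp
        qed
        then obtain j where j: "j < n" "e \<le> max 0 (\<beta> j - measure G' (cell j))" by auto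
        have je: "measure G' (cell j) + e \<le> \<beta> j" using j(2) e0 by linarith
        \<comment> \<open>A single cell is all of \<open>\<Theta>\<close> and has no
          deficit.\<close>
        have n2: "2 \<le> n"
        proof (rule ccontr)
          assume "\<not> 2 \<le> n"
          then have "n = 1" using n_pos by simp
          then have "j = 0" and "nearest x = 0" for x
            using j(1) nearest(1)[of x] by linarith+
          then have "cell j = \<Theta>" by (auto simp: cell_def)
          moreover have "\<beta> j = 1" using \<beta>_sum \<open>n = 1\<close> \<open>j = 0\<close> by simp
          moreover have "measure G' \<Theta> = 1"
            using space_prob_algebraD[OF G'] prob_space.prob_space[of G'] by simp
          ultimately show False using je e0 by simp
        qed
        obtain \<B> t where \<B>: "\<B> \<in> sets (prob_algebra M)"
          "e / 2 \<le> measure (dirichlet_measure M \<alpha>' G') \<B> - measure DG \<B>"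
          "\<And>\<delta>. 0 < \<delta> \<Longrightarrow> enlarge r M \<B> \<delta> - \<B> \<subseteq>
            off_atoms \<union> mass_between M (cell j) t ((2 * \<delta> / m) powr r)"
          using cell_test_set[OF G' \<alpha>' j(1) e0 je m] by blast
        define I where "I = (\<lambda>\<delta>. (mass_between M (cell j) t ((2 * \<delta> / m) powr r)))"
        have I: "I \<delta> \<in> sets (prob_algebra M)" for \<delta>
          unfolding I_def by measurable
        have gain: "c0 * W powr r \<le> e / 2" by (simp add: c0_def e_def)
        have loss: "measure DG (off_atoms \<union> I \<delta>) \<le> C0 * (\<delta> / W) powr (b * r)" if \<delta>: "0 < \<delta>" for \<delta>
        proof -
          have "measure DG (off_atoms \<union> I \<delta>) \<le> measure DG off_atoms + measure DG (I \<delta>)"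
            using I sets_off_atoms by (intro measure_Un_le) (auto simp: sets_DG)
          also have "\<dots> = measure DG (I \<delta>)" by (simp add: measure_off_atoms)
          also have "\<dots> \<le> C * ((2 * \<delta> / m) powr r) powr b"
            unfolding I_def using \<delta> m by (intro C(2)[OF n2 j(1)]) simp
          also have "((2 * \<delta> / m) powr r) powr b = (2 * \<delta> / m) powr (b * r)"
            by (simp add: powr_powr mult.commute)
          \<comment> \<open>\<open>W \<le> R\<close> replaces the absolute \<open>\<delta>\<close>
            by the relative \<open>\<delta> / W\<close>, at the price of the factor
            \<open>R\<close>.\<close>
          also have "\<dots> \<le> ((2 * R / m) * (\<delta> / W)) powr (b * r)"
          proof (intro powr_mono2)
            have "2 * \<delta> / m * W \<le> 2 * \<delta> / m * R"
              using wass_le[OF G G'] \<delta> m by (intro mult_left_mono) (auto simp: W_def)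
            then have "2 * \<delta> / m * W / W \<le> 2 * \<delta> / m * R / W"
              using W0 by (rule divide_right_mono)
            then show "2 * \<delta> / m \<le> (2 * R / m) * (\<delta> / W)"
              using Wpos by (simp add: mult_ac)
          qed (use b r_ge_1 \<delta> m in auto)
          also have "\<dots> = (2 * R / m) powr (b * r) * (\<delta> / W) powr (b * r)"
            by (rule powr_mult)
          finally show ?thesis using C(1) by (simp add: C0_def mult.assoc)
        qed
        show ?thesis
          unfolding W_def[symmetric]
        proof (rule bexI[OF _ \<B>(1)], intro conjI allI impI)
          show "c0 * W powr r \<le> measure (dirichlet_measure M \<alpha>' G') \<B> - measure DG \<B>"
            using gain \<B>(2) by linarith
          fix \<delta> :: real assume "0 < \<delta>"
          then show "\<exists>S\<in>sets (prob_algebra M). enlarge r M \<B> \<delta> - \<B> \<subseteq> S \<and> measure DG S \<le> C0 * (\<delta> / W) powr (b * r)"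
            using \<B>(3)[of \<delta>] loss[of \<delta>] sets_off_atoms I
            by (intro bexI[of _ "off_atoms \<union> I \<delta>"]) (auto simp: I_def)
        qed
      qed
    qed
  qed
  show ?thesis
    unfolding regular_boundary_def
    by (intro exI[of _ C0] exI[of _ c0] exI[of _ "1 / 4"] conjI C0 c0) (use core in auto)
qed

end

end

section \<open>Reduction to distinct atoms\<close>

theorem theorem3:
  fixes \<Theta> :: "'a::euclidean_space set"
    and r \<alpha> \<alpha>0 \<alpha>1 :: real and k :: nat
    and \<beta> :: "nat \<Rightarrow> real" and \<theta> :: "nat \<Rightarrow> 'a" and G :: "'a measure"
  defines "M \<equiv> restrict_space borel \<Theta>"
  assumes "r \<ge> 1"
    and "bounded \<Theta>"
    and "k \<ge> 1"
    and "\<forall>i<k. \<beta> i > 0" and "(\<Sum>i<k. \<beta> i) = 1" and "\<forall>i<k. \<theta> i \<in> \<Theta>"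
    and "G \<in> space (prob_algebra M)"
    and "\<forall>A \<in> sets M. measure G A = (\<Sum>i<k. \<beta> i * indicator A (\<theta> i))"
    and "0 < \<alpha>" and "\<alpha> \<le> 1"
    and "0 < \<alpha>0" and "\<alpha>0 < \<alpha>1"
  shows "regular_boundary r M (Min ((\<lambda>i. \<alpha> * \<beta> i) ` {..<k}) * r) \<alpha> G
           {(\<alpha>', G'). G' \<in> space (prob_algebra M) \<and> \<alpha>' \<in> {\<alpha>0..\<alpha>1}}"
proof -
  obtain R0 where R0: "\<And>x. x \<in> \<Theta> \<Longrightarrow> norm x \<le> R0"
    using \<open>bounded \<Theta>\<close> by (auto simp: bounded_iff)
  \<comment> \<open>The summand 1 keeps the diameter bound positive even for a one-point
    \<open>\<Theta>\<close>.\<close>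
  define R where "R = 2 * \<bar>R0\<bar> + 1"
  have diam: "norm (x - y) \<le> R" if "x \<in> \<Theta>" "y \<in> \<Theta>" for x y
    using norm_triangle_ineq4[of x y] R0[OF that(1)] R0[OF that(2)] by (simp add: R_def)
  \<comment> \<open>The given \<open>\<theta> i\<close> may coincide, whereas the cells and the
    minimal gap call for distinct atoms. The distinct ones are enumerated by \<open>e\<close>, with
    the weights of coinciding ones added up in \<open>\<gamma>\<close>.\<close>
  define A where "A = \<theta> ` {..<k}"
  define n where "n = card A"
  have A: "finite A" "A \<noteq> {}" using \<open>k \<ge> 1\<close> by (auto simp: A_def lessThan_empty_iff)
  obtain e where "bij_betw e {0..<card A} A"
    using ex_bij_betw_nat_finite[OF A(1)] by auto
  then have e: "bij_betw e {..<n} A" by (simp add: n_def atLeast0LessThan)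
  define \<gamma> where "\<gamma> = (\<lambda>i. \<Sum>l\<in>{l \<in> {..<k}. \<theta> l = e i}. \<beta> l)"
  interpret transport_atoms \<Theta> r R e n
  proof
    show "0 < n" using A by (simp add: n_def card_gt_0_iff)
    show "e i \<in> \<Theta>" if "i < n" for i
    proof -
      have "e i \<in> A" using bij_betwE[OF e] that by simp
      then show ?thesis using \<open>\<forall>i<k. \<theta> i \<in> \<Theta>\<close> by (auto simp: A_def)
    qed
    show "inj_on e {..<n}" using e by (simp add: bij_betw_def)
  qed (use \<open>r \<ge> 1\<close> diam in \<open>auto simp: R_def\<close>)
  have merge: "(\<Sum>i<n. \<gamma> i * f (e i)) = (\<Sum>l<k. \<beta> l * f (\<theta> l))" for f :: "'a \<Rightarrow> real"
  proof -
    have "(\<Sum>l<k. \<beta> l * f (\<theta> l)) = (\<Sum>a\<in>A. \<Sum>l\<in>{l \<in> {..<k}. \<theta> l = a}. \<beta> l * f (\<theta> l))"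
      unfolding A_def by (rule sum.image_gen) simp
    also have "\<dots> = (\<Sum>a\<in>A. (\<Sum>l\<in>{l \<in> {..<k}. \<theta> l = a}. \<beta> l) * f a)"
      by (simp add: sum_distrib_right)
    also have "\<dots> = (\<Sum>i<n. \<gamma> i * f (e i))"
      unfolding \<gamma>_def by (rule sum.reindex_bij_betw[OF e, symmetric])
    finally show ?thesis ..
  qed
  \<comment> \<open>Merging only increases weights, so the minimum over the original weights remains
    a lower bound for the merged ones.\<close>
  have heavy: "\<exists>l<k. \<beta> l \<le> \<gamma> i" if "i < n" for i
  proof -
    have "e i \<in> A" using e that by (auto simp: bij_betw_def)
    then obtain l where l: "l < k" "\<theta> l = e i" by (auto simp: A_def)
    have "\<beta> l \<le> \<gamma> i"
      unfolding \<gamma>_def using l \<open>\<forall>i<k. \<beta> i > 0\<close> by (intro member_le_sum) (auto intro: less_imp_le)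
    then show ?thesis using l by auto
  qed
  let ?b = "Min ((\<lambda>i. \<alpha> * \<beta> i) ` {..<k})"
  have fin: "finite ((\<lambda>i. \<alpha> * \<beta> i) ` {..<k})" "(\<lambda>i. \<alpha> * \<beta> i) ` {..<k} \<noteq> {}"
    using \<open>k \<ge> 1\<close> by (auto simp: lessThan_empty_iff)
  show ?thesis
    unfolding M_def
  proof (rule regular_boundary_atoms[of G \<gamma>])
    show "G \<in> space (prob_algebra (restrict_space borel \<Theta>))"
      using assms by simp
    show "measure G B = (\<Sum>i<n. \<gamma> i * indicator B (e i))" if "B \<in> sets (restrict_space borel \<Theta>)" for B
      using that assms(9) merge[of "indicator B"] by (simp add: M_def)
    show "0 < \<gamma> i" if "i < n" for i
      using heavy[OF that] \<open>\<forall>i<k. \<beta> i > 0\<close> by (meson less_le_trans)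
    show "(\<Sum>i<n. \<gamma> i) = 1" using merge[of "\<lambda>_. 1"] \<open>(\<Sum>i<k. \<beta> i) = 1\<close> by simp
    have "?b \<in> (\<lambda>i. \<alpha> * \<beta> i) ` {..<k}" using fin by (rule Min_in)
    then show "0 < ?b" using \<open>0 < \<alpha>\<close> \<open>\<forall>i<k. \<beta> i > 0\<close> by auto
    show "?b \<le> \<alpha> * \<gamma> i" if i: "i < n" for i
    proof -
      obtain l where l: "l < k" "\<beta> l \<le> \<gamma> i" using heavy[OF i] by auto
      have "?b \<le> \<alpha> * \<beta> l" using fin l by (intro Min_le) auto
      also have "\<dots> \<le> \<alpha> * \<gamma> i" using l \<open>0 < \<alpha>\<close> by (intro mult_left_mono) auto
      finally show ?thesis .
    qed
  qed (use \<open>0 < \<alpha>\<close> \<open>\<alpha> \<le> 1\<close> \<open>0 < \<alpha>0\<close> in auto)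
qed

end
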